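(* Let $\Sigma$ be a system of ODEs $$\Sigma=\begin{cases}\mathbf{x}'=\mathbf{f}(\mathbf{x},\bm{\mu},\mathbf{u}),\\ \mathbf{y}=\mathbf{g}(\mathbf{x},\bm{\mu},\mathbf{u}),\\ \mathbf{x}(0)=\mathbf{x}^\ast,\end{cases}$$ where the entries of $\mathbf{f}=(f_1,\ldots,f_n)$ and $\mathbf{g}=(g_1,\ldots,g_m)$ are polynomials in $\mathbf{x},\mathbf{u}$ over $\mathbb{C}(\bm{\mu})$ of degree at most one, and assume $m=1$ (that is, there is a single output). Then for every $h\in\mathbb{C}(\bm{\mu})$: $h$ is identifiable if and only if $h$ is IO-identifiable.
   Context: **Systems.** $\lambda,n,m,\kappa$ are positive integers; $\bm{\mu}=(\mu_1,\ldots,\mu_\lambda)$ (parameters, indeterminates), $\mathbf{x}=(x_1,\ldots,x_n)$ (states), $\mathbf{y}=(y_1,\ldots,y_m)$ (outputs), $\mathbf{u}=(u_1,\ldots,u_\kappa)$ (inputs). **Identifiability.** $\mathbb{C}^\infty(0)$ is the set of all functions complex analytic in some neighborhood of $t=0$. $\Omega\subset\mathbb{C}^\lambda$ is the complement of the set where at least one of the denominators of the coefficients (in $\mathbb{C}(\bm{\mu})$) of $\Sigma$ vanishes. For $h\in\mathbb{C}(\bm{\mu})$ put $\Omega_h:=\mathbb{C}^n\times\{\hat{\bm{\mu}}\in\Omega\mid h(\hat{\bm{\mu}})\text{ well-defined}\}\times(\mathbb{C}^\infty(0))^\kappa$. For $(\hat{\mathbf{x}}^\ast,\hat{\bm{\mu}},\hat{\mathbf{u}})$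 with $\hat{\bm{\mu}}\in\Omega$, $Y(\hat{\mathbf{x}}^\ast,\hat{\bm{\mu}},\hat{\mathbf{u}})$ denotes the $\mathbf{y}$-component of the unique solution over $\mathbb{C}^\infty(0)$ of $\Sigma$ with $\mathbf{x}^\ast=\hat{\mathbf{x}}^\ast$, $\bm{\mu}=\hat{\bm{\mu}}$, $\mathbf{u}=\hat{\mathbf{u}}$. A subset of $\mathbb{C}^s$ is Zariski open if it is the complement of the zero set of some polynomial $P$ on $\mathbb{C}^s$; a subset $U\subset(\mathbb{C}^\infty(0))^s$ is Zariski open if there is a polynomial $P$ in $z_1,\ldots,z_s$ and their derivatives with $U=\{\hat{\mathbf z}\in(\mathbb{C}^\infty(0))^s\mid P(\hat{\mathbf z})|_{t=0}\neq0\}$. $\tau(X)$ denotes the set of nonempty Zariski open subsets of $X$. A function $h\in\mathbb{C}(\bm{\mu})$ is *identifiable* if there exist $\Theta\in\tau(\mathbb{C}^n\times\mathbb{C}^\lambda)$ and $U\in\tau((\mathbb{C}^\infty(0))^\kappa)$ such that for all $(\hat{\mathbf{x}}^\ast,\hat{\bm{\mu}},\hat{\mathbf{u}})\in(\Theta\times U)\cap\Omega_h$ one has $|S_h(\hat{\mathbf{x}}^\ast,\hat{\bm{\mu}},\hat{\mathbf{u}})|=1$, where $$S_h(\hat{\mathbf{x}}^\ast,\hat{\bm{\mu}},\hat{\mathbf{u}})=\{h(\tilde{\bm{\mu}})\mid\exists(\tilde{\mathbf{x}}^\ast,\tilde{\bm{\mu}},\hat{\mathbf{u}})\in\Omega_h\text{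 with }Y(\hat{\mathbf{x}}^\ast,\hat{\bm{\mu}},\hat{\mathbf{u}})=Y(\tilde{\mathbf{x}}^\ast,\tilde{\bm{\mu}},\hat{\mathbf{u}})\}.$$ **IO-identifiability.** For a field $K$, $K\{z_1,\ldots,z_s\}$ is the differential polynomial ring $K[z_j^{(i)}\mid i\ge0,1\le j\le s]$ with derivation $(z_j^{(i)})'=z_j^{(i+1)}$, zero on $K$; $\operatorname{ord}_{z_j}P$ is the order of the highest derivative of $z_j$ appearing in $P$ ($-\infty$ if none); $[F]$ is the smallest differential ideal containing $F$. Put $I_\Sigma=[\mathbf{x}'-\mathbf{f},\mathbf{y}-\mathbf{g}]\subset\mathbb{C}(\bm{\mu})\{\mathbf{x},\mathbf{y},\mathbf{u}\}$. "Linear" differential polynomial means of total degree at most one (a constant term is allowed). A tuple $(p_1,\ldots,p_m)$ in $\mathbb{C}(\bm{\mu})\{\mathbf{y},\mathbf{u}\}$ is a *full set of input-output equations* if, for some ordering of the outputs, written $y_1<\cdots<y_m$: (1) $p_1$ is the linear differential polynomial in $y_1$ and $\mathbf{u}$ in $I_\Sigma$ of the smallest possible order in $y_1$ such that the coefficient of the highest derivative of $y_1$ is one; (2) for every $\ell>1$, $p_\ell$ is the linear differential polynomial in $y_1,\ldots,y_\ell$ and $\mathbf{u}$ in $I_\Sigma$ such that $\operatorname{ord}_{y_j}p_\ell<\operatorname{ord}_{y_j}p_j$ for all $1\le j<\ell$, the coefficient of the highest derivative of $y_\ell$ in $p_\ell$ is $1$, and $\operatorname{ord}_{y_\ell}p_\ell$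 is the smallest possible. (For $m=1$ this is the single polynomial $p_1$.) The *field of IO-identifiable functions* is the subfield of $\mathbb{C}(\bm{\mu})$ generated over $\mathbb{C}$ by the coefficients of a full set of input-output equations (it does not depend on the choice of the full set); $h\in\mathbb{C}(\bm{\mu})$ is *IO-identifiable* if it lies in this field. *)

theory Defs
  imports
    "HOL-Analysis.Analysis"
    "HOL-Library.Poly_Mapping"
    "HOL-Library.Extended"
    "HOL-Computational_Algebra.Fraction_Field"
begin

section \<open>Polynomials and rational functions in several variables\<close>

type_synonym ('v, 'a) mpoly = "('v \<Rightarrow>\<^sub>0 nat) \<Rightarrow>\<^sub>0 'a"

definition mp_const :: "'a::zero \<Rightarrow> ('v, 'a) mpoly" where
  "mp_const c = Poly_Mapping.single 0 c"

definition mp_var :: "'v \<Rightarrow> ('v, 'a::{zero,one}) mpoly" where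
  "mp_var v = Poly_Mapping.single (Poly_Mapping.single v 1) 1"

text \<open>Evaluation: apply \<open>c\<close> to the coefficients and substitute \<open>a v\<close> for the variable \<open>v\<close>.\<close>

definition mp_eval ::
  "('a::zero \<Rightarrow> 'b::comm_semiring_1) \<Rightarrow> ('v \<Rightarrow> 'b) \<Rightarrow> ('v, 'a) mpoly \<Rightarrow> 'b" where
  "mp_eval c a p =
     (\<Sum>m\<in>Poly_Mapping.keys p. c (Poly_Mapping.lookup p m) *
        (\<Prod>v\<in>Poly_Mapping.keys m. a v ^ Poly_Mapping.lookup m v))"

definition mp_vars :: "('v, 'a::zero) mpoly \<Rightarrow> 'v set" where
  "mp_vars p = (\<Union>m\<in>Poly_Mapping.keys p. Poly_Mapping.keys m)"

definition total_degree :: "('v, 'a::zero) mpoly \<Rightarrow> nat" where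
  "total_degree p =
     Max (insert 0 ((\<lambda>m. \<Sum>v\<in>Poly_Mapping.keys m. Poly_Mapping.lookup m v) ` Poly_Mapping.keys p))"

text \<open>
  The field \<open>\<complex>(\<mu>)\<close>, with the parameters indexed by the type \<open>'l\<close>.  The library makes
  polynomials an integral domain only for linearly ordered indeterminates, hence the
  sort \<open>linorder\<close> on \<open>'l\<close> below; the order itself plays no role.
\<close>

type_synonym 'l ratfun = "('l, complex) mpoly fract"

definition rf_const :: "complex \<Rightarrow> 'l::linorder ratfun" where
  "rf_const c = Fract (mp_const c) 1"

text \<open>
  A rational function is well-defined at a point if it is a quotient of polynomials whose
  denominator does not vanish there.  By unique factorization this means that its denominator
  in lowest terms does not vanish.
\<close>

definition rf_defined :: "'l::linorder ratfun \<Rightarrow> ('l \<Rightarrow> complex) \<Rightarrow> bool" where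
  "rf_defined h a \<longleftrightarrow> (\<exists>p q. h = Fract p q \<and> mp_eval id a q \<noteq> 0)"

definition rf_eval :: "('l \<Rightarrow> complex) \<Rightarrow> 'l::linorder ratfun \<Rightarrow> complex" where
  "rf_eval a h =
     (THE w. \<exists>p q. h = Fract p q \<and> mp_eval id a q \<noteq> 0 \<and> w = mp_eval id a p / mp_eval id a q)"

definition is_subfield :: "'a::field set \<Rightarrow> bool" where
  "is_subfield F \<longleftrightarrow>
     0 \<in> F \<and> 1 \<in> F \<and>
     (\<forall>a\<in>F. \<forall>b\<in>F. a + b \<in> F \<and> a * b \<in> F) \<and>
     (\<forall>a\<in>F. - a \<in> F \<and> inverse a \<in> F)"

definition field_generated :: "'a::field set \<Rightarrow> 'a set" where
  "field_generated A = \<Inter>{F. is_subfield F \<and> A \<subseteq> F}"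


section \<open>Differential polynomials\<close>

text \<open>The indeterminate \<open>(z, i)\<close> stands for the \<open>i\<close>-th derivative of \<open>z\<close>.\<close>

type_synonym ('z, 'a) dpoly = "('z \<times> nat, 'a) mpoly"

text \<open>
  The derivation that vanishes on coefficients and sends \<open>(z, i)\<close> to \<open>(z, Suc i)\<close>, written out
  on monomials by the Leibniz rule.
\<close>

definition dp_deriv :: "('z, 'a::comm_ring_1) dpoly \<Rightarrow> ('z, 'a) dpoly" where
  "dp_deriv p =
     (\<Sum>m\<in>Poly_Mapping.keys p. \<Sum>v\<in>Poly_Mapping.keys m.
        Poly_Mapping.single
          (m - Poly_Mapping.single v 1 + Poly_Mapping.single (fst v, Suc (snd v)) 1)
          (of_nat (Poly_Mapping.lookup m v) * Poly_Mapping.lookup p m))"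

definition is_diff_ideal :: "('z, 'a::comm_ring_1) dpoly set \<Rightarrow> bool" where
  "is_diff_ideal I \<longleftrightarrow>
     0 \<in> I \<and> (\<forall>p\<in>I. \<forall>q\<in>I. p + q \<in> I) \<and> (\<forall>r. \<forall>p\<in>I. r * p \<in> I) \<and>
     (\<forall>p\<in>I. dp_deriv p \<in> I)"

definition diff_ideal_generated :: "('z, 'a::comm_ring_1) dpoly set \<Rightarrow> ('z, 'a) dpoly set" where
  "diff_ideal_generated F = \<Inter>{I. is_diff_ideal I \<and> F \<subseteq> I}"

definition dp_ord :: "'z \<Rightarrow> ('z, 'a::zero) dpoly \<Rightarrow> nat extended" where
  "dp_ord z p =
     (if \<exists>i. (z, i) \<in> mp_vars p then Fin (Max {i. (z, i) \<in> mp_vars p}) else Minf)"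


section \<open>Identifiability\<close>

text \<open>
  Elements of \<open>\<complex>\<^sup>\<infinity>(0)\<close> are represented by functions \<open>complex \<Rightarrow> complex\<close> that are analytic in a
  neighbourhood of 0; two of them are the same element if they agree near 0.

  A system is given by \<open>f\<close> and \<open>g\<close>, families of polynomials over \<open>\<complex>(\<mu>)\<close> in the
  states \<open>Inl i\<close> and the inputs \<open>Inr k\<close>.
\<close>

type_synonym ('n, 'k, 'l) syspoly = "('n + 'k, 'l ratfun) mpoly"

definition Omega ::
  "('n \<Rightarrow> ('n, 'k, 'l::linorder) syspoly) \<Rightarrow> ('m \<Rightarrow> ('n, 'k, 'l) syspoly) \<Rightarrow> ('l \<Rightarrow> complex) set"
where
  "Omega f g =
     {a. (\<forall>i m. rf_defined (Poly_Mapping.lookup (f i) m) a) \<and>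
         (\<forall>j m. rf_defined (Poly_Mapping.lookup (g j) m) a)}"

definition Omega_h ::
  "('n \<Rightarrow> ('n, 'k, 'l::linorder) syspoly) \<Rightarrow> ('m \<Rightarrow> ('n, 'k, 'l) syspoly) \<Rightarrow> 'l ratfun \<Rightarrow>
   (('n \<Rightarrow> complex) \<times> ('l \<Rightarrow> complex) \<times> ('k \<Rightarrow> complex \<Rightarrow> complex)) set"
where
  "Omega_h f g h =
     {(x0, a, u). a \<in> Omega f g \<and> rf_defined h a \<and> (\<forall>k. u k analytic_on {0})}"

definition is_solution ::
  "('n \<Rightarrow> ('n, 'k, 'l::linorder) syspoly) \<Rightarrow> ('m \<Rightarrow> ('n, 'k, 'l) syspoly) \<Rightarrow>
   ('n \<Rightarrow> complex) \<Rightarrow> ('l \<Rightarrow> complex) \<Rightarrow> ('k \<Rightarrow> complex \<Rightarrow> complex) \<Rightarrow>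
   ('n \<Rightarrow> complex \<Rightarrow> complex) \<Rightarrow> ('m \<Rightarrow> complex \<Rightarrow> complex) \<Rightarrow> bool"
where
  "is_solution f g x0 a u x y \<longleftrightarrow>
     (\<forall>i. x i analytic_on {0}) \<and> (\<forall>j. y j analytic_on {0}) \<and>
     (\<forall>i. \<forall>\<^sub>F t in nhds 0.
        deriv (x i) t = mp_eval (rf_eval a) (case_sum (\<lambda>i. x i t) (\<lambda>k. u k t)) (f i)) \<and>
     (\<forall>j. \<forall>\<^sub>F t in nhds 0.
        y j t = mp_eval (rf_eval a) (case_sum (\<lambda>i. x i t) (\<lambda>k. u k t)) (g j)) \<and>
     (\<forall>i. x i 0 = x0 i)"

text \<open>A representative of the output; it is unique up to equality near 0.\<close>

definition Y_out ::
  "('n \<Rightarrow> ('n, 'k, 'l::linorder) syspoly) \<Rightarrow> ('m \<Rightarrow> ('n, 'k, 'l) syspoly) \<Rightarrow>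
   ('n \<Rightarrow> complex) \<Rightarrow> ('l \<Rightarrow> complex) \<Rightarrow> ('k \<Rightarrow> complex \<Rightarrow> complex) \<Rightarrow>
   ('m \<Rightarrow> complex \<Rightarrow> complex)"
where
  "Y_out f g x0 a u = (SOME y. \<exists>x. is_solution f g x0 a u x y)"

definition same_germs :: "('s \<Rightarrow> complex \<Rightarrow> complex) \<Rightarrow> ('s \<Rightarrow> complex \<Rightarrow> complex) \<Rightarrow> bool" where
  "same_germs y z \<longleftrightarrow> (\<forall>j. \<forall>\<^sub>F t in nhds 0. y j t = z j t)"

definition zariski_open :: "('s \<Rightarrow> complex) set \<Rightarrow> bool" where
  "zariski_open T \<longleftrightarrow> (\<exists>P :: ('s, complex) mpoly. T = {z. mp_eval id z P \<noteq> 0})"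

definition zariski_open_germs :: "('s \<Rightarrow> complex \<Rightarrow> complex) set \<Rightarrow> bool" where
  "zariski_open_germs U \<longleftrightarrow>
     (\<exists>P :: ('s, complex) dpoly.
        U = {z. (\<forall>j. z j analytic_on {0}) \<and>
                mp_eval id (\<lambda>(j, i). (deriv ^^ i) (z j) 0) P \<noteq> 0})"

definition S_h ::
  "('n \<Rightarrow> ('n, 'k, 'l::linorder) syspoly) \<Rightarrow> ('m \<Rightarrow> ('n, 'k, 'l) syspoly) \<Rightarrow> 'l ratfun \<Rightarrow>
   ('n \<Rightarrow> complex) \<Rightarrow> ('l \<Rightarrow> complex) \<Rightarrow> ('k \<Rightarrow> complex \<Rightarrow> complex) \<Rightarrow> complex set"
where
  "S_h f g h x0 a u =
     {rf_eval b h | b. \<exists>x1. (x1, b, u) \<in> Omega_h f g h \<and>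
        same_germs (Y_out f g x0 a u) (Y_out f g x1 b u)}"

text \<open>A point \<open>(x0, a)\<close> of \<open>\<complex>\<^sup>n \<times> \<complex>\<^sup>\<lambda>\<close> is the function \<open>case_sum x0 a\<close> on the disjoint sum of the
  index types.\<close>

definition identifiable ::
  "('n \<Rightarrow> ('n, 'k, 'l::linorder) syspoly) \<Rightarrow> ('m \<Rightarrow> ('n, 'k, 'l) syspoly) \<Rightarrow> 'l ratfun \<Rightarrow> bool"
where
  "identifiable f g h \<longleftrightarrow>
     (\<exists>(\<Theta> :: ('n + 'l \<Rightarrow> complex) set) (U :: ('k \<Rightarrow> complex \<Rightarrow> complex) set).
        zariski_open \<Theta> \<and> \<Theta> \<noteq> {} \<and> zariski_open_germs U \<and> U \<noteq> {} \<and>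
        (\<forall>x0 a u. case_sum x0 a \<in> \<Theta> \<and> u \<in> U \<and> (x0, a, u) \<in> Omega_h f g h \<longrightarrow>
           card (S_h f g h x0 a u) = 1))"


section \<open>IO-identifiability\<close>

datatype ('n, 'm, 'k) indet = State 'n | Output 'm | Input 'k

type_synonym ('n, 'm, 'k, 'l) iopoly = "(('n, 'm, 'k) indet, 'l ratfun) dpoly"

definition to_dpoly :: "('n, 'k, 'l::linorder) syspoly \<Rightarrow> ('n, 'm, 'k, 'l) iopoly" where
  "to_dpoly p =
     mp_eval mp_const (case_sum (\<lambda>i. mp_var (State i, 0)) (\<lambda>k. mp_var (Input k, 0))) p"

definition I_Sigma ::
  "('n \<Rightarrow> ('n, 'k, 'l::linorder) syspoly) \<Rightarrow> ('m \<Rightarrow> ('n, 'k, 'l) syspoly) \<Rightarrow>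
   ('n, 'm, 'k, 'l) iopoly set"
where
  "I_Sigma f g =
     diff_ideal_generated
       ((\<lambda>i. mp_var (State i, 1) - to_dpoly (f i)) ` UNIV \<union>
        (\<lambda>j. mp_var (Output j, 0) - to_dpoly (g j)) ` UNIV)"

text \<open>
  For \<open>p\<close> of total degree at most one: \<open>z\<close> occurs in \<open>p\<close>, and its highest derivative has
  coefficient one.
\<close>

definition monic_in :: "'z \<Rightarrow> ('z, 'a::{zero,one}) dpoly \<Rightarrow> bool" where
  "monic_in z p \<longleftrightarrow>
     (\<exists>i. dp_ord z p = Fin i \<and>
          Poly_Mapping.lookup p (Poly_Mapping.single (z, i) 1) = 1)"

text \<open>
  The outputs are ordered by \<open>\<sigma>\<close>, counted from 0.  The polynomials admitted as the
  \<open>l\<close>-th equation, given the preceding equations of the tuple \<open>p\<close> (indexed by outputs):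
\<close>

definition io_candidates ::
  "('n \<Rightarrow> ('n, 'k, 'l::linorder) syspoly) \<Rightarrow> ('m \<Rightarrow> ('n, 'k, 'l) syspoly) \<Rightarrow>
   (nat \<Rightarrow> 'm) \<Rightarrow> ('m \<Rightarrow> ('n, 'm, 'k, 'l) iopoly) \<Rightarrow> nat \<Rightarrow> ('n, 'm, 'k, 'l) iopoly set"
where
  "io_candidates f g \<sigma> p l =
     {q \<in> I_Sigma f g.
        total_degree q \<le> 1 \<and>
        mp_vars q \<subseteq> ((\<lambda>j. Output (\<sigma> j)) ` {..l} \<union> range Input) \<times> UNIV \<and>
        (\<forall>j<l. dp_ord (Output (\<sigma> j)) q < dp_ord (Output (\<sigma> j)) (p (\<sigma> j))) \<and>
        monic_in (Output (\<sigma> l)) q}"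

definition full_set_io_equations ::
  "('n \<Rightarrow> ('n, 'k, 'l::linorder) syspoly) \<Rightarrow> ('m::finite \<Rightarrow> ('n, 'k, 'l) syspoly) \<Rightarrow>
   ('m \<Rightarrow> ('n, 'm, 'k, 'l) iopoly) \<Rightarrow> bool"
where
  "full_set_io_equations f g p \<longleftrightarrow>
     (\<exists>\<sigma>. bij_betw \<sigma> {..<CARD('m)} UNIV \<and>
        (\<forall>l<CARD('m).
           p (\<sigma> l) \<in> io_candidates f g \<sigma> p l \<and>
           (\<forall>q \<in> io_candidates f g \<sigma> p l.
              dp_ord (Output (\<sigma> l)) (p (\<sigma> l)) \<le> dp_ord (Output (\<sigma> l)) q)))"

definition io_field :: "('m \<Rightarrow> ('n, 'm, 'k, 'l::linorder) iopoly) \<Rightarrow> 'l ratfun set" where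
  "io_field p = field_generated (range rf_const \<union> (\<Union>j. range (Poly_Mapping.lookup (p j))))"

definition IO_identifiable ::
  "('n \<Rightarrow> ('n, 'k, 'l::linorder) syspoly) \<Rightarrow> ('m::finite \<Rightarrow> ('n, 'k, 'l) syspoly) \<Rightarrow>
   'l ratfun \<Rightarrow> bool"
where
  "IO_identifiable f g h \<longleftrightarrow> (\<exists>p. full_set_io_equations f g p \<and> h \<in> io_field p)"

end

theory Submission
  imports Defs "HOL-Complex_Analysis.Complex_Analysis" "HOL-Computational_Algebra.Fundamental_Theorem_Algebra"
begin

text \<open>
  The \<open>i\<close>-th derivative of the output is a linear form \<open>\<nu>\<^sub>i\<close> over \<open>\<complex>(\<mu>)\<close> in the states, the inputs
  and \<open>1\<close>, plus derivatives of the inputs; the input-output equation is the first linear relation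
  between the state parts of \<open>\<nu>\<^sub>0, \<nu>\<^sub>1, \<dots>\<close>.

  Let \<open>h\<close> lie outside the field generated by its coefficients, and let \<open>k\<close> be a countable field of
  constants over which all the data are defined.  The homomorphism that evaluates the coefficients of
  the equation, extended to \<open>h\<close>, has two extensions with different values at \<open>h\<close>: a countable field
  leaves room for a second transcendental value, and a minimal polynomial has a second root.
  Extending both to \<open>k(\<mu>)\<close> yields two parameter values, generic over \<open>k\<close>, with the same
  input-output equation and different values of \<open>h\<close>.  As the state parts of
  \<open>\<nu>\<^sub>0, \<dots>, \<nu>\<^bsub>r-1\<^esub>\<close> stay independent, initial values can be chosen so that the outputs coincide.

  Conversely, for generic initial values and inputs the output satisfies only one equation of the
  relevant order.  A parameter value \<open>b\<close> with the same output, even one where the coefficients of the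
  equation might have poles, must therefore have independent \<open>\<nu>\<^sub>i\<close>, and Gaussian elimination over the
  local ring of \<open>b\<close> shows that the coefficients are defined at \<open>b\<close> and take the same values.
\<close>

section \<open>Evaluation of polynomials\<close>

text \<open>A homomorphism of fields is injective. Once \<open>k\<close> contains the coefficients
  of every polynomial that must not vanish, an embedding over \<open>k\<close> of the field
  generated by the parameters is evaluation at a point where none of them vanishes. This replaces
  arguments by dimension or density.

  Solutions are handled through their sequences of derivatives at 0, where the system becomes a
  linear recurrence and a differential operator with constant coefficients becomes a polynomial
  acting by shifts. The recurrence makes sense over any field. Over the complex numbers it describes
  analytic solutions; over the rational functions its solutions have free initial values and inputs,
  and evaluating the differential ideal at them determines its linear elements.

  The obstacle in the converse is that a single solution may satisfy equations that the system does
  not. They have to be excluded by polynomial conditions on the initial values, on \<open>a\<close>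
  and on the derivatives of the inputs, while \<open>b\<close> is an arbitrary admissible parameter
  value.\<close>

definition ring_hom_fun :: "('a::comm_ring_1 \<Rightarrow> 'b::comm_ring_1) \<Rightarrow> bool" where
  "ring_hom_fun c \<longleftrightarrow> c 0 = 0 \<and> c 1 = 1 \<and> (\<forall>x y. c (x + y) = c x + c y) \<and> (\<forall>x y. c (x * y) = c x * c y)"

lemma ring_hom_funD:
  assumes "ring_hom_fun c"
  shows "c 0 = 0" "c 1 = 1" "c (x + y) = c x + c y" "c (x * y) = c x * c y"
  using assms by (auto simp: ring_hom_fun_def)

lemma ring_hom_fun_id [simp]: "ring_hom_fun id"
  by (simp add: ring_hom_fun_def)

definition mon_eval :: "('v \<Rightarrow> 'b::comm_semiring_1) \<Rightarrow> ('v \<Rightarrow>\<^sub>0 nat) \<Rightarrow> 'b" where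
  "mon_eval a m = (\<Prod>v\<in>Poly_Mapping.keys m. a v ^ Poly_Mapping.lookup m v)"

lemma mon_eval_superset:
  assumes "finite S" "Poly_Mapping.keys m \<subseteq> S"
  shows "mon_eval a m = (\<Prod>v\<in>S. a v ^ Poly_Mapping.lookup m v)"
  unfolding mon_eval_def
  by (rule prod.mono_neutral_left[OF assms]) (auto simp: in_keys_iff)

lemma mon_eval_add: "mon_eval a (m + m') = mon_eval a m * mon_eval a m'"
proof -
  let ?S = "Poly_Mapping.keys m \<union> Poly_Mapping.keys m'"
  have "Poly_Mapping.keys (m + m') \<subseteq> ?S" by (rule keys_add)
  then have "mon_eval a (m + m') = (\<Prod>v\<in>?S. a v ^ Poly_Mapping.lookup (m + m') v)"
    by (intro mon_eval_superset) auto
  moreover have "mon_eval a m = (\<Prod>v\<in>?S. a v ^ Poly_Mapping.lookup m v)"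
    "mon_eval a m' = (\<Prod>v\<in>?S. a v ^ Poly_Mapping.lookup m' v)"
    by (intro mon_eval_superset; auto)+
  ultimately show ?thesis by (simp add: lookup_add power_add prod.distrib)
qed

lemma mon_eval_zero [simp]: "mon_eval a 0 = 1"
  by (simp add: mon_eval_def)

lemma mon_eval_single [simp]: "mon_eval a (Poly_Mapping.single v n) = a v ^ n"
  by (cases "n = 0") (auto simp: mon_eval_def)

lemma mp_eval_superset:
  assumes "finite S" "Poly_Mapping.keys p \<subseteq> S" "c 0 = 0"
  shows "mp_eval c a p = (\<Sum>m\<in>S. c (Poly_Mapping.lookup p m) * mon_eval a m)"
  unfolding mp_eval_def mon_eval_def
  by (rule sum.mono_neutral_left[OF assms(1,2)]) (auto simp: in_keys_iff assms(3))

lemma mp_eval_single: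
  assumes "c 0 = 0"
  shows "mp_eval c a (Poly_Mapping.single m x) = c x * mon_eval a m"
  using mp_eval_superset[of "{m}" "Poly_Mapping.single m x" c a] assms
  by (auto simp: split: if_splits)

lemma mp_eval_zero [simp]: "mp_eval c a 0 = 0"
  by (simp add: mp_eval_def)

lemma mp_eval_add:
  assumes "ring_hom_fun c"
  shows "mp_eval c a (p + q) = mp_eval c a p + mp_eval c a q"
proof -
  note c = ring_hom_funD[OF assms]
  let ?S = "Poly_Mapping.keys p \<union> Poly_Mapping.keys q"
  have "Poly_Mapping.keys (p + q) \<subseteq> ?S" by (rule keys_add)
  then have "mp_eval c a (p + q) = (\<Sum>m\<in>?S. c (Poly_Mapping.lookup (p + q) m) * mon_eval a m)"
    by (intro mp_eval_superset) (auto simp: c)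
  moreover have "mp_eval c a p = (\<Sum>m\<in>?S. c (Poly_Mapping.lookup p m) * mon_eval a m)"
    "mp_eval c a q = (\<Sum>m\<in>?S. c (Poly_Mapping.lookup q m) * mon_eval a m)"
    by (intro mp_eval_superset; auto simp: c)+
  ultimately show ?thesis by (simp add: lookup_add c sum.distrib distrib_right)
qed

lemma mp_eval_sum:
  assumes "ring_hom_fun c"
  shows "mp_eval c a (\<Sum>i\<in>I. p i) = (\<Sum>i\<in>I. mp_eval c a (p i))"
  by (induction I rule: infinite_finite_induct) (auto simp: mp_eval_add[OF assms])

lemma poly_mapping_sum_single:
  "p = (\<Sum>m\<in>Poly_Mapping.keys p. Poly_Mapping.single m (Poly_Mapping.lookup p m))"
  by (rule poly_mapping_eqI) (auto simp: lookup_sum lookup_single when_def in_keys_iff sum.delta)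

lemma mp_eval_mult:
  assumes "ring_hom_fun c"
  shows "mp_eval c a (p * q) = mp_eval c a p * mp_eval c a q"
proof -
  note c = ring_hom_funD[OF assms]
  let ?s = "\<lambda>p m. Poly_Mapping.single m (Poly_Mapping.lookup p m)"
  have "mp_eval c a (p * q) =
      mp_eval c a ((\<Sum>m\<in>Poly_Mapping.keys p. ?s p m) * (\<Sum>m\<in>Poly_Mapping.keys q. ?s q m))"
    using poly_mapping_sum_single[of p] poly_mapping_sum_single[of q] by simp
  also have "\<dots> = (\<Sum>m\<in>Poly_Mapping.keys p. \<Sum>m'\<in>Poly_Mapping.keys q.
      mp_eval c a (?s p m) * mp_eval c a (?s q m'))"
    by (simp add: sum_product mp_eval_sum[OF assms] mult_single mp_eval_single c mon_eval_add ac_simps)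
  also have "\<dots> = mp_eval c a p * mp_eval c a q"
    by (simp add: sum_product[symmetric] mp_eval_sum[OF assms, symmetric] poly_mapping_sum_single[symmetric])
  finally show ?thesis .
qed

lemma mp_eval_const: "c 0 = 0 \<Longrightarrow> mp_eval c a (mp_const x) = c x"
  by (simp add: mp_const_def mp_eval_single)

lemma mp_eval_var: "ring_hom_fun c \<Longrightarrow> mp_eval c a (mp_var v) = a v"
  by (simp add: mp_var_def mp_eval_single ring_hom_funD)

lemma mp_eval_one: "ring_hom_fun c \<Longrightarrow> mp_eval c a 1 = 1"
  using mp_eval_const[of c a 1] by (simp add: mp_const_def ring_hom_funD)

lemma mp_eval_uminus:
  assumes "ring_hom_fun c"
  shows "mp_eval c a (- p) = - mp_eval c a p"
  using mp_eval_add[OF assms, of a p "- p"] by (simp add: eq_neg_iff_add_eq_0 add.commute)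

lemma mp_eval_diff:
  assumes "ring_hom_fun c"
  shows "mp_eval c a (p - q) = mp_eval c a p - mp_eval c a q"
  using mp_eval_add[OF assms, of a p "- q"] mp_eval_uminus[OF assms] by simp

lemma ring_hom_fun_uminus: "ring_hom_fun c \<Longrightarrow> c (- x) = - c x"
  using ring_hom_funD(3)[of c x "-x"] by (simp add: ring_hom_funD(1) eq_neg_iff_add_eq_0 add.commute)

lemma ring_hom_fun_sum: "ring_hom_fun c \<Longrightarrow> c (sum f I) = (\<Sum>i\<in>I. c (f i))"
  by (induction I rule: infinite_finite_induct) (auto simp: ring_hom_funD)

lemma mp_const_hom: "ring_hom_fun (mp_const :: 'a::comm_ring_1 \<Rightarrow> ('v,'a) mpoly)"
  by (auto simp: ring_hom_fun_def mp_const_def single_add mult_single)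

lemma total_degree_le_1_keys:
  assumes "total_degree p \<le> 1" "m \<in> Poly_Mapping.keys p"
  shows "m = 0 \<or> (\<exists>v. m = Poly_Mapping.single v 1)"
proof -
  let ?d = "\<lambda>m. \<Sum>v\<in>Poly_Mapping.keys m. Poly_Mapping.lookup m v"
  have "?d m \<le> total_degree p"
    unfolding total_degree_def using assms(2) by (intro Max_ge) auto
  then have d: "?d m \<le> 1" using assms(1) by simp
  show ?thesis
  proof (cases "m = 0")
    case False
    then obtain v where v: "v \<in> Poly_Mapping.keys m" by fastforce
    have "?d m = Poly_Mapping.lookup m v + (\<Sum>v\<in>Poly_Mapping.keys m - {v}. Poly_Mapping.lookup m v)"
      using v by (simp add: sum.remove)
    moreover have "Poly_Mapping.lookup m v \<ge> 1" using v by (simp add: in_keys_iff)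
    ultimately have 1: "Poly_Mapping.lookup m v = 1"
      "(\<Sum>v\<in>Poly_Mapping.keys m - {v}. Poly_Mapping.lookup m v) = 0"
      using d by linarith+
    have "Poly_Mapping.lookup m w = 0" if "w \<noteq> v" for w
    proof (cases "w \<in> Poly_Mapping.keys m")
      case True
      then have "Poly_Mapping.lookup m w \<le> (\<Sum>v\<in>Poly_Mapping.keys m - {v}. Poly_Mapping.lookup m v)"
        using that by (intro member_le_sum) auto
      then show ?thesis using 1 by simp
    qed (simp add: in_keys_iff)
    then have "m = Poly_Mapping.single v 1"
      using 1 by (intro poly_mapping_eqI) (auto simp: lookup_single when_def)
    then show ?thesis by blast
  qed auto
qed

abbreviation lin_coeff :: "('v, 'a::zero) mpoly \<Rightarrow> 'v \<Rightarrow> 'a" where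
  "lin_coeff p v \<equiv> Poly_Mapping.lookup p (Poly_Mapping.single v 1)"

lemma lin_coeff_nonzero_vars: "lin_coeff p v \<noteq> 0 \<Longrightarrow> v \<in> mp_vars p"
  unfolding mp_vars_def
  by (rule UN_I[of "Poly_Mapping.single v 1"]) (simp_all add: in_keys_iff)

lemma total_degree_le_1_vars:
  assumes "total_degree p \<le> 1"
  shows "mp_vars p = {v. lin_coeff p v \<noteq> 0}"
proof
  show "mp_vars p \<subseteq> {v. lin_coeff p v \<noteq> 0}"
  proof
    fix v assume "v \<in> mp_vars p"
    then obtain m where m: "m \<in> Poly_Mapping.keys p" "v \<in> Poly_Mapping.keys m"
      by (auto simp: mp_vars_def)
    with total_degree_le_1_keys[OF assms m(1)] have "Poly_Mapping.single v 1 \<in> Poly_Mapping.keys p"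
      by (auto split: if_splits)
    then show "v \<in> {v. lin_coeff p v \<noteq> 0}"
      by (simp add: in_keys_iff)
  qed
qed (auto intro: lin_coeff_nonzero_vars)

lemma finite_mp_vars [simp]: "finite (mp_vars p)"
  by (simp add: mp_vars_def)

text \<open>The set \<open>V\<close> may exceed the variables that occur, so that one can sum over
  all states and inputs at once.\<close>

lemma mp_eval_degree_le_1:
  assumes deg: "total_degree p \<le> 1" and c: "c 0 = 0" and V: "finite V" "mp_vars p \<subseteq> V"
  shows "mp_eval c a p = c (Poly_Mapping.lookup p 0) + (\<Sum>v\<in>V. c (lin_coeff p v) * a v)"
proof -
  let ?g = "\<lambda>v. Poly_Mapping.single v (1::nat)"
  have inj: "inj_on ?g V"
  proof (rule inj_onI)
    fix v w assume "?g v = ?g w"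
    then have "Poly_Mapping.keys (?g v) = Poly_Mapping.keys (?g w)" by (rule arg_cong)
    then show "v = w" by simp
  qed
  have sub: "Poly_Mapping.keys p \<subseteq> insert 0 (?g ` V)"
  proof
    fix m assume m: "m \<in> Poly_Mapping.keys p"
    show "m \<in> insert 0 (?g ` V)"
    proof (cases "m = 0")
      case False
      then obtain v where v: "m = ?g v" using total_degree_le_1_keys[OF deg m] by auto
      with m have "v \<in> mp_vars p" unfolding mp_vars_def by (intro UN_I[of m]) auto
      then show ?thesis using V v by auto
    qed auto
  qed
  have "?g v \<noteq> 0" for v :: 'a
    using keys_eq_empty[of "?g v"] by (simp del: keys_eq_empty)
  then have n0: "0 \<notin> ?g ` V" by force
  have "mp_eval c a p = (\<Sum>m\<in>insert 0 (?g ` V). c (Poly_Mapping.lookup p m) * mon_eval a m)"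
    by (rule mp_eval_superset) (use V sub c in auto)
  also have "\<dots> = c (Poly_Mapping.lookup p 0) + (\<Sum>m\<in>?g ` V. c (Poly_Mapping.lookup p m) * mon_eval a m)"
    using n0 V by (subst sum.insert) auto
  also have "(\<Sum>m\<in>?g ` V. c (Poly_Mapping.lookup p m) * mon_eval a m) = (\<Sum>v\<in>V. c (lin_coeff p v) * a v)"
    by (subst sum.reindex[OF inj]) simp
  finally show ?thesis .
qed

lemma total_degree_le_1I:
  assumes "\<And>m. m \<in> Poly_Mapping.keys p \<Longrightarrow> m = 0 \<or> (\<exists>v. m = Poly_Mapping.single v 1)"
  shows "total_degree p \<le> 1"
  unfolding total_degree_def
proof (subst Max_le_iff, simp, simp, safe)
  fix m assume "m \<in> Poly_Mapping.keys p"
  from assms[OF this] show "(\<Sum>v\<in>Poly_Mapping.keys m. Poly_Mapping.lookup m v) \<le> 1"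
    by auto
qed

section \<open>Polynomial functions\<close>

text \<open>Zariski open sets depend only on the function induced by a polynomial. For functions,
  closure under substitution needs no substitution on formal polynomials.\<close>

definition poly_fun :: "(('v \<Rightarrow> complex) \<Rightarrow> complex) \<Rightarrow> bool" where
  "poly_fun \<phi> \<longleftrightarrow> (\<exists>P :: ('v, complex) mpoly. \<phi> = (\<lambda>z. mp_eval id z P))"

lemma poly_fun_const [intro]: "poly_fun (\<lambda>z. c)"
  unfolding poly_fun_def by (rule exI[of _ "mp_const c"]) (simp add: mp_eval_const)

lemma poly_fun_var [intro]: "poly_fun (\<lambda>z. z v)"
  unfolding poly_fun_def by (rule exI[of _ "mp_var v"]) (simp add: mp_eval_var)

lemma poly_fun_add [intro]: "poly_fun \<phi> \<Longrightarrow> poly_fun \<psi> \<Longrightarrow> poly_fun (\<lambda>z. \<phi> z + \<psi> z)"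
  unfolding poly_fun_def
proof (elim exE)
  fix P Q :: "('a, complex) mpoly"
  assume "\<phi> = (\<lambda>z. mp_eval id z P)" "\<psi> = (\<lambda>z. mp_eval id z Q)"
  then show "\<exists>P. (\<lambda>z. \<phi> z + \<psi> z) = (\<lambda>z. mp_eval id z P)"
    by (intro exI[of _ "P + Q"]) (simp add: mp_eval_add)
qed

lemma poly_fun_mult [intro]: "poly_fun \<phi> \<Longrightarrow> poly_fun \<psi> \<Longrightarrow> poly_fun (\<lambda>z. \<phi> z * \<psi> z)"
  unfolding poly_fun_def
proof (elim exE)
  fix P Q :: "('a, complex) mpoly"
  assume "\<phi> = (\<lambda>z. mp_eval id z P)" "\<psi> = (\<lambda>z. mp_eval id z Q)"
  then show "\<exists>P. (\<lambda>z. \<phi> z * \<psi> z) = (\<lambda>z. mp_eval id z P)"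
    by (intro exI[of _ "P * Q"]) (simp add: mp_eval_mult)
qed

lemma poly_fun_sum: "(\<And>i. i \<in> I \<Longrightarrow> poly_fun (\<phi> i)) \<Longrightarrow> poly_fun (\<lambda>z. \<Sum>i\<in>I. \<phi> i z)"
  by (induction I rule: infinite_finite_induct) auto

lemma poly_fun_prod: "(\<And>i. i \<in> I \<Longrightarrow> poly_fun (\<phi> i)) \<Longrightarrow> poly_fun (\<lambda>z. \<Prod>i\<in>I. \<phi> i z)"
  by (induction I rule: infinite_finite_induct) auto

lemma poly_fun_power: "poly_fun \<phi> \<Longrightarrow> poly_fun (\<lambda>z. \<phi> z ^ n)"
  by (induction n) auto

lemma poly_fun_mp_eval: 
  assumes "\<And>v. poly_fun (\<lambda>z. \<phi> v z)"
  shows "poly_fun (\<lambda>z. mp_eval id (\<lambda>v. \<phi> v z) P)"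
  unfolding mp_eval_def 
  by (intro poly_fun_sum poly_fun_mult poly_fun_const poly_fun_prod poly_fun_power assms)

text \<open>One denominator has to serve wherever it is nonzero, not only near \<open>z0\<close>.
  Thus the nonvanishing of finitely many polynomials carries a statement from \<open>z0\<close> to a
  whole Zariski open set.\<close>

definition regular_at :: "('v \<Rightarrow> complex) \<Rightarrow> (('v \<Rightarrow> complex) \<Rightarrow> complex) \<Rightarrow> bool" where
  "regular_at z0 \<phi> \<longleftrightarrow>
     (\<exists>p q. poly_fun p \<and> poly_fun q \<and> q z0 \<noteq> 0 \<and> (\<forall>z. q z \<noteq> 0 \<longrightarrow> \<phi> z = p z / q z))"

lemma regular_atI:
  "poly_fun p \<Longrightarrow> poly_fun q \<Longrightarrow> q z0 \<noteq> 0 \<Longrightarrow> (\<And>z. q z \<noteq> 0 \<Longrightarrow> \<phi> z = p z / q z) \<Longrightarrow> regular_at z0 \<phi>"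
  unfolding regular_at_def by blast

lemma regular_at_poly: "poly_fun \<phi> \<Longrightarrow> regular_at z0 \<phi>"
  unfolding regular_at_def by (rule exI[of _ \<phi>], rule exI[of _ "\<lambda>z. 1"]) auto

lemma regular_at_add:
  assumes "regular_at z0 \<phi>" "regular_at z0 \<psi>"
  shows "regular_at z0 (\<lambda>z. \<phi> z + \<psi> z)"
proof -
  obtain p q p' q' where "poly_fun p" "poly_fun q" "q z0 \<noteq> 0" "\<forall>z. q z \<noteq> 0 \<longrightarrow> \<phi> z = p z / q z"
    "poly_fun p'" "poly_fun q'" "q' z0 \<noteq> 0" "\<forall>z. q' z \<noteq> 0 \<longrightarrow> \<psi> z = p' z / q' z"
    using assms unfolding regular_at_def by blast
  then show ?thesis
    by (intro regular_atI[of "\<lambda>z. p z * q' z + p' z * q z" "\<lambda>z. q z * q' z"])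
       (auto simp: field_simps)
qed

lemma regular_at_mult:
  assumes "regular_at z0 \<phi>" "regular_at z0 \<psi>"
  shows "regular_at z0 (\<lambda>z. \<phi> z * \<psi> z)"
proof -
  obtain p q p' q' where "poly_fun p" "poly_fun q" "q z0 \<noteq> 0" "\<forall>z. q z \<noteq> 0 \<longrightarrow> \<phi> z = p z / q z"
    "poly_fun p'" "poly_fun q'" "q' z0 \<noteq> 0" "\<forall>z. q' z \<noteq> 0 \<longrightarrow> \<psi> z = p' z / q' z"
    using assms unfolding regular_at_def by blast
  then show ?thesis
    by (intro regular_atI[of "\<lambda>z. p z * p' z" "\<lambda>z. q z * q' z"]) auto
qed

lemma regular_at_uminus: "regular_at z0 \<phi> \<Longrightarrow> regular_at z0 (\<lambda>z. - \<phi> z)"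
  using regular_at_mult[OF regular_at_poly[OF poly_fun_const[of "-1"]], of z0 \<phi>] by simp

lemma regular_at_diff: "regular_at z0 \<phi> \<Longrightarrow> regular_at z0 \<psi> \<Longrightarrow> regular_at z0 (\<lambda>z. \<phi> z - \<psi> z)"
  using regular_at_add[OF _ regular_at_uminus, of z0 \<phi> \<psi>] by simp

lemma regular_at_sum: "(\<And>i. i \<in> I \<Longrightarrow> regular_at z0 (\<phi> i)) \<Longrightarrow> regular_at z0 (\<lambda>z. \<Sum>i\<in>I. \<phi> i z)"
  by (induction I rule: infinite_finite_induct) (auto intro: regular_at_add regular_at_poly)

text \<open>Gaussian elimination: only the pivots have to stay nonzero.\<close>

lemma independent_open:
  assumes "finite I" and "\<And>i s. i \<in> I \<Longrightarrow> regular_at z0 (v i s)"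
    and "\<And>c. (\<And>s. (\<Sum>i\<in>I. c i * v i s z0) = 0) \<Longrightarrow> (\<forall>i\<in>I. c i = 0)"
  shows "\<exists>P. poly_fun P \<and> P z0 \<noteq> 0 \<and>
    (\<forall>z. P z \<noteq> 0 \<longrightarrow> (\<forall>c. (\<forall>s. (\<Sum>i\<in>I. c i * v i s z) = 0) \<longrightarrow> (\<forall>i\<in>I. c i = 0)))"
  using assms
proof (induction I arbitrary: v rule: finite_induct)
  case empty
  then show ?case by (intro exI[of _ "\<lambda>z. 1"]) auto
next
  case (insert i0 I)
  have "\<exists>s. v i0 s z0 \<noteq> 0"
  proof (rule ccontr)
    assume n: "\<not> ?thesis"
    have "(\<Sum>i\<in>insert i0 I. (if i = i0 then 1 else 0) * v i s z0) = 0" for s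
      using n by (intro sum.neutral) auto
    from insert.prems(2)[OF this] show False by auto
  qed
  then obtain s0 where s0: "v i0 s0 z0 \<noteq> 0" by blast
  \<comment> \<open>Rows cleared of the coordinate \<open>s0\<close> by cross-multiplication with
    the pivot: no division occurs, so regularity is kept.\<close>
  define w where "w i s z = v i0 s0 z * v i s z - v i s0 z * v i0 s z" for i s z
  have elim: "(\<Sum>i\<in>I. c i * w i s z) =
      v i0 s0 z * (\<Sum>i\<in>I. c i * v i s z) - v i0 s z * (\<Sum>i\<in>I. c i * v i s0 z)" for c s z
    by (simp add: w_def sum_distrib_left sum_subtractf algebra_simps)
  have "\<exists>P. poly_fun P \<and> P z0 \<noteq> 0 \<and>
    (\<forall>z. P z \<noteq> 0 \<longrightarrow> (\<forall>c. (\<forall>s. (\<Sum>i\<in>I. c i * w i s z) = 0) \<longrightarrow> (\<forall>i\<in>I. c i = 0)))"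
  proof (rule insert.IH)
    show "regular_at z0 (w i s)" if "i \<in> I" for i s
      unfolding w_def using insert.prems(1) that
      by (intro regular_at_diff regular_at_mult) auto
  next
    fix c assume c: "\<And>s. (\<Sum>i\<in>I. c i * w i s z0) = 0"
    \<comment> \<open>The coordinate \<open>s0\<close> forces the coefficient of the pivot row; with
      it, a relation among the reduced rows extends to the original rows.\<close>
    define d where "d i = (if i = i0 then - (\<Sum>i\<in>I. c i * v i s0 z0) / v i0 s0 z0 else c i)" for i
    have I: "(\<Sum>i\<in>I. d i * x i) = (\<Sum>i\<in>I. c i * x i)" for x
      using insert.hyps by (intro sum.cong) (auto simp: d_def)
    have "(\<Sum>i\<in>insert i0 I. d i * v i s z0) = 0" for s
    proof -
      have "v i0 s0 z0 * (\<Sum>i\<in>I. c i * v i s z0) = v i0 s z0 * (\<Sum>i\<in>I. c i * v i s0 z0)"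
        using c[of s] by (simp add: elim)
      then show ?thesis using s0 insert.hyps by (simp add: I) (simp add: d_def field_simps)
    qed
    from insert.prems(2)[OF this] show "\<forall>i\<in>I. c i = 0"
      using insert.hyps by (auto simp: d_def split: if_splits)
  qed
  then obtain P where P: "poly_fun P" "P z0 \<noteq> 0"
    "\<And>z c. P z \<noteq> 0 \<Longrightarrow> (\<And>s. (\<Sum>i\<in>I. c i * w i s z) = 0) \<Longrightarrow> (\<forall>i\<in>I. c i = 0)"
    by blast
  obtain p q where pq: "poly_fun p" "poly_fun q" "q z0 \<noteq> 0" "\<And>z. q z \<noteq> 0 \<Longrightarrow> v i0 s0 z = p z / q z"
    using insert.prems(1)[of i0 s0] unfolding regular_at_def by auto
  have p0: "p z0 \<noteq> 0" using pq(3) pq(4)[of z0] s0 by auto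
  \<comment> \<open>Where the product is nonzero, \<open>q\<close> makes the pivot the quotient
    \<open>p / q\<close>, \<open>p\<close> makes it nonzero, and \<open>P\<close> keeps the reduced
    rows independent.\<close>
  show ?case
  proof (intro exI[of _ "\<lambda>z. P z * (p z * q z)"] conjI allI impI)
    show "poly_fun (\<lambda>z. P z * (p z * q z))" by (intro poly_fun_mult P pq)
    show "P z0 * (p z0 * q z0) \<noteq> 0" using P(2) pq(3) p0 by simp
    fix z c assume z: "P z * (p z * q z) \<noteq> 0" and c: "\<forall>s. (\<Sum>i\<in>insert i0 I. c i * v i s z) = 0"
    have piv: "v i0 s0 z \<noteq> 0" using z pq(4)[of z] by simp
    have rel: "(\<Sum>i\<in>I. c i * v i s z) = - (c i0 * v i0 s z)" for s
      using c insert.hyps by (simp add: eq_neg_iff_add_eq_0 add.commute)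
    have "(\<Sum>i\<in>I. c i * w i s z) = 0" for s
      by (simp add: elim rel)
    then have ci: "\<forall>i\<in>I. c i = 0" using P(3)[of z c] z by simp
    then have "c i0 * v i0 s0 z = 0" using rel[of s0] by simp
    then show "\<forall>i\<in>insert i0 I. c i = 0" using ci piv by auto
  qed
qed

section \<open>Values of rational functions\<close>

lemma rf_eval_Fract:
  fixes p q :: "('l::linorder, complex) mpoly"
  assumes "mp_eval id a q \<noteq> 0"
  shows "rf_eval a (Fract p q) = mp_eval id a p / mp_eval id a q"
  unfolding rf_eval_def
proof (rule the_equality)
  show "\<exists>p' q'. Fract p q = Fract p' q' \<and> mp_eval id a q' \<noteq> 0 \<and>
      mp_eval id a p / mp_eval id a q = mp_eval id a p' / mp_eval id a q'"
    using assms by blast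
next
  fix w assume "\<exists>p' q'. Fract p q = Fract p' q' \<and> mp_eval id a q' \<noteq> 0 \<and> w = mp_eval id a p' / mp_eval id a q'"
  then obtain p' q' where pq: "Fract p q = Fract p' q'" and nz: "mp_eval id a q' \<noteq> 0"
    and w: "w = mp_eval id a p' / mp_eval id a q'" by blast
  have "q \<noteq> 0" "q' \<noteq> 0" using assms nz by auto
  then have "p * q' = p' * q" using pq by (simp add: eq_fract)
  then have "mp_eval id a p * mp_eval id a q' = mp_eval id a p' * mp_eval id a q"
    by (metis mp_eval_mult ring_hom_fun_id)
  then show "w = mp_eval id a p / mp_eval id a q"
    unfolding w using assms nz by (simp add: frac_eq_eq)
qed

lemma rf_defined_Fract: "mp_eval id a q \<noteq> 0 \<Longrightarrow> rf_defined (Fract p q) a"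
  unfolding rf_defined_def by blast

lemma rf_definedE:
  assumes "rf_defined h a"
  obtains p q where "h = Fract p q" "q \<noteq> 0" "mp_eval id a q \<noteq> 0" "rf_eval a h = mp_eval id a p / mp_eval id a q"
proof -
  obtain p q where "h = Fract p q" "mp_eval id a q \<noteq> 0" using assms unfolding rf_defined_def by blast
  with rf_eval_Fract[of a q p] show ?thesis by (intro that[of p q]) auto
qed

lemma rf_const [simp]: "rf_defined (rf_const c) a" "rf_eval a (rf_const c) = c"
proof -
  have "mp_eval id a 1 \<noteq> 0" by (simp add: mp_eval_one)
  then show "rf_defined (rf_const c) a" "rf_eval a (rf_const c) = c"
    by (simp_all add: rf_const_def rf_defined_Fract rf_eval_Fract mp_eval_const mp_eval_one)
qed

lemma rf_const_0 [simp]: "rf_const 0 = 0" and rf_const_1 [simp]: "rf_const 1 = 1"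
  by (simp_all add: rf_const_def mp_const_def Zero_fract_def One_fract_def)

lemma rf_const_hom: "ring_hom_fun rf_const"
  by (simp add: ring_hom_fun_def) (simp add: rf_const_def mp_const_def single_add mult_single)

lemma rf_zero [simp]: "rf_defined 0 a" "rf_eval a 0 = 0"
  using rf_const[where c = 0 and a = a] by simp_all

lemma rf_one [simp]: "rf_defined 1 a" "rf_eval a 1 = 1"
  using rf_const[where c = 1 and a = a] by simp_all

lemma rf_add:
  assumes "rf_defined g a" "rf_defined h a"
  shows "rf_defined (g + h) a" "rf_eval a (g + h) = rf_eval a g + rf_eval a h"
proof -
  obtain p q p' q' where *: "g = Fract p q" "q \<noteq> 0" "mp_eval id a q \<noteq> 0" "rf_eval a g = mp_eval id a p / mp_eval id a q"
    "h = Fract p' q'" "q' \<noteq> 0" "mp_eval id a q' \<noteq> 0" "rf_eval a h = mp_eval id a p' / mp_eval id a q'"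
    using assms by (elim rf_definedE) blast
  then have s: "g + h = Fract (p * q' + p' * q) (q * q')" by simp
  have nz: "mp_eval id a (q * q') \<noteq> 0" using * by (simp add: mp_eval_mult)
  show "rf_defined (g + h) a" "rf_eval a (g + h) = rf_eval a g + rf_eval a h"
    unfolding s using nz rf_defined_Fract[OF nz] * 
    by (simp_all add: rf_eval_Fract mp_eval_mult mp_eval_add field_simps)
qed

lemma rf_mult:
  assumes "rf_defined g a" "rf_defined h a"
  shows "rf_defined (g * h) a" "rf_eval a (g * h) = rf_eval a g * rf_eval a h"
proof -
  obtain p q p' q' where *: "g = Fract p q" "q \<noteq> 0" "mp_eval id a q \<noteq> 0" "rf_eval a g = mp_eval id a p / mp_eval id a q"
    "h = Fract p' q'" "q' \<noteq> 0" "mp_eval id a q' \<noteq> 0" "rf_eval a h = mp_eval id a p' / mp_eval id a q'"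
    using assms by (elim rf_definedE) blast
  then have s: "g * h = Fract (p * p') (q * q')" by simp
  have nz: "mp_eval id a (q * q') \<noteq> 0" using * by (simp add: mp_eval_mult)
  show "rf_defined (g * h) a" "rf_eval a (g * h) = rf_eval a g * rf_eval a h"
    unfolding s using nz rf_defined_Fract[OF nz] * 
    by (simp_all add: rf_eval_Fract mp_eval_mult)
qed

lemma rf_uminus:
  fixes g :: "'l::linorder ratfun"
  assumes "rf_defined g a"
  shows "rf_defined (- g) a" "rf_eval a (- g) = - rf_eval a g"
proof -
  have "- g = rf_const (-1) * g"
    using ring_hom_fun_uminus[OF rf_const_hom[where 'a = 'l], of 1] by simp
  then show "rf_defined (- g) a" "rf_eval a (- g) = - rf_eval a g"
    using rf_mult[of "rf_const (-1)" a g] assms by auto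
qed

lemma rf_diff:
  assumes "rf_defined g a" "rf_defined h a"
  shows "rf_defined (g - h) a" "rf_eval a (g - h) = rf_eval a g - rf_eval a h"
  using rf_add[OF assms(1) rf_uminus(1)[OF assms(2)]] rf_uminus[OF assms(2)] by auto

lemma rf_inverse:
  assumes "rf_defined g a" "rf_eval a g \<noteq> 0"
  shows "rf_defined (inverse g) a" "rf_eval a (inverse g) = inverse (rf_eval a g)"
proof -
  obtain p q where *: "g = Fract p q" "mp_eval id a q \<noteq> 0" "rf_eval a g = mp_eval id a p / mp_eval id a q"
    using assms by (elim rf_definedE) blast
  then have nz: "mp_eval id a p \<noteq> 0" using assms by auto
  show "rf_defined (inverse g) a" "rf_eval a (inverse g) = inverse (rf_eval a g)"
    using * nz by (simp_all add: rf_defined_Fract rf_eval_Fract)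
qed

lemma rf_sum:
  assumes "\<And>i. i \<in> I \<Longrightarrow> rf_defined (f i) a"
  shows "rf_defined (\<Sum>i\<in>I. f i) a" "rf_eval a (\<Sum>i\<in>I. f i) = (\<Sum>i\<in>I. rf_eval a (f i))"
proof -
  have "rf_defined (\<Sum>i\<in>I. f i) a \<and> rf_eval a (\<Sum>i\<in>I. f i) = (\<Sum>i\<in>I. rf_eval a (f i))"
    using assms by (induction I rule: infinite_finite_induct) (auto simp: rf_add)
  then show "rf_defined (\<Sum>i\<in>I. f i) a" "rf_eval a (\<Sum>i\<in>I. f i) = (\<Sum>i\<in>I. rf_eval a (f i))" by auto
qed

lemma rf_denominator:
  fixes h :: "'l::linorder ratfun"
  obtains q where "q \<noteq> 0" "\<And>a. mp_eval id a q \<noteq> 0 \<Longrightarrow> rf_defined h a"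
proof -
  obtain p q where "h = Fract p q" "q \<noteq> 0" by (cases h)
  then show ?thesis by (intro that[of q]) (simp_all add: rf_defined_Fract)
qed

lemma rf_numerator:
  fixes h :: "'l::linorder ratfun"
  assumes "h \<noteq> 0"
  obtains q where "q \<noteq> 0" "\<And>a. mp_eval id a q \<noteq> 0 \<Longrightarrow> rf_defined h a \<and> rf_eval a h \<noteq> 0"
proof -
  obtain p q where h: "h = Fract p q" "q \<noteq> 0" by (cases h)
  have "p \<noteq> 0" using h assms by (auto simp: fract_collapse)
  then show ?thesis 
    by (intro that[of "p * q"]) (use h in \<open>auto simp: rf_defined_Fract rf_eval_Fract mp_eval_mult\<close>)
qed

lemma rf_common_denominator:
  assumes "finite (A :: 'l::linorder ratfun set)"
  obtains q where "q \<noteq> 0" "\<And>a h. mp_eval id a q \<noteq> 0 \<Longrightarrow> h \<in> A \<Longrightarrow> rf_defined h a"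
proof -
  have "\<exists>q. q \<noteq> 0 \<and> (\<forall>a h. mp_eval id a q \<noteq> 0 \<longrightarrow> h \<in> A \<longrightarrow> rf_defined h a)"
    using assms
  proof (induction A rule: finite_induct)
    case empty
    then show ?case by (intro exI[of _ 1]) auto
  next
    case (insert h A)
    then obtain q where q: "q \<noteq> 0" "\<And>a h. mp_eval id a q \<noteq> 0 \<Longrightarrow> h \<in> A \<Longrightarrow> rf_defined h a" by blast
    obtain q' where q': "q' \<noteq> 0" "\<And>a. mp_eval id a q' \<noteq> 0 \<Longrightarrow> rf_defined h a" using rf_denominator[of h] by blast
    have "mp_eval id a (q * q') = mp_eval id a q * mp_eval id a q'" for a by (simp add: mp_eval_mult)
    then have "mp_eval id a q \<noteq> 0 \<and> mp_eval id a q' \<noteq> 0" if "mp_eval id a (q * q') \<noteq> 0" for a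
      using that by simp
    moreover have "q * q' \<noteq> 0" using q q' by simp
    ultimately show ?case using q(2) q'(2) by blast
  qed
  then show ?thesis using that by blast
qed

text \<open>The map \<open>e\<close> picks the parameters out of the coordinates of a larger space,
  such as the space of initial values and parameters.\<close>

lemma regular_at_rf_eval:
  fixes \<kappa> :: "'l::linorder ratfun"
  assumes "rf_defined \<kappa> (\<lambda>l. z0 (e l))"
  shows "regular_at z0 (\<lambda>z. rf_eval (\<lambda>l. z (e l)) \<kappa>)"
proof -
  obtain p q where "\<kappa> = Fract p q" "mp_eval id (\<lambda>l. z0 (e l)) q \<noteq> 0"
    using assms by (elim rf_definedE) blast
  then show ?thesis
    by (intro regular_atI[of "\<lambda>z. mp_eval id (\<lambda>l. z (e l)) p" "\<lambda>z. mp_eval id (\<lambda>l. z (e l)) q"]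
       poly_fun_mp_eval poly_fun_var) (auto simp: rf_eval_Fract)
qed

text \<open>Gaussian elimination over the local ring of \<open>b\<close>: the pivots are units.\<close>

lemma local_solution:
  fixes v :: "'i \<Rightarrow> 's \<Rightarrow> 'l::linorder ratfun"
  assumes "finite I" and "\<And>i s. i \<in> I \<Longrightarrow> rf_defined (v i s) b" and "\<And>s. rf_defined (w s) b"
    and "\<And>c. (\<And>s. (\<Sum>i\<in>I. c i * rf_eval b (v i s)) = 0) \<Longrightarrow> (\<forall>i\<in>I. c i = 0)"
    and "\<And>s. w s = (\<Sum>i\<in>I. \<kappa> i * v i s)"
  shows "\<forall>i\<in>I. rf_defined (\<kappa> i) b"
  using assms
proof (induction I arbitrary: v w rule: finite_induct)
  case empty
  then show ?case by simp
next
  case (insert i0 I)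
  let ?e = "rf_eval b"
  have "\<exists>s. ?e (v i0 s) \<noteq> 0"
  proof (rule ccontr)
    assume n: "\<not> ?thesis"
    have "(\<Sum>i\<in>insert i0 I. (if i = i0 then 1 else 0) * ?e (v i s)) = 0" for s
      using n by (intro sum.neutral) auto
    from insert.prems(3)[OF this] show False by auto
  qed
  then obtain s0 where s0: "?e (v i0 s0) \<noteq> 0" by blast
  have def0: "rf_defined (v i0 s) b" for s using insert.prems(1) by simp
  define v' where "v' i s = v i0 s0 * v i s - v i s0 * v i0 s" for i s
  define w' where "w' s = v i0 s0 * w s - w s0 * v i0 s" for s
  have def': "rf_defined (v' i s) b" "?e (v' i s) = ?e (v i0 s0) * ?e (v i s) - ?e (v i s0) * ?e (v i0 s)"
    if "i \<in> I" for i s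
    unfolding v'_def using insert.prems(1) that by (simp_all add: rf_diff rf_mult)
  have IH: "\<forall>i\<in>I. rf_defined (\<kappa> i) b"
  proof (rule insert.IH)
    show "rf_defined (v' i s) b" if "i \<in> I" for i s using def' that by simp
    show "rf_defined (w' s) b" for s
      unfolding w'_def using insert.prems(2) def0 by (intro rf_diff rf_mult)
    show "w' s = (\<Sum>i\<in>I. \<kappa> i * v' i s)" for s
      using insert.hyps
      by (simp add: w'_def v'_def insert.prems(4) sum_distrib_left sum_distrib_right sum_subtractf algebra_simps)
  next
    fix c assume c: "\<And>s. (\<Sum>i\<in>I. c i * ?e (v' i s)) = 0"
    define d where "d i = (if i = i0 then - (\<Sum>i\<in>I. c i * ?e (v i s0)) / ?e (v i0 s0) else c i)" for i
    have I: "(\<Sum>i\<in>I. d i * x i) = (\<Sum>i\<in>I. c i * x i)" for x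
      using insert.hyps by (intro sum.cong) (auto simp: d_def)
    have "(\<Sum>i\<in>insert i0 I. d i * ?e (v i s)) = 0" for s
    proof -
      have "0 = (\<Sum>i\<in>I. c i * (?e (v i0 s0) * ?e (v i s) - ?e (v i s0) * ?e (v i0 s)))"
        using c[of s] def' by simp
      also have "\<dots> = ?e (v i0 s0) * (\<Sum>i\<in>I. c i * ?e (v i s)) - ?e (v i0 s) * (\<Sum>i\<in>I. c i * ?e (v i s0))"
        by (simp add: sum_distrib_left sum_subtractf algebra_simps)
      finally show ?thesis using s0 insert.hyps by (simp add: I) (simp add: d_def field_simps)
    qed
    from insert.prems(3)[OF this] show "\<forall>i\<in>I. c i = 0"
      using insert.hyps by (auto simp: d_def split: if_splits)
  qed
  have nz: "v i0 s0 \<noteq> 0" using s0 by auto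
  \<comment> \<open>The coordinate \<open>s0\<close> yields the remaining coefficient; the division
    by the pivot stays in the local ring, because the pivot is nonzero at \<open>b\<close>.\<close>
  have "w s0 - (\<Sum>i\<in>I. \<kappa> i * v i s0) = \<kappa> i0 * v i0 s0"
    using insert.hyps insert.prems(4)[of s0] by simp
  then have "\<kappa> i0 = (w s0 - (\<Sum>i\<in>I. \<kappa> i * v i s0)) * inverse (v i0 s0)"
    using nz by (simp add: field_simps)
  moreover have "rf_defined ((w s0 - (\<Sum>i\<in>I. \<kappa> i * v i s0)) * inverse (v i0 s0)) b"
    using IH insert.prems(1,2) s0 def0 by (intro rf_mult rf_diff rf_sum rf_inverse) auto
  ultimately show ?case using IH by simp
qed

section \<open>Linear algebra over finite index sets\<close>

text \<open>A certificate of independence that survives specialisation: where the finitely many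
  entries of \<open>L\<close> are defined, the identities persist and the evaluated rows stay
  independent. The same \<open>L\<close> solves for initial values with prescribed output
  derivatives.\<close>

lemma dual_family:
  fixes v :: "'i \<Rightarrow> 's::finite \<Rightarrow> 'a::field"
  assumes "finite I"
    and "\<And>c. (\<And>s. (\<Sum>i\<in>I. c i * v i s) = 0) \<Longrightarrow> (\<forall>i\<in>I. c i = 0)"
  shows "\<exists>L. \<forall>i\<in>I. \<forall>j\<in>I. (\<Sum>s\<in>UNIV. L i s * v j s) = (if i = j then 1 else 0)"
  using assms
proof (induction I arbitrary: v rule: finite_induct)
  case empty
  then show ?case by simp
next
  case (insert i0 I)
  have "\<exists>s. v i0 s \<noteq> 0"
  proof (rule ccontr)
    assume n: "\<not> ?thesis"
    have "(\<Sum>i\<in>insert i0 I. (if i = i0 then 1 else 0) * v i s) = 0" for s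
      using n by (intro sum.neutral) auto
    from insert.prems[OF this] show False by auto
  qed
  then obtain s0 where s0: "v i0 s0 \<noteq> 0" by blast
  define r where "r j = v j s0 / v i0 s0" for j
  define v' where "v' j s = v j s - r j * v i0 s" for j s
  have "\<exists>L. \<forall>i\<in>I. \<forall>j\<in>I. (\<Sum>s\<in>UNIV. L i s * v' j s) = (if i = j then 1 else 0)"
  proof (rule insert.IH)
    fix c assume c: "\<And>s. (\<Sum>i\<in>I. c i * v' i s) = 0"
    define d where "d i = (if i = i0 then - (\<Sum>i\<in>I. c i * r i) else c i)" for i
    have I: "(\<Sum>i\<in>I. d i * x i) = (\<Sum>i\<in>I. c i * x i)" for x
      using insert.hyps by (intro sum.cong) (auto simp: d_def)
    have "(\<Sum>i\<in>insert i0 I. d i * v i s) = 0" for s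
      using insert.hyps c[of s] by (simp add: I) 
        (simp add: d_def v'_def sum_subtractf sum_distrib_left algebra_simps)
    from insert.prems[OF this] show "\<forall>i\<in>I. c i = 0"
      using insert.hyps by (auto simp: d_def split: if_splits)
  qed
  then obtain L' where L': "\<And>i j. i \<in> I \<Longrightarrow> j \<in> I \<Longrightarrow> (\<Sum>s\<in>UNIV. L' i s * v' j s) = (if i = j then 1 else 0)"
    by blast
  \<comment> \<open>\<open>M\<close> corrects \<open>L'\<close> at the pivot coordinate so as to
    vanish on row \<open>i0\<close>. The functional for \<open>i0\<close> reads off the pivot
    coordinate and removes the contributions of the other rows.\<close>
  define e where "e i = (\<Sum>s\<in>UNIV. L' i s * v i0 s) / v i0 s0" for i
  define M where "M i s = L' i s - (if s = s0 then e i else 0)" for i s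
  define L where "L i s = (if i = i0 then (if s = s0 then 1 / v i0 s0 else 0) - (\<Sum>j\<in>I. r j * M j s) else M i s)" for i s
  have M: "(\<Sum>s\<in>UNIV. M i s * x s) = (\<Sum>s\<in>UNIV. L' i s * x s) - e i * x s0" for i x
    by (simp add: M_def left_diff_distrib sum_subtractf if_distrib[of "\<lambda>z. z * _"] cong: if_cong)
  have Mi0: "(\<Sum>s\<in>UNIV. M i s * v i0 s) = 0" for i
    using s0 by (simp add: M e_def)
  have MI: "(\<Sum>s\<in>UNIV. M i s * v j s) = (if i = j then 1 else 0)" if "i \<in> I" "j \<in> I" for i j
    using L'[OF that] s0
    by (simp add: M e_def v'_def r_def right_diff_distrib sum_subtractf sum_distrib_left sum_divide_distrib algebra_simps)
  have Li0: "(\<Sum>s\<in>UNIV. L i0 s * x s) = x s0 / v i0 s0 - (\<Sum>j\<in>I. r j * (\<Sum>s\<in>UNIV. M j s * x s))" for x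
  proof -
    have "(\<Sum>s\<in>UNIV. L i0 s * x s) = (\<Sum>s\<in>UNIV. (if s = s0 then x s0 / v i0 s0 else 0)) - (\<Sum>s\<in>UNIV. \<Sum>j\<in>I. r j * (M j s * x s))"
      unfolding sum_subtractf[symmetric]
      by (intro sum.cong) (auto simp: L_def left_diff_distrib sum_distrib_right mult.assoc)
    then show ?thesis
      by (subst (asm) sum.swap) (simp add: sum_distrib_left)
  qed
  show ?case
  proof (intro exI[of _ L] ballI)
    fix i j assume ij: "i \<in> insert i0 I" "j \<in> insert i0 I"
    show "(\<Sum>s\<in>UNIV. L i s * v j s) = (if i = j then 1 else 0)"
    proof (cases "i = i0")
      case True
      show ?thesis
      proof (cases "j = i0")
        case True
        then show ?thesis using \<open>i = i0\<close> s0 by (simp add: Li0 Mi0)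
      next
        case False
        then have "j \<in> I" using ij by simp
        then have "(\<Sum>k\<in>I. r k * (\<Sum>s\<in>UNIV. M k s * v j s)) = (\<Sum>k\<in>I. if k = j then r j else 0)"
          by (intro sum.cong) (auto simp: MI)
        also have "\<dots> = r j" using \<open>j \<in> I\<close> insert.hyps by simp
        finally show ?thesis using \<open>i = i0\<close> False by (simp add: Li0 r_def)
      qed
    next
      case False
      then have "i \<in> I" "L i = M i" using ij by (auto simp: L_def)
      then show ?thesis using ij False by (auto simp: Mi0 MI)
    qed
  qed
qed

text \<open>Each elimination step uses up one coordinate and at most one vector, so a vector is left
  when the coordinates are exhausted.\<close>

lemma dependent_family:
  fixes v :: "'i \<Rightarrow> 's \<Rightarrow> 'a::field"
  assumes "finite S" "finite I" "card I > card S"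
  shows "\<exists>c. (\<exists>i\<in>I. c i \<noteq> 0) \<and> (\<forall>s\<in>S. (\<Sum>i\<in>I. c i * v i s) = 0)"
  using assms
proof (induction S arbitrary: I v rule: finite_induct)
  case empty
  then have "I \<noteq> {}" by auto
  then show ?case by (intro exI[of _ "\<lambda>_. 1"]) auto
next
  case (insert s0 S)
  show ?case
  proof (cases "\<forall>i\<in>I. v i s0 = 0")
    case True
    have "\<exists>c. (\<exists>i\<in>I. c i \<noteq> 0) \<and> (\<forall>s\<in>S. (\<Sum>i\<in>I. c i * v i s) = 0)"
      using insert.prems insert.hyps by (intro insert.IH) auto
    then show ?thesis using True by (auto intro!: sum.neutral)
  next
    case False
    then obtain i0 where i0: "i0 \<in> I" "v i0 s0 \<noteq> 0" by blast
    define r where "r i = v i s0 / v i0 s0" for i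
    define v' where "v' i s = v i s - r i * v i0 s" for i s
    have "\<exists>c. (\<exists>i\<in>I - {i0}. c i \<noteq> 0) \<and> (\<forall>s\<in>S. (\<Sum>i\<in>I - {i0}. c i * v' i s) = 0)"
      using insert.prems insert.hyps i0 by (intro insert.IH) auto
    then obtain c where c: "\<exists>i\<in>I - {i0}. c i \<noteq> 0" "\<And>s. s \<in> S \<Longrightarrow> (\<Sum>i\<in>I - {i0}. c i * v' i s) = 0"
      by blast
    define d where "d i = (if i = i0 then - (\<Sum>i\<in>I - {i0}. c i * r i) else c i)" for i
    have I: "(\<Sum>i\<in>I. d i * x i) = d i0 * x i0 + (\<Sum>i\<in>I - {i0}. c i * x i)" for x
      using i0 insert.prems by (subst sum.remove[of _ i0]) (auto intro!: sum.cong simp: d_def)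
    show ?thesis
    proof (intro exI[of _ d] conjI ballI)
      show "\<exists>i\<in>I. d i \<noteq> 0" using c(1) by (auto simp: d_def)
      fix s assume "s \<in> insert s0 S"
      then show "(\<Sum>i\<in>I. d i * v i s) = 0"
      proof
        assume "s = s0"
        then show ?thesis using i0 
          by (simp only: I) (simp add: d_def r_def sum_distrib_left sum_distrib_right sum_negf)
      next
        assume "s \<in> S"
        then show ?thesis using c(2)[of s]
          by (simp only: I) (simp add: d_def v'_def sum_subtractf sum_distrib_left sum_distrib_right sum_negf algebra_simps)
      qed
    qed
  qed
qed

section \<open>Extending homomorphisms of countable fields into the complex numbers\<close>

lemma is_subfieldD:
  assumes "is_subfield F"
  shows "0 \<in> F" "1 \<in> F" "a \<in> F \<Longrightarrow> b \<in> F \<Longrightarrow> a + b \<in> F" "a \<in> F \<Longrightarrow> b \<in> F \<Longrightarrow> a * b \<in> F"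
    "a \<in> F \<Longrightarrow> - a \<in> F" "a \<in> F \<Longrightarrow> inverse a \<in> F" "a \<in> F \<Longrightarrow> b \<in> F \<Longrightarrow> a - b \<in> F"
    "a \<in> F \<Longrightarrow> b \<in> F \<Longrightarrow> a / b \<in> F" "a \<in> F \<Longrightarrow> a ^ n \<in> F"
proof -
  show *: "0 \<in> F" "1 \<in> F" "a \<in> F \<Longrightarrow> b \<in> F \<Longrightarrow> a + b \<in> F" "a \<in> F \<Longrightarrow> b \<in> F \<Longrightarrow> a * b \<in> F"
    "a \<in> F \<Longrightarrow> - a \<in> F" "a \<in> F \<Longrightarrow> inverse a \<in> F" for a b
    using assms by (auto simp: is_subfield_def)
  show "a \<in> F \<Longrightarrow> b \<in> F \<Longrightarrow> a - b \<in> F" using *(3)[OF _ *(5), of a b] by simp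
  show "a \<in> F \<Longrightarrow> b \<in> F \<Longrightarrow> a / b \<in> F" using *(4)[OF _ *(6), of a b] by (simp add: divide_inverse)
  show "a \<in> F \<Longrightarrow> a ^ n \<in> F" by (induction n) (auto simp: *)
qed

lemma is_subfield_sum: "is_subfield F \<Longrightarrow> (\<And>i. i \<in> I \<Longrightarrow> f i \<in> F) \<Longrightarrow> sum f I \<in> F"
  by (induction I rule: infinite_finite_induct) (auto simp: is_subfieldD)

lemma is_subfield_prod: "is_subfield F \<Longrightarrow> (\<And>i. i \<in> I \<Longrightarrow> f i \<in> F) \<Longrightarrow> prod f I \<in> F"
  by (induction I rule: infinite_finite_induct) (auto simp: is_subfieldD)

lemma is_subfield_of_nat: "is_subfield F \<Longrightarrow> of_nat n \<in> F"
  by (induction n) (auto simp: is_subfieldD)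

section \<open>Polynomials with coefficients in a subfield\<close>

definition coeffs_in :: "'a::zero set \<Rightarrow> 'a poly \<Rightarrow> bool" where
  "coeffs_in E p \<longleftrightarrow> (\<forall>i. coeff p i \<in> E)"

lemma coeffs_inD: "coeffs_in E p \<Longrightarrow> coeff p i \<in> E"
  by (simp add: coeffs_in_def)

context
  fixes E :: "'a::field set"
  assumes E: "is_subfield E"
begin

lemma coeffs_in_intros:
  "coeffs_in E 0" "coeffs_in E 1" "x \<in> E \<Longrightarrow> coeffs_in E [:x:]" "x \<in> E \<Longrightarrow> coeffs_in E (monom x n)"
  "x \<in> E \<Longrightarrow> y \<in> E \<Longrightarrow> coeffs_in E [:x, y:]"
  "coeffs_in E p \<Longrightarrow> coeffs_in E q \<Longrightarrow> coeffs_in E (p + q)"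
  "coeffs_in E p \<Longrightarrow> coeffs_in E q \<Longrightarrow> coeffs_in E (p - q)"
  "coeffs_in E p \<Longrightarrow> coeffs_in E (- p)"
  "coeffs_in E p \<Longrightarrow> coeffs_in E q \<Longrightarrow> coeffs_in E (p * q)"
  "coeffs_in E p \<Longrightarrow> coeffs_in E (pderiv p)"
  by (auto simp: coeffs_in_def is_subfieldD[OF E] coeff_pCons coeff_mult coeff_pderiv
      simp del: of_nat_Suc
      intro!: is_subfield_sum[OF E] is_subfieldD[OF E] is_subfield_of_nat[OF E] split: nat.split)

lemma poly_in: "coeffs_in E p \<Longrightarrow> x \<in> E \<Longrightarrow> poly p x \<in> E"
  by (auto simp: poly_altdef coeffs_in_def intro!: is_subfield_sum[OF E] is_subfieldD[OF E])

text \<open>Subfields are sets here, so Euclidean division is carried out with control of the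
  coefficients: the leading term is cancelled by a quotient of two elements of
  \<open>E\<close>.\<close>

lemma division_in:
  assumes d: "coeffs_in E d" "d \<noteq> 0"
  shows "coeffs_in E p \<Longrightarrow>
    \<exists>q r. coeffs_in E q \<and> coeffs_in E r \<and> p = q * d + r \<and> (r = 0 \<or> degree r < degree d)"
proof (induction "degree p" arbitrary: p rule: less_induct)
  case less
  show ?case
  proof (cases "p = 0 \<or> degree p < degree d")
    case True
    then show ?thesis using less.prems
      by (intro exI[of _ 0] exI[of _ p]) (auto simp: coeffs_in_intros)
  next
    case False
    define m where "m = monom (lead_coeff p / lead_coeff d) (degree p - degree d)"
    have m: "coeffs_in E m" unfolding m_def
      using less.prems d by (intro coeffs_in_intros is_subfieldD[OF E]) (auto simp: coeffs_in_def)
    define p' where "p' = p - m * d"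
    have p': "coeffs_in E p'" unfolding p'_def using m d less.prems by (intro coeffs_in_intros)
    have lc: "lead_coeff p \<noteq> 0" "lead_coeff d \<noteq> 0" using False d by auto
    have "m \<noteq> 0" using lc by (simp add: m_def)
    have "lead_coeff p / lead_coeff d \<noteq> 0" using lc by (simp only: divide_eq_0_iff) simp
    then have degm': "degree m = degree p - degree d" unfolding m_def by (rule degree_monom_eq)
    moreover have "degree (m * d) = degree m + degree d"
      using \<open>m \<noteq> 0\<close> d(2) by (rule degree_mult_eq)
    ultimately have degm: "degree (m * d) = degree p"
      using False by linarith
    have "lead_coeff (m * d) = lead_coeff p"
      using lc degm' by (simp add: lead_coeff_mult) (simp add: m_def)
    then have c0: "coeff p' (degree p) = 0" using degm by (simp add: p'_def)
    \<comment> \<open>The degree of a constant cannot drop; in that case the remainder is zero at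
      once.\<close>
    show ?thesis
    proof (cases "degree p = 0")
      case True
      have "degree p' \<le> degree p" unfolding p'_def using degm by (intro degree_diff_le) auto
      then have "p' = 0" using c0 True by (metis le_zero_eq leading_coeff_0_iff)
      then show ?thesis using m p' 
        by (intro exI[of _ m] exI[of _ 0]) (auto simp: p'_def coeffs_in_intros)
    next
      case False
      have "degree p' \<le> degree p" unfolding p'_def using degm by (intro degree_diff_le) auto
      moreover have "degree p' \<noteq> degree p" using c0 False by (metis degree_0 leading_coeff_0_iff)
      ultimately have "degree p' < degree p" by simp
      from less.hyps[OF this p'] obtain q r where qr: "coeffs_in E q" "coeffs_in E r" "p' = q * d + r" 
        "r = 0 \<or> degree r < degree d" by blast
      then show ?thesis using m 
        by (intro exI[of _ "q + m"] exI[of _ r]) (auto simp: coeffs_in_intros p'_def algebra_simps)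
    qed
  qed
qed

end

text \<open>The field \<open>E(t)\<close>, presented by quotients so that a homomorphism can be
  defined on numerator and denominator separately.\<close>

definition adjoin :: "'a::field set \<Rightarrow> 'a \<Rightarrow> 'a set" where
  "adjoin E t = {poly q t / poly s t |q s. coeffs_in E q \<and> coeffs_in E s \<and> poly s t \<noteq> 0}"

lemma adjoinI: "coeffs_in E q \<Longrightarrow> coeffs_in E s \<Longrightarrow> poly s t \<noteq> 0 \<Longrightarrow> poly q t / poly s t \<in> adjoin E t"
  unfolding adjoin_def by blast

lemma adjoinE:
  assumes "x \<in> adjoin E t"
  obtains q s where "coeffs_in E q" "coeffs_in E s" "poly s t \<noteq> 0" "x = poly q t / poly s t"
  using assms unfolding adjoin_def by blast

lemma subfield_adjoin:
  assumes E: "is_subfield E"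
  shows "is_subfield (adjoin E t)"
  unfolding is_subfield_def
proof (intro conjI ballI)
  note ci = coeffs_in_intros[OF E]
  show "0 \<in> adjoin E t" using adjoinI[of E 0 1 t] ci by simp
  show "1 \<in> adjoin E t" using adjoinI[of E 1 1 t] ci by simp
  fix a assume "a \<in> adjoin E t"
  then obtain q s where a: "coeffs_in E q" "coeffs_in E s" "poly s t \<noteq> 0" "a = poly q t / poly s t"
    by (rule adjoinE)
  show "- a \<in> adjoin E t" using adjoinI[of E "- q" s t] ci a by simp
  show "inverse a \<in> adjoin E t"
  proof (cases "poly q t = 0")
    case True
    then show ?thesis using adjoinI[of E 0 1 t] ci a by simp
  next
    case False
    then show ?thesis using adjoinI[of E s q t] ci a by simp
  qed
  fix b assume "b \<in> adjoin E t"
  then obtain q' s' where b: "coeffs_in E q'" "coeffs_in E s'" "poly s' t \<noteq> 0" "b = poly q' t / poly s' t"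
    by (rule adjoinE)
  show "a + b \<in> adjoin E t" 
    using adjoinI[of E "q * s' + q' * s" "s * s'" t] ci a b by (simp add: add_frac_eq)
  show "a * b \<in> adjoin E t" 
    using adjoinI[of E "q * q'" "s * s'" t] ci a b by simp
qed

lemma adjoin_superset:
  assumes E: "is_subfield E"
  shows "E \<subseteq> adjoin E t" "t \<in> adjoin E t"
proof -
  note ci = coeffs_in_intros[OF E]
  show "E \<subseteq> adjoin E t"
  proof
    fix x assume "x \<in> E"
    then show "x \<in> adjoin E t" using adjoinI[of E "[:x:]" 1 t] ci by simp
  qed
  show "t \<in> adjoin E t" using adjoinI[of E "[:0,1:]" 1 t] ci is_subfieldD(1,2)[OF E] by simp
qed

lemma adjoin_least:
  assumes G: "is_subfield G" and "E \<subseteq> G" "t \<in> G"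
  shows "adjoin E t \<subseteq> G"
proof
  fix x assume "x \<in> adjoin E t"
  then obtain q s where "coeffs_in E q" "coeffs_in E s" "x = poly q t / poly s t" by (rule adjoinE)
  moreover then have "coeffs_in G q" "coeffs_in G s" using \<open>E \<subseteq> G\<close> by (auto simp: coeffs_in_def)
  ultimately show "x \<in> G" using \<open>t \<in> G\<close> by (auto intro!: is_subfieldD[OF G] poly_in[OF G])
qed

lemma countable_coeffs_in:
  assumes "countable E"
  shows "countable {p. coeffs_in E p}"
proof -
  have "{p. coeffs_in E p} \<subseteq> Poly ` lists E"
  proof
    fix p assume "p \<in> {p. coeffs_in E p}"
    then have "coeffs p \<in> lists E" by (auto simp: coeffs_in_def coeffs_def)
    then show "p \<in> Poly ` lists E" by (metis Poly_coeffs imageI)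
  qed
  moreover have "countable (Poly ` lists E)" using assms by (intro countable_image countable_lists)
  ultimately show ?thesis by (rule countable_subset)
qed

lemma countable_adjoin:
  assumes "countable E"
  shows "countable (adjoin E t)"
proof -
  have "adjoin E t \<subseteq> (\<lambda>(q, s). poly q t / poly s t) ` ({p. coeffs_in E p} \<times> {p. coeffs_in E p})"
    by (auto elim!: adjoinE)
  moreover have "countable \<dots>" using countable_coeffs_in[OF assms] by (intro countable_image countable_SIGMA)
  ultimately show ?thesis by (rule countable_subset)
qed

definition field_hom_on :: "'a::field set \<Rightarrow> ('a \<Rightarrow> 'b::field) \<Rightarrow> bool" where
  "field_hom_on E \<phi> \<longleftrightarrow> is_subfield E \<and> \<phi> 1 = 1 \<and>
     (\<forall>x\<in>E. \<forall>y\<in>E. \<phi> (x + y) = \<phi> x + \<phi> y \<and> \<phi> (x * y) = \<phi> x * \<phi> y)"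

context
  fixes E :: "'a::field set" and \<phi> :: "'a \<Rightarrow> 'b::field"
  assumes hom: "field_hom_on E \<phi>"
begin

lemma fh_subfield: "is_subfield E" 
  using hom by (simp add: field_hom_on_def)

lemma fh_simps: 
  "\<phi> 1 = 1" "x \<in> E \<Longrightarrow> y \<in> E \<Longrightarrow> \<phi> (x + y) = \<phi> x + \<phi> y" "x \<in> E \<Longrightarrow> y \<in> E \<Longrightarrow> \<phi> (x * y) = \<phi> x * \<phi> y"
  using hom by (auto simp: field_hom_on_def)

lemma fh_zero: "\<phi> 0 = 0"
proof -
  have "\<phi> (0 + 0) = \<phi> 0 + \<phi> 0" by (intro fh_simps is_subfieldD(1)[OF fh_subfield])
  then show ?thesis by (simp only: add_0_right add_cancel_right_right)
qed

lemma fh_uminus: "x \<in> E \<Longrightarrow> \<phi> (- x) = - \<phi> x"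
  using fh_simps(2)[of x "- x"] is_subfieldD(5)[OF fh_subfield, of x] fh_zero
  by (simp add: eq_neg_iff_add_eq_0 add.commute)

lemma fh_diff: "x \<in> E \<Longrightarrow> y \<in> E \<Longrightarrow> \<phi> (x - y) = \<phi> x - \<phi> y"
  using fh_simps(2)[of x "- y"] is_subfieldD(5)[OF fh_subfield, of y] fh_uminus by simp

text \<open>Injectivity: the images of a nonzero element and of its inverse multiply to 1.\<close>

lemma fh_eq_0_iff: "x \<in> E \<Longrightarrow> \<phi> x = 0 \<longleftrightarrow> x = 0"
  using fh_simps(3)[of x "inverse x"] is_subfieldD(6)[OF fh_subfield, of x] fh_zero fh_simps(1)
  by (cases "x = 0") auto

lemma fh_sum: "(\<And>i. i \<in> I \<Longrightarrow> f i \<in> E) \<Longrightarrow> \<phi> (sum f I) = (\<Sum>i\<in>I. \<phi> (f i))"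
  by (induction I rule: infinite_finite_induct) 
     (auto simp: fh_zero fh_simps is_subfield_sum[OF fh_subfield])

lemma fh_prod: "(\<And>i. i \<in> I \<Longrightarrow> f i \<in> E) \<Longrightarrow> \<phi> (prod f I) = (\<Prod>i\<in>I. \<phi> (f i))"
  by (induction I rule: infinite_finite_induct) 
     (auto simp: fh_simps is_subfield_prod[OF fh_subfield])

lemma fh_power: "x \<in> E \<Longrightarrow> \<phi> (x ^ n) = \<phi> x ^ n"
  by (induction n) (auto simp: fh_simps is_subfieldD(9)[OF fh_subfield])

lemma fh_of_nat: "\<phi> (of_nat n) = of_nat n"
  by (induction n) (auto simp: fh_simps fh_zero is_subfield_of_nat[OF fh_subfield] is_subfieldD(2)[OF fh_subfield])

abbreviation "\<Phi> \<equiv> map_poly \<phi>"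

lemma coeff_Phi: "coeff (\<Phi> p) i = \<phi> (coeff p i)"
  by (simp add: coeff_map_poly fh_zero)

lemma Phi_add: "coeffs_in E p \<Longrightarrow> coeffs_in E q \<Longrightarrow> \<Phi> (p + q) = \<Phi> p + \<Phi> q"
  by (rule poly_eqI) (simp add: coeff_Phi fh_simps coeffs_inD)

lemma Phi_diff: "coeffs_in E p \<Longrightarrow> coeffs_in E q \<Longrightarrow> \<Phi> (p - q) = \<Phi> p - \<Phi> q"
  by (rule poly_eqI) (simp add: coeff_Phi fh_diff coeffs_inD)

lemma Phi_mult: "coeffs_in E p \<Longrightarrow> coeffs_in E q \<Longrightarrow> \<Phi> (p * q) = \<Phi> p * \<Phi> q"
  by (rule poly_eqI) 
     (simp add: coeff_Phi coeff_mult fh_sum fh_simps coeffs_inD is_subfieldD(4)[OF fh_subfield])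

lemma Phi_pderiv: "coeffs_in E p \<Longrightarrow> \<Phi> (pderiv p) = pderiv (\<Phi> p)"
  by (rule poly_eqI) 
     (simp add: coeff_Phi coeff_pderiv fh_simps fh_of_nat coeffs_inD is_subfield_of_nat[OF fh_subfield]
       del: of_nat_Suc)

lemma degree_Phi: "coeffs_in E p \<Longrightarrow> degree (\<Phi> p) = degree p"
proof (cases "p = 0")
  case False
  assume p: "coeffs_in E p"
  have "coeff (\<Phi> p) (degree p) \<noteq> 0" 
    using False p by (simp add: coeff_Phi fh_eq_0_iff coeffs_inD)
  moreover have "degree (\<Phi> p) \<le> degree p"
    by (rule degree_le) (simp add: coeff_Phi fh_zero coeff_eq_0)
  ultimately show ?thesis by (meson antisym le_degree)
qed (simp add: fh_zero)

lemma Phi_eq_0_iff: "coeffs_in E p \<Longrightarrow> \<Phi> p = 0 \<longleftrightarrow> p = 0"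
  by (auto simp: poly_eq_iff coeff_Phi fh_eq_0_iff coeffs_inD)

text \<open>The assumption says that \<open>t\<close> and \<open>\<tau>\<close> satisfy the same
  algebraic relations over \<open>E\<close>, after transport by \<open>\<phi>\<close>. Hence
  quotients of polynomials in \<open>t\<close> can be sent to the corresponding quotients in
  \<open>\<tau>\<close>.\<close>

lemma extend_field_hom:
  assumes \<tau>: "\<And>q. coeffs_in E q \<Longrightarrow> poly q t = 0 \<longleftrightarrow> poly (\<Phi> q) \<tau> = 0"
  shows "\<exists>\<psi>. field_hom_on (adjoin E t) \<psi> \<and> (\<forall>x\<in>E. \<psi> x = \<phi> x) \<and> \<psi> t = \<tau>"
proof -
  note E = fh_subfield
  note ci = coeffs_in_intros[OF E]
  define R where "R x w \<longleftrightarrow> (\<exists>q s. coeffs_in E q \<and> coeffs_in E s \<and> poly s t \<noteq> 0 \<and> 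
      x = poly q t / poly s t \<and> w = poly (\<Phi> q) \<tau> / poly (\<Phi> s) \<tau>)" for x w
  define \<psi> where "\<psi> x = (SOME w. R x w)" for x
  \<comment> \<open>Independence of the representation: by cross-multiplication, equality of two
    quotients is a relation at \<open>t\<close>, which the assumption carries to
    \<open>\<tau>\<close>.\<close>
  have \<psi>: "\<psi> (poly q t / poly s t) = poly (\<Phi> q) \<tau> / poly (\<Phi> s) \<tau>"
    if qs: "coeffs_in E q" "coeffs_in E s" "poly s t \<noteq> 0" for q s
  proof -
    have "R (poly q t / poly s t) (poly (\<Phi> q) \<tau> / poly (\<Phi> s) \<tau>)"
      unfolding R_def by (intro exI[of _ q] exI[of _ s] conjI qs refl)
    then have "R (poly q t / poly s t) (\<psi> (poly q t / poly s t))"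
      unfolding \<psi>_def by (rule someI)
    then obtain q' s' where q's': "coeffs_in E q'" "coeffs_in E s'" "poly s' t \<noteq> 0"
      "poly q t / poly s t = poly q' t / poly s' t" 
      "\<psi> (poly q t / poly s t) = poly (\<Phi> q') \<tau> / poly (\<Phi> s') \<tau>" unfolding R_def by (elim exE conjE)
    have "poly (q * s' - q' * s) t = 0" using q's' qs by (simp add: frac_eq_eq)
    moreover have "coeffs_in E (q * s' - q' * s)" by (intro ci qs q's')
    ultimately have "poly (\<Phi> (q * s' - q' * s)) \<tau> = 0" using \<tau> by (simp only:)
    then have "poly (\<Phi> q) \<tau> * poly (\<Phi> s') \<tau> = poly (\<Phi> q') \<tau> * poly (\<Phi> s) \<tau>"
      using qs q's' ci by (simp add: Phi_diff Phi_mult)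
    moreover have "poly (\<Phi> s) \<tau> \<noteq> 0" "poly (\<Phi> s') \<tau> \<noteq> 0" using \<tau> qs q's' by auto
    ultimately show ?thesis using q's'(5) by (simp add: frac_eq_eq)
  qed
  have one: "\<Phi> 1 = 1" by (rule poly_eqI) (simp add: coeff_Phi fh_simps fh_zero)
  have const: "\<psi> x = \<phi> x" if "x \<in> E" for x
    using \<psi>[of "[:x:]" 1] ci that one by (simp add: map_poly_pCons fh_zero)
  have t: "\<psi> t = \<tau>"
    using \<psi>[of "[:0,1:]" 1] ci is_subfieldD(1,2)[OF E] one by (simp add: map_poly_pCons fh_zero fh_simps)
  have "field_hom_on (adjoin E t) \<psi>"
    unfolding field_hom_on_def
  proof (intro conjI ballI)
    show "is_subfield (adjoin E t)" by (rule subfield_adjoin[OF E])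
    show "\<psi> 1 = 1" using const[OF is_subfieldD(2)[OF E]] fh_simps by simp
    fix x y assume "x \<in> adjoin E t" "y \<in> adjoin E t"
    then obtain q s q' s' where 
      x: "coeffs_in E q" "coeffs_in E s" "poly s t \<noteq> 0" "x = poly q t / poly s t" and
      y: "coeffs_in E q'" "coeffs_in E s'" "poly s' t \<noteq> 0" "y = poly q' t / poly s' t"
      by (elim adjoinE) blast
    have nz: "poly (\<Phi> s) \<tau> \<noteq> 0" "poly (\<Phi> s') \<tau> \<noteq> 0" using \<tau> x y by auto
    have "x + y = poly (q * s' + q' * s) t / poly (s * s') t" using x y by (simp add: add_frac_eq)
    then have "\<psi> (x + y) = poly (\<Phi> (q * s' + q' * s)) \<tau> / poly (\<Phi> (s * s')) \<tau>"
      using \<psi>[of "q * s' + q' * s" "s * s'"] ci x y by simp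
    then show "\<psi> (x + y) = \<psi> x + \<psi> y"
      using nz x y ci by (simp add: \<psi> Phi_add Phi_mult add_frac_eq)
    have "x * y = poly (q * q') t / poly (s * s') t" using x y by simp
    then have "\<psi> (x * y) = poly (\<Phi> (q * q')) \<tau> / poly (\<Phi> (s * s')) \<tau>"
      using \<psi>[of "q * q'" "s * s'"] ci x y by simp
    then show "\<psi> (x * y) = \<psi> x * \<psi> y"
      using x y ci by (simp add: \<psi> Phi_mult)
  qed
  then show ?thesis using const t by blast
qed

end

lemma conjugate_pair:
  fixes E :: "'a::field set" and \<phi> :: "'a \<Rightarrow> complex"
  assumes hom: "field_hom_on E \<phi>" and cE: "countable E"
    and char0: "\<forall>n>0. (of_nat n :: 'a) \<noteq> 0"
  shows "\<exists>\<tau>1 \<tau>2. (\<forall>\<tau>\<in>{\<tau>1, \<tau>2}. \<forall>q. coeffs_in E q \<longrightarrow> (poly q t = 0 \<longleftrightarrow> poly (map_poly \<phi> q) \<tau> = 0)) \<and>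
    (t \<notin> E \<longrightarrow> \<tau>1 \<noteq> \<tau>2)"
proof -
  note E = fh_subfield[OF hom]
  note ci = coeffs_in_intros[OF E]
  let ?\<Phi> = "map_poly \<phi>"
  note Phi = Phi_add[OF hom] Phi_mult[OF hom] 
  show ?thesis
  proof (cases "\<exists>p. p \<noteq> 0 \<and> coeffs_in E p \<and> poly p t = 0")
    case False
    define S where "S = (\<Union>q\<in>{q. coeffs_in E q} - {0}. {\<tau>. poly (?\<Phi> q) \<tau> = 0})"
    have "countable S" unfolding S_def
      using countable_coeffs_in[OF cE] Phi_eq_0_iff[OF hom]
      by (intro countable_UN) (auto intro!: countable_finite poly_roots_finite)
    then obtain \<tau>1 where 1: "\<tau>1 \<notin> S" using uncountable_UNIV_complex by (metis UNIV_eq_I)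
    have "countable (insert \<tau>1 S)" using \<open>countable S\<close> by simp
    then obtain \<tau>2 where 2: "\<tau>2 \<notin> insert \<tau>1 S" using uncountable_UNIV_complex by (metis UNIV_eq_I)
    have good: "poly q t = 0 \<longleftrightarrow> poly (?\<Phi> q) \<tau> = 0" if "\<tau> \<notin> S" "coeffs_in E q" for \<tau> q
      using False that by (cases "q = 0") (auto simp: S_def)
    show ?thesis
    proof (rule exI[of _ \<tau>1], rule exI[of _ \<tau>2], intro conjI ballI allI impI)
      fix \<tau> q assume "\<tau> \<in> {\<tau>1, \<tau>2}" and q: "coeffs_in E q"
      then have "\<tau> \<notin> S" using 1 2 by auto
      then show "poly q t = 0 \<longleftrightarrow> poly (?\<Phi> q) \<tau> = 0" using q by (rule good)
    next
      show "\<tau>1 \<noteq> \<tau>2" using 2 by blast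
    qed
  next
    case True
    then obtain p0 where p0: "p0 \<noteq> 0 \<and> coeffs_in E p0 \<and> poly p0 t = 0" by (elim exE)
    from ex_has_least_nat[of "\<lambda>p. p \<noteq> 0 \<and> coeffs_in E p \<and> poly p t = 0", OF p0, of degree]
    obtain p where p: "p \<noteq> 0" "coeffs_in E p" "poly p t = 0"
      and least: "\<And>q. q \<noteq> 0 \<Longrightarrow> coeffs_in E q \<Longrightarrow> poly q t = 0 \<Longrightarrow> degree p \<le> degree q"
      by (elim exE conjE) blast
    have deg_pos: "degree p > 0"
    proof (rule ccontr)
      assume "\<not> ?thesis"
      then obtain c where "p = [:c:]" by (auto elim: degree_eq_zeroE)
      with p show False by simp
    qed
    let ?P = "?\<Phi> p"
    have degP: "degree ?P = degree p" using p by (simp add: degree_Phi[OF hom])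
    have good: "poly q t = 0 \<longleftrightarrow> poly (?\<Phi> q) \<tau> = 0" if \<tau>: "poly ?P \<tau> = 0" and q: "coeffs_in E q" for \<tau> q
    proof
      assume qt: "poly q t = 0"
      obtain e r where er: "coeffs_in E e" "coeffs_in E r" "q = e * p + r" "r = 0 \<or> degree r < degree p"
        using division_in[OF E p(2,1) q] by blast
      have "poly r t = 0" using qt er p by simp
      then have "r = 0" using least[of r] er by fastforce
      then have "?\<Phi> q = ?\<Phi> e * ?P" using er p by (simp add: Phi)
      then show "poly (?\<Phi> q) \<tau> = 0" using \<tau> by simp
    next
      assume q\<tau>: "poly (?\<Phi> q) \<tau> = 0"
      show "poly q t = 0"
      proof (rule ccontr)
        assume "poly q t \<noteq> 0"
        then have q0: "poly q t \<noteq> 0 \<and> coeffs_in E q \<and> poly (?\<Phi> q) \<tau> = 0" using q q\<tau> by (intro conjI)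
        \<comment> \<open>This amounts to irreducibility of \<open>p\<close>: a counterexample
          \<open>d\<close> of least degree divides \<open>p\<close>, the cofactor then vanishes at
          \<open>t\<close> and has full degree, so \<open>d\<close> is a nonzero constant and has no
          root.\<close>
        from ex_has_least_nat[of "\<lambda>d. poly d t \<noteq> 0 \<and> coeffs_in E d \<and> poly (?\<Phi> d) \<tau> = 0", OF q0, of degree]
        obtain d where d: "poly d t \<noteq> 0" "coeffs_in E d" "poly (?\<Phi> d) \<tau> = 0"
          and least': "\<And>q. poly q t \<noteq> 0 \<Longrightarrow> coeffs_in E q \<Longrightarrow> poly (?\<Phi> q) \<tau> = 0 \<Longrightarrow> degree d \<le> degree q"
          by (elim exE conjE) blast
        have d0: "d \<noteq> 0" using d by auto
        have dle: "degree d < degree p"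
        proof -
          obtain e r where er: "coeffs_in E e" "coeffs_in E r" "d = e * p + r" "r = 0 \<or> degree r < degree p"
            using division_in[OF E p(2,1) d(2)] by blast
          have "poly r t \<noteq> 0" using er d p by simp
          moreover have "poly (?\<Phi> r) \<tau> = 0" using d(3) er p \<tau> ci by (simp add: Phi)
          ultimately have "degree d \<le> degree r" using least' er by blast
          moreover have "r \<noteq> 0" using \<open>poly r t \<noteq> 0\<close> by auto
          ultimately show ?thesis using er by auto
        qed
        obtain e r where er: "coeffs_in E e" "coeffs_in E r" "p = e * d + r" "r = 0 \<or> degree r < degree d"
          using division_in[OF E d(2) d0 p(2)] by blast
        have "poly (?\<Phi> r) \<tau> = 0" using \<tau> d er ci by (simp add: Phi)
        have "poly r t = 0"
        proof (rule ccontr)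
          assume "poly r t \<noteq> 0"
          then have "degree d \<le> degree r" using least' er \<open>poly (?\<Phi> r) \<tau> = 0\<close> by blast
          moreover have "r \<noteq> 0" using \<open>poly r t \<noteq> 0\<close> by auto
          ultimately show False using er by auto
        qed
        then have "r = 0" using least[of r] er dle by fastforce
        then have "p = e * d" using er by simp
        moreover from this have "e \<noteq> 0" "poly e t = 0" using p d by auto
        moreover have "degree (e * d) = degree e + degree d" using \<open>e \<noteq> 0\<close> d0 by (rule degree_mult_eq)
        ultimately have "degree d = 0" using least[of e] er by simp
        then obtain c where c: "d = [:c:]" by (auto elim: degree_eq_zeroE)
        then have "c \<in> E" "c \<noteq> 0" using d coeffs_inD[OF d(2), of 0] by auto
        then show False using d(3) c by (simp add: map_poly_pCons fh_zero[OF hom] fh_eq_0_iff[OF hom])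
      qed
    qed
    have "\<not> constant (poly ?P)" using deg_pos degP by (simp add: constant_degree)
    then obtain \<tau>1 where \<tau>1: "poly ?P \<tau>1 = 0" using Fundamental_Theorem_Algebra.fundamental_theorem_of_algebra by blast
    show ?thesis
    proof (cases "t \<in> E")
      case True
      show ?thesis
      proof (rule exI[of _ \<tau>1], rule exI[of _ \<tau>1], intro conjI ballI allI impI)
        fix \<tau> q assume "\<tau> \<in> {\<tau>1, \<tau>1}" and q: "coeffs_in E q"
        then have "poly ?P \<tau> = 0" using \<tau>1 by simp
        then show "poly q t = 0 \<longleftrightarrow> poly (?\<Phi> q) \<tau> = 0" using q by (rule good)
      next
        assume "t \<notin> E"
        then show "\<tau>1 \<noteq> \<tau>1" using True by simp
      qed
    next
      case False
      have deg2: "degree p \<ge> 2"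
      proof (rule ccontr)
        assume "\<not> ?thesis"
        then have "degree p = 1" using deg_pos by simp
        define c d where "c = coeff p 0" and "d = coeff p 1"
        have "poly p t = c + d * t" using \<open>degree p = 1\<close> by (simp add: poly_altdef c_def d_def)
        moreover have "d \<noteq> 0" using p \<open>degree p = 1\<close> unfolding d_def by (metis leading_coeff_0_iff)
        ultimately have "t = - c / d" using p(3) by (simp add: field_simps add_eq_0_iff)
        moreover have "c \<in> E" "d \<in> E" using coeffs_inD[OF p(2)] by (auto simp: c_def d_def)
        ultimately have "t \<in> E" using is_subfieldD(5,8)[OF E] by blast
        then show False using False by simp
      qed
      have pd: "coeffs_in E (pderiv p)" by (intro ci p)
      have "coeff (pderiv p) (degree p - 1) \<noteq> 0"
        using deg_pos p char0 by (simp add: coeff_pderiv)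
      then have pd0: "pderiv p \<noteq> 0" by auto
      \<comment> \<open>Having smaller degree, the derivative cannot vanish at \<open>t\<close>;
        \<open>good\<close> carries this over to \<open>\<tau>1\<close>, which is therefore a simple
        root.\<close>
      have "degree (pderiv p) \<le> degree p - 1"
        by (rule degree_le) (auto simp: coeff_pderiv coeff_eq_0)
      then have "poly (pderiv p) t \<noteq> 0" using least[OF pd0 pd] deg_pos by fastforce
      then have simple: "poly (pderiv ?P) \<tau>1 \<noteq> 0"
        using good[OF \<tau>1 pd] p by (simp add: Phi_pderiv[OF hom])
      obtain Q where Q: "?P = [:- \<tau>1, 1:] * Q" using \<tau>1 by (auto simp: poly_eq_0_iff_dvd elim: dvdE)
      have "?P \<noteq> 0" using p by (simp add: Phi_eq_0_iff[OF hom])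
      then have "Q \<noteq> 0" using Q by auto
      then have "degree ?P = 1 + degree Q" unfolding Q by (subst degree_mult_eq) auto
      then have "degree Q \<noteq> 0" using deg2 degP by simp
      then have "\<not> constant (poly Q)" by (simp add: constant_degree)
      then obtain \<tau>2 where \<tau>2: "poly Q \<tau>2 = 0" using Fundamental_Theorem_Algebra.fundamental_theorem_of_algebra by blast
      have "poly Q \<tau>1 \<noteq> 0" using simple unfolding Q pderiv_mult by (simp add: pderiv_pCons)
      then have "\<tau>1 \<noteq> \<tau>2" using \<tau>2 by auto
      have "poly ?P \<tau>2 = 0" using Q \<tau>2 by simp
      show ?thesis
      proof (rule exI[of _ \<tau>1], rule exI[of _ \<tau>2], intro conjI ballI allI impI)
        fix \<tau> q assume "\<tau> \<in> {\<tau>1, \<tau>2}" and q: "coeffs_in E q"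
        then have "poly ?P \<tau> = 0" using \<tau>1 \<open>poly ?P \<tau>2 = 0\<close> by auto
        then show "poly q t = 0 \<longleftrightarrow> poly (?\<Phi> q) \<tau> = 0" using q by (rule good)
      next
        show "\<tau>1 \<noteq> \<tau>2" by fact
      qed
    qed
  qed
qed

text \<open>The last clause says that \<open>E'\<close> is no larger than the field generated by
  \<open>E\<close> and \<open>T\<close>. It guarantees that a function outside the field of
  coefficients is also outside the domain of the extended map.\<close>

lemma extend_field_hom_set:
  fixes E :: "'a::field set" and \<phi> :: "'a \<Rightarrow> complex"
  assumes char0: "\<forall>n>0. (of_nat n :: 'a) \<noteq> 0" and "finite T"
    and "field_hom_on E \<phi>" "countable E"
  shows "\<exists>E' \<psi>. field_hom_on E' \<psi> \<and> countable E' \<and> E \<subseteq> E' \<and> T \<subseteq> E' \<and> (\<forall>x\<in>E. \<psi> x = \<phi> x) \<and>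
     (\<forall>G. is_subfield G \<and> E \<subseteq> G \<and> T \<subseteq> G \<longrightarrow> E' \<subseteq> G)"
  using assms(2-)
proof (induction T rule: finite_induct)
  case empty
  then show ?case by blast
next
  case (insert t T)
  then obtain E' \<psi> where E': "field_hom_on E' \<psi>" "countable E'" "E \<subseteq> E'" "T \<subseteq> E'" "\<forall>x\<in>E. \<psi> x = \<phi> x"
    "\<And>G. is_subfield G \<and> E \<subseteq> G \<and> T \<subseteq> G \<longrightarrow> E' \<subseteq> G"
    by blast
  note sf = fh_subfield[OF E'(1)]
  from conjugate_pair[OF E'(1,2) char0, of t] obtain \<tau> where
    good: "\<And>q. coeffs_in E' q \<Longrightarrow> (poly q t = 0) = (poly (map_poly \<psi> q) \<tau> = 0)" by blast
  from extend_field_hom[OF E'(1) good] obtain \<rho> where 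
    \<rho>: "field_hom_on (adjoin E' t) \<rho>" "\<forall>x\<in>E'. \<rho> x = \<psi> x" by blast
  show ?case
    using \<rho> E' adjoin_superset[OF sf, of t] countable_adjoin[OF E'(2), of t] adjoin_least[of _ E' t]
    by (intro exI[of _ "adjoin E' t"] exI[of _ \<rho>]) auto
qed

section \<open>Rational functions that are separated by a field of rational functions\<close>

lemma single_sum_eq_prod:
  "Poly_Mapping.single (\<Sum>v\<in>S. f v) (1::'a::comm_ring_1) = (\<Prod>v\<in>S. Poly_Mapping.single (f v) 1)"
proof (induction S rule: infinite_finite_induct)
  case (insert x F)
  then show ?case by (simp add: mult_single flip: insert.IH)
qed auto

lemma single_single_eq_power:
  "Poly_Mapping.single (Poly_Mapping.single v n) (1::'a::comm_ring_1) = mp_var v ^ n"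
proof (induction n)
  case (Suc n)
  have "Poly_Mapping.single (Poly_Mapping.single v (Suc n)) (1::'a) =
      Poly_Mapping.single (Poly_Mapping.single v 1) 1 * Poly_Mapping.single (Poly_Mapping.single v n) 1"
    by (simp only: mult_single mult_1) (simp flip: single_add)
  then show ?case using Suc by (simp add: mp_var_def)
qed simp

lemma single_eq_mon_eval: "Poly_Mapping.single m (1::'a::comm_ring_1) = mon_eval mp_var m"
proof -
  have "Poly_Mapping.single m (1::'a) =
      Poly_Mapping.single (\<Sum>v\<in>Poly_Mapping.keys m. Poly_Mapping.single v (Poly_Mapping.lookup m v)) 1"
    using poly_mapping_sum_single[of m] by simp
  then show ?thesis by (simp add: single_sum_eq_prod single_single_eq_power mon_eval_def)
qed

definition rf_var :: "'l \<Rightarrow> 'l::linorder ratfun" where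
  "rf_var l = Fract (mp_var l) 1"

lemma ring_hom_fun_Fract: "ring_hom_fun (\<lambda>P :: ('l::linorder, complex) mpoly. Fract P 1)"
  by (simp add: ring_hom_fun_def flip: Zero_fract_def One_fract_def)

lemma ring_hom_fun_mon_eval:
  assumes "ring_hom_fun c"
  shows "c (mon_eval a m) = mon_eval (\<lambda>v. c (a v)) m"
proof -
  have pow: "c (x ^ n) = c x ^ n" for x n
    by (induction n) (auto simp: ring_hom_funD[OF assms])
  have prod: "c (prod f S) = (\<Prod>x\<in>S. c (f x))" for f S
    by (induction S rule: infinite_finite_induct) (auto simp: ring_hom_funD[OF assms])
  show ?thesis by (simp add: mon_eval_def pow prod)
qed

text \<open>Writes a polynomial in terms of constants and the elements \<open>rf_var\<close>, to
  which a field homomorphism can be applied.\<close>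

lemma Fract_eq_sum:
  fixes P :: "('l::linorder, complex) mpoly"
  shows "Fract P 1 = (\<Sum>m\<in>Poly_Mapping.keys P. rf_const (Poly_Mapping.lookup P m) * mon_eval rf_var m)"
proof -
  note hom = ring_hom_fun_Fract[where 'l = 'l]
  have "Poly_Mapping.single m c = mp_const c * mon_eval mp_var m" for m :: "'l \<Rightarrow>\<^sub>0 nat" and c :: complex
    by (simp add: mp_const_def mult_single flip: single_eq_mon_eval)
  then have "Fract (Poly_Mapping.single m c) 1 = rf_const c * mon_eval rf_var m" for m :: "'l \<Rightarrow>\<^sub>0 nat" and c
    using ring_hom_funD(4)[OF hom, of "mp_const c" "mon_eval mp_var m"] ring_hom_fun_mon_eval[OF hom, of mp_var m]
    by (simp add: rf_const_def rf_var_def[abs_def])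
  then show ?thesis
    using ring_hom_fun_sum[OF hom, of "\<lambda>m. Poly_Mapping.single m (Poly_Mapping.lookup P m)" "Poly_Mapping.keys P"]
    by (simp flip: poly_mapping_sum_single)
qed

lemma of_nat_ratfun_nonzero: "\<forall>n>0. (of_nat n :: 'l::linorder ratfun) \<noteq> 0"
proof (intro allI impI notI)
  fix n
  assume n: "n > 0" "(of_nat n :: 'l::linorder ratfun) = 0"
  have "(of_nat n :: 'l ratfun) = rf_const (of_nat n)"
    by (induction n) (auto simp: ring_hom_funD(3)[OF rf_const_hom])
  then have "rf_eval a (of_nat n :: 'l ratfun) = of_nat n" for a by simp
  then show False using n by simp
qed

section \<open>Field homomorphisms as points generic over a field of constants\<close>

context
  fixes E :: "'l::linorder ratfun set" and \<phi> :: "'l ratfun \<Rightarrow> complex" and k0 :: "complex set"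
  assumes hom: "field_hom_on E \<phi>"
    and cst: "\<And>c. c \<in> k0 \<Longrightarrow> rf_const c \<in> E" "\<And>c. c \<in> k0 \<Longrightarrow> \<phi> (rf_const c) = c"
    and vrs: "\<And>l. rf_var l \<in> E"
begin

lemma mon_eval_rf_var_in: "mon_eval rf_var m \<in> E"
  unfolding mon_eval_def
  by (intro is_subfield_prod[OF fh_subfield[OF hom]] is_subfieldD(9)[OF fh_subfield[OF hom]] vrs)

lemma hom_Fract:
  assumes "range (Poly_Mapping.lookup P) \<subseteq> k0"
  shows "Fract P 1 \<in> E" "\<phi> (Fract P 1) = mp_eval id (\<lambda>l. \<phi> (rf_var l)) P"
proof -
  note sf = fh_subfield[OF hom]
  have c: "Poly_Mapping.lookup P m \<in> k0" for m using assms by auto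
  have "\<phi> (mon_eval rf_var m) = mon_eval (\<lambda>l. \<phi> (rf_var l)) m" for m
    by (simp add: mon_eval_def fh_prod[OF hom] fh_power[OF hom] vrs is_subfieldD(9)[OF sf])
  moreover have *: "rf_const (Poly_Mapping.lookup P m) * mon_eval rf_var m \<in> E" for m
    by (intro is_subfieldD(4)[OF sf] cst c mon_eval_rf_var_in)
  ultimately show "\<phi> (Fract P 1) = mp_eval id (\<lambda>l. \<phi> (rf_var l)) P"
    by (simp add: Fract_eq_sum fh_sum[OF hom] fh_simps[OF hom] cst c mon_eval_rf_var_in mp_eval_def
        flip: mon_eval_def)
  show "Fract P 1 \<in> E" unfolding Fract_eq_sum by (intro is_subfield_sum[OF sf] *)
qed

text \<open>On polynomials over \<open>k0\<close>, evaluation at this point is the restriction of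
  the injective map \<open>\<phi>\<close>.\<close>

lemma hom_nonvanishing:
  assumes "range (Poly_Mapping.lookup P) \<subseteq> k0" "P \<noteq> 0"
  shows "mp_eval id (\<lambda>l. \<phi> (rf_var l)) P \<noteq> 0"
proof -
  have "Fract P 1 \<noteq> 0" using assms(2) by (simp add: Zero_fract_def eq_fract)
  then show ?thesis
    using fh_eq_0_iff[OF hom hom_Fract(1)[OF assms(1)]] hom_Fract(2)[OF assms(1)] by simp
qed

lemma hom_rf_eval:
  assumes "range (Poly_Mapping.lookup p) \<subseteq> k0" "range (Poly_Mapping.lookup q) \<subseteq> k0" "q \<noteq> 0"
  shows "rf_defined (Fract p q) (\<lambda>l. \<phi> (rf_var l))"
    "rf_eval (\<lambda>l. \<phi> (rf_var l)) (Fract p q) = \<phi> (Fract p q)"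
proof -
  note nz = hom_nonvanishing[OF assms(2,3)]
  note sf = fh_subfield[OF hom]
  show "rf_defined (Fract p q) (\<lambda>l. \<phi> (rf_var l))" by (rule rf_defined_Fract[OF nz])
  have in_E: "Fract p 1 \<in> E" "Fract q 1 \<in> E" using hom_Fract(1) assms by auto
  have q0: "Fract q 1 \<noteq> 0" using assms(3) by (simp add: Zero_fract_def eq_fract)
  have "Fract p q = Fract p 1 / Fract q 1" by simp
  then have "Fract p q \<in> E" using in_E is_subfieldD(8)[OF sf] by metis
  moreover have "Fract p q * Fract q 1 = Fract p 1" using assms(3) by (simp add: eq_fract)
  ultimately have "\<phi> (Fract p q) * \<phi> (Fract q 1) = \<phi> (Fract p 1)"
    using fh_simps(3)[OF hom _ in_E(2)] by metis
  then show "rf_eval (\<lambda>l. \<phi> (rf_var l)) (Fract p q) = \<phi> (Fract p q)"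
    using nz assms by (simp add: rf_eval_Fract hom_Fract field_simps)
qed

end

text \<open>The field arises as the domain of an extension of the identity of the rationals to
  \<open>Z\<close>.\<close>

lemma countable_subfield:
  assumes "finite (Z :: complex set)"
  obtains k0 where "is_subfield k0" "countable k0" "Z \<subseteq> k0"
proof -
  have "is_subfield (\<rat> :: complex set)" by (auto simp: is_subfield_def)
  then have "field_hom_on (\<rat> :: complex set) (\<lambda>x. x)" by (simp add: field_hom_on_def)
  moreover have "countable (\<rat> :: complex set)" unfolding Rats_def by auto
  ultimately obtain E' \<psi> where "field_hom_on E' (\<psi> :: complex \<Rightarrow> complex)" "countable E'" "Z \<subseteq> E'"
    using extend_field_hom_set[OF _ assms, of "\<rat>" "\<lambda>x. x"] by auto
  then show ?thesis using fh_subfield that by blast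
qed

text \<open>Evaluation at the origin stands for the inverse of \<open>rf_const\<close>; on constants
  every point gives the same value.\<close>

lemma field_hom_on_rf_const:
  assumes "is_subfield k0"
  shows "field_hom_on (rf_const ` k0) (rf_eval (\<lambda>_. 0) :: 'l::linorder ratfun \<Rightarrow> complex)"
proof -
  note sf = is_subfieldD[OF assms]
  have inv: "inverse (rf_const c) = (rf_const (inverse c) :: 'l ratfun)" for c :: complex
  proof (cases "c = 0")
    case False
    have "rf_const c * rf_const (inverse c) = (1 :: 'l ratfun)"
      using False ring_hom_funD(4)[OF rf_const_hom[where 'a = 'l], of c "inverse c"] by simp
    then show "inverse (rf_const c) = (rf_const (inverse c) :: 'l ratfun)" by (rule inverse_unique)
  qed simp
  have "is_subfield (rf_const ` k0 :: 'l ratfun set)"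
    unfolding is_subfield_def
  proof (intro conjI ballI)
    show "0 \<in> (rf_const ` k0 :: 'l ratfun set)" using sf(1) rf_const_0 by (metis imageI)
    show "1 \<in> (rf_const ` k0 :: 'l ratfun set)" using sf(2) rf_const_1 by (metis imageI)
    fix a :: "'l ratfun" assume "a \<in> rf_const ` k0"
    then obtain c where c: "c \<in> k0" "a = rf_const c" by blast
    show "- a \<in> rf_const ` k0" "inverse a \<in> rf_const ` k0"
      using c sf by (auto simp: inv simp flip: ring_hom_fun_uminus[OF rf_const_hom])
    fix b :: "'l ratfun" assume "b \<in> rf_const ` k0"
    then obtain d where d: "d \<in> k0" "b = rf_const d" by blast
    show "a + b \<in> rf_const ` k0" "a * b \<in> rf_const ` k0"
      using c d sf by (auto simp flip: ring_hom_funD[OF rf_const_hom])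
  qed
  then show ?thesis by (auto simp: field_hom_on_def rf_add rf_mult)
qed

lemma finite_range_lookup: "finite (range (Poly_Mapping.lookup p))"
proof (rule finite_subset)
  show "range (Poly_Mapping.lookup p) \<subseteq> insert 0 (Poly_Mapping.lookup p ` Poly_Mapping.keys p)"
    by (auto simp: in_keys_iff)
qed simp

text \<open>A point that is generic over a countable field containing the coefficients of
  \<open>P\<close> cannot be a zero of \<open>P\<close>.\<close>

lemma nonvanishing_point:
  fixes P :: "('l::{finite,linorder}, complex) mpoly"
  assumes "P \<noteq> 0"
  shows "\<exists>a. mp_eval id a P \<noteq> 0"
proof -
  obtain k0 where k0: "is_subfield k0" "countable k0" "range (Poly_Mapping.lookup P) \<subseteq> k0"
    using countable_subfield[OF finite_range_lookup[of P]] by blast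
  from extend_field_hom_set[OF of_nat_ratfun_nonzero _ field_hom_on_rf_const[OF k0(1)] countable_image[OF k0(2)],
      of "range (rf_var :: 'l \<Rightarrow> _)"]
  obtain E \<phi> where E: "field_hom_on E \<phi>" "rf_const ` k0 \<subseteq> E" "range rf_var \<subseteq> E"
    "\<forall>x\<in>rf_const ` k0. \<phi> x = rf_eval (\<lambda>_::'l. 0) x"
    by auto
  have "mp_eval id (\<lambda>l. \<phi> (rf_var l)) P \<noteq> 0"
    using k0 E by (intro hom_nonvanishing[of E \<phi> k0] assms) auto
  then show ?thesis by blast
qed

lemma separating_points:
  fixes P :: "('l::{finite,linorder}, complex) mpoly" and h :: "'l ratfun"
  assumes A: "finite A" and h: "h \<notin> field_generated (range rf_const \<union> A)" and P: "P \<noteq> 0"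
  shows "\<exists>a b. mp_eval id a P \<noteq> 0 \<and> mp_eval id b P \<noteq> 0 \<and>
    (\<forall>\<kappa>\<in>insert h A. rf_defined \<kappa> a \<and> rf_defined \<kappa> b) \<and>
    (\<forall>\<kappa>\<in>A. rf_eval a \<kappa> = rf_eval b \<kappa>) \<and> rf_eval a h \<noteq> rf_eval b h"
proof -
  define G where "G = field_generated (range rf_const \<union> A)"
  have G: "is_subfield G" "range rf_const \<subseteq> G" "A \<subseteq> G"
    unfolding G_def field_generated_def is_subfield_def by auto
  have "\<forall>\<kappa>. \<exists>p q. \<kappa> = Fract p q \<and> q \<noteq> (0 :: ('l, complex) mpoly)" by (metis Fract_cases)
  then obtain nm dn where nd: "\<And>\<kappa> :: 'l ratfun. \<kappa> = Fract (nm \<kappa>) (dn \<kappa>)" "\<And>\<kappa>. dn \<kappa> \<noteq> 0"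
    by metis
  \<comment> \<open>All complex coefficients that occur, so that \<open>P\<close> and the given
    functions live over \<open>k0\<close>.\<close>
  define Z where "Z = range (Poly_Mapping.lookup P) \<union>
    (\<Union>\<kappa>\<in>insert h A. range (Poly_Mapping.lookup (nm \<kappa>)) \<union> range (Poly_Mapping.lookup (dn \<kappa>)))"
  have "finite Z" unfolding Z_def using A by (intro finite_UnI finite_UN_I finite_range_lookup) auto
  then obtain k0 where k0: "is_subfield k0" "countable k0" "Z \<subseteq> k0" by (rule countable_subfield)
  note ext = extend_field_hom_set[OF of_nat_ratfun_nonzero]
  from ext[OF A field_hom_on_rf_const[OF k0(1)] countable_image[OF k0(2)]]
  obtain F \<phi>0 where F: "field_hom_on F \<phi>0" "countable F" "rf_const ` k0 \<subseteq> F" "A \<subseteq> F"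
    "\<forall>x\<in>rf_const ` k0. \<phi>0 x = rf_eval (\<lambda>_::'l. 0) x"
    "\<forall>G. is_subfield G \<and> rf_const ` k0 \<subseteq> G \<and> A \<subseteq> G \<longrightarrow> F \<subseteq> G"
    by (elim exE conjE) blast
  \<comment> \<open>Leastness of \<open>F\<close> enters here: even the field \<open>G\<close>,
    which contains all complex constants, misses \<open>h\<close>.\<close>
  have "F \<subseteq> G" using G F(6) by blast
  then have hF: "h \<notin> F" using h by (auto simp: G_def)
  from conjugate_pair[OF F(1,2) of_nat_ratfun_nonzero, of h] hF
  obtain \<tau>1 \<tau>2 where \<tau>: "\<tau>1 \<noteq> \<tau>2"
    "\<And>q. coeffs_in F q \<Longrightarrow> (poly q h = 0) = (poly (map_poly \<phi>0 q) \<tau>1 = 0)"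
    "\<And>q. coeffs_in F q \<Longrightarrow> (poly q h = 0) = (poly (map_poly \<phi>0 q) \<tau>2 = 0)" by blast
  \<comment> \<open>Each admissible value of \<open>h\<close> yields a point: extend the map to all
    parameters and take their images as coordinates. The values on \<open>A\<close> are fixed
    beforehand by \<open>\<phi>0\<close>.\<close>
  have point: "\<exists>a. mp_eval id a P \<noteq> 0 \<and> (\<forall>\<kappa>\<in>insert h A. rf_defined \<kappa> a) \<and>
      (\<forall>\<kappa>\<in>A. rf_eval a \<kappa> = \<phi>0 \<kappa>) \<and> rf_eval a h = \<tau>"
    if good: "\<And>q. coeffs_in F q \<Longrightarrow> (poly q h = 0) = (poly (map_poly \<phi>0 q) \<tau> = 0)" for \<tau>
  proof -
    obtain \<psi> where \<psi>: "field_hom_on (adjoin F h) \<psi>" "\<forall>x\<in>F. \<psi> x = \<phi>0 x" "\<psi> h = \<tau>"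
      using extend_field_hom[OF F(1) good] by blast
    obtain E \<phi> where E: "field_hom_on E \<phi>" "adjoin F h \<subseteq> E" "range rf_var \<subseteq> E" "\<forall>x\<in>adjoin F h. \<phi> x = \<psi> x"
      using ext[OF _ \<psi>(1) countable_adjoin[OF F(2)], of "range rf_var"] by auto
    note sup = adjoin_superset[OF fh_subfield[OF F(1)], of h]
    have FE: "F \<subseteq> E" using sup E by blast
    have c: "rf_const c \<in> E" "\<phi> (rf_const c) = c" if "c \<in> k0" for c
    proof -
      have "rf_const c \<in> F" using that F by blast
      then show "rf_const c \<in> E" using FE by blast
      have "\<phi> (rf_const c) = \<phi>0 (rf_const c)" using \<open>rf_const c \<in> F\<close> sup E \<psi> by auto
      then show "\<phi> (rf_const c) = c" using F(5) that by simp
    qed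
    have v: "rf_var l \<in> E" for l using E by blast
    define a where "a l = \<phi> (rf_var l)" for l
    have val: "rf_defined \<kappa> a" "rf_eval a \<kappa> = \<phi> \<kappa>" if "\<kappa> \<in> insert h A" for \<kappa>
    proof -
      have "range (Poly_Mapping.lookup (nm \<kappa>)) \<subseteq> k0" "range (Poly_Mapping.lookup (dn \<kappa>)) \<subseteq> k0"
        using k0(3) that unfolding Z_def by blast+
      from hom_rf_eval[OF E(1) c v this nd(2)]
      show "rf_defined \<kappa> a" "rf_eval a \<kappa> = \<phi> \<kappa>" unfolding a_def by (simp_all flip: nd(1))
    qed
    have "range (Poly_Mapping.lookup P) \<subseteq> k0" using k0(3) unfolding Z_def by blast
    from hom_nonvanishing[OF E(1) c v this P] have "mp_eval id a P \<noteq> 0" unfolding a_def .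
    moreover have "\<phi> \<kappa> = \<phi>0 \<kappa>" if "\<kappa> \<in> A" for \<kappa>
      using that F(4) sup(1) E(4) \<psi>(2) by (metis subsetD)
    moreover have "\<phi> h = \<tau>" using sup E(4) \<psi>(3) by auto
    ultimately show ?thesis using val by (intro exI[of _ a]) auto
  qed
  obtain a b where 
    a: "mp_eval id a P \<noteq> 0" "\<forall>\<kappa>\<in>insert h A. rf_defined \<kappa> a" "\<forall>\<kappa>\<in>A. rf_eval a \<kappa> = \<phi>0 \<kappa>" "rf_eval a h = \<tau>1" and
    b: "mp_eval id b P \<noteq> 0" "\<forall>\<kappa>\<in>insert h A. rf_defined \<kappa> b" "\<forall>\<kappa>\<in>A. rf_eval b \<kappa> = \<phi>0 \<kappa>" "rf_eval b h = \<tau>2"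
    using point[OF \<tau>(2)] point[OF \<tau>(3)] by blast
  show ?thesis using a b \<tau>(1) by - (rule exI[of _ a], rule exI[of _ b], simp)
qed

section \<open>Sequences of derivatives\<close>

text \<open>A polynomial acts on sequences with the indeterminate acting as the shift.\<close>

definition act :: "'a::comm_ring_1 poly \<Rightarrow> (nat \<Rightarrow> 'a) \<Rightarrow> nat \<Rightarrow> 'a" where
  "act q Z s = (\<Sum>i\<le>degree q. coeff q i * Z (i + s))"

lemma act_bound: "degree q \<le> N \<Longrightarrow> act q Z s = (\<Sum>i\<le>N. coeff q i * Z (i + s))"
  unfolding act_def by (rule sum.mono_neutral_left) (auto simp: coeff_eq_0)

lemma act_0 [simp]: "act 0 Z s = 0"
  by (simp add: act_def)

lemma act_add: "act (p + q) Z s = act p Z s + act q Z s"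
proof -
  let ?N = "max (degree p) (degree q)"
  have "degree (p + q) \<le> ?N" by (rule degree_add_le_max)
  then show ?thesis
    by (simp add: act_bound[of _ ?N] distrib_right sum.distrib)
qed

lemma act_smult: "act (smult a p) Z s = a * act p Z s"
  using act_bound[OF degree_smult_le[of a p], of Z s]
  by (simp add: act_def sum_distrib_left mult.assoc)

lemma act_uminus: "act (- p) Z s = - act p Z s"
  using act_smult[of "-1" p Z s] by simp

lemma act_diff: "act (p - q) Z s = act p Z s - act q Z s"
  using act_add[of p "- q" Z s] by (simp add: act_uminus)

lemma act_sum: "act (\<Sum>i\<in>I. p i) Z s = (\<Sum>i\<in>I. act (p i) Z s)"
  by (induction I rule: infinite_finite_induct) (auto simp: act_add)

lemma act_pCons: "act (pCons a q) Z s = a * Z s + act q Z (Suc s)"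
proof -
  have "act (pCons a q) Z s = (\<Sum>i\<le>Suc (degree q). coeff (pCons a q) i * Z (i + s))"
    by (rule act_bound) (simp add: degree_pCons_le)
  then show ?thesis by (simp add: sum.atMost_Suc_shift act_def del: sum.atMost_Suc)
qed

lemma act_mult: "act (p * q) Z s = act p (act q Z) s"
proof (induction p arbitrary: s)
  case (pCons a p)
  then show ?case by (simp add: act_pCons act_add act_smult)
qed simp

lemma act_monom: "act (monom a n) Z s = a * Z (n + s)"
proof (induction n arbitrary: s)
  case 0
  then show ?case by (simp add: monom_0 act_pCons)
next
  case (Suc n)
  then show ?case by (simp add: monom_Suc act_pCons)
qed

lemma act_uminus_right: "act p (\<lambda>s. - Z s) s = - act p Z s"
  by (simp add: act_def sum_negf)

lemma act_sum_right: "act p (\<lambda>s. \<Sum>i\<in>I. Z i s) s = (\<Sum>i\<in>I. act p (Z i) s)"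
  unfolding act_def sum_distrib_left by (rule sum.swap)

text \<open>
  A row is a polynomial of degree at most one in the states and inputs; \<open>None\<close> carries its
  constant term.  On rows, \<open>row_step F\<close> is the derivative along the system up to derivatives of
  the inputs.
\<close>

type_synonym ('n, 'k, 'a) row = "('n + 'k) option \<Rightarrow> 'a"

text \<open>The argument \<open>c\<close> takes the place of the constant function 1, whose
  derivative of order \<open>s\<close> at 0 is \<open>0 ^ s\<close>.\<close>

definition row_eval :: "('n::finite, 'k::finite, 'a::field) row \<Rightarrow> ('n \<Rightarrow> 'a) \<Rightarrow> ('k \<Rightarrow> 'a) \<Rightarrow> 'a \<Rightarrow> 'a" where
  "row_eval w x u c =
     (\<Sum>n\<in>UNIV. w (Some (Inl n)) * x n) + (\<Sum>k\<in>UNIV. w (Some (Inr k)) * u k) + w None * c"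

definition row_step :: "('n::finite \<Rightarrow> ('n, 'k, 'a::field) row) \<Rightarrow> ('n, 'k, 'a) row \<Rightarrow> ('n, 'k, 'a) row" where
  "row_step F w = (\<lambda>o1. \<Sum>n\<in>UNIV. w (Some (Inl n)) * F n o1)"

definition nu :: "('n::finite \<Rightarrow> ('n, 'k, 'a::field) row) \<Rightarrow> ('n, 'k, 'a) row \<Rightarrow> nat \<Rightarrow> ('n, 'k, 'a) row" where
  "nu F G i = (row_step F ^^ i) G"

lemma nu_0 [simp]: "nu F G 0 = G" and nu_Suc: "nu F G (Suc i) = row_step F (nu F G i)"
  by (simp_all add: nu_def)

lemma nu_nu: "nu F (nu F G i) j = nu F G (i + j)"
  by (induction j) (simp_all add: nu_Suc)

lemma row_step_sum: "row_step F (\<lambda>o1. \<Sum>i\<in>I. c i * w i o1) = (\<lambda>o1. \<Sum>i\<in>I. c i * row_step F (w i) o1)"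
  by (rule ext) (simp add: row_step_def sum_distrib_left sum_distrib_right mult.assoc, rule sum.swap)

lemma nu_sum: "nu F (\<lambda>o1. \<Sum>i\<in>I. c i * w i o1) j = (\<lambda>o1. \<Sum>i\<in>I. c i * nu F (w i) j o1)"
  by (induction j) (simp_all add: nu_Suc row_step_sum)

lemma nu_zero [simp]: "nu F (\<lambda>_. 0) j = (\<lambda>_. 0)"
  by (induction j) (simp_all add: nu_Suc row_step_def)

lemma row_step_state_zero:
  assumes "\<And>n. w (Some (Inl n)) = 0"
  shows "row_step F w o1 = 0"
  using assms by (simp add: row_step_def)

text \<open>The system read on derivatives at 0. It is stated over any field, since it is applied to
  analytic solutions over the complex numbers and to formal ones over the rational
  functions.\<close>

definition seq_sol ::
  "('n::finite \<Rightarrow> ('n, 'k::finite, 'a::field) row) \<Rightarrow> ('n, 'k, 'a) row \<Rightarrow>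
   ('n \<Rightarrow> nat \<Rightarrow> 'a) \<Rightarrow> ('k \<Rightarrow> nat \<Rightarrow> 'a) \<Rightarrow> (nat \<Rightarrow> 'a) \<Rightarrow> bool" where
  "seq_sol F G X U Y \<longleftrightarrow>
     (\<forall>n s. X n (Suc s) = row_eval (F n) (\<lambda>n. X n s) (\<lambda>k. U k s) (0 ^ s)) \<and>
     (\<forall>s. Y s = row_eval G (\<lambda>n. X n s) (\<lambda>k. U k s) (0 ^ s))"

text \<open>Collects the input derivatives that \<open>row_step\<close> drops: the input entry of
  row \<open>j\<close> is differentiated \<open>i - j\<close> more times before it reaches the
  output derivative of order \<open>i\<close>.\<close>

definition input_poly :: "('n::finite \<Rightarrow> ('n, 'k, 'a::field) row) \<Rightarrow> ('n, 'k, 'a) row \<Rightarrow> nat \<Rightarrow> 'k \<Rightarrow> 'a poly" where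
  "input_poly F G i k = (\<Sum>j\<le>i. monom (nu F G j (Some (Inr k))) (i - j))"

lemma coeff_input_poly:
  "coeff (input_poly F G i k) m = (if m \<le> i then nu F G (i - m) (Some (Inr k)) else 0)"
proof -
  have "coeff (input_poly F G i k) m =
      (\<Sum>j\<le>i. if j = i - m \<and> m \<le> i then nu F G j (Some (Inr k)) else 0)"
    unfolding input_poly_def coeff_sum by (intro sum.cong) (auto simp: coeff_monom)
  then show ?thesis by auto
qed

lemma degree_input_poly: "degree (input_poly F G i k) \<le> i"
  by (rule degree_le) (simp add: coeff_input_poly)

lemma input_poly_Suc: "input_poly F G (Suc i) k = pCons (nu F G (Suc i) (Some (Inr k))) (input_poly F G i k)"
  by (rule poly_eqI) (auto simp: coeff_input_poly coeff_pCons split: nat.split)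

lemma input_poly_0: "input_poly F G 0 k = [:G (Some (Inr k)):]"
  by (rule poly_eqI) (auto simp: coeff_input_poly coeff_pCons split: nat.split)

lemma row_eval_step:
  "(\<Sum>n\<in>UNIV. w (Some (Inl n)) * row_eval (F n) x u c) = row_eval (row_step F w) x u c"
proof -
  have "(\<Sum>n\<in>UNIV. \<Sum>i\<in>UNIV. w (Some (Inl n)) * (F n (Some (Inl i)) * x i)) =
        (\<Sum>i\<in>UNIV. \<Sum>n\<in>UNIV. w (Some (Inl n)) * (F n (Some (Inl i)) * x i))" by (rule sum.swap)
  moreover have "(\<Sum>n\<in>UNIV. \<Sum>i\<in>UNIV. w (Some (Inl n)) * (F n (Some (Inr i)) * u i)) =
        (\<Sum>i\<in>UNIV. \<Sum>n\<in>UNIV. w (Some (Inl n)) * (F n (Some (Inr i)) * u i))" by (rule sum.swap)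
  ultimately show ?thesis
    by (simp add: row_eval_def row_step_def distrib_left sum.distrib sum_distrib_left sum_distrib_right mult.assoc)
qed

text \<open>For a shift \<open>s > 0\<close> the constant term disappears, as derivatives of a
  constant do.\<close>

lemma seq_sol_output:
  assumes "seq_sol F G X U Y"
  shows "Y (i + s) = (\<Sum>n\<in>UNIV. nu F G i (Some (Inl n)) * X n s) + nu F G i None * 0 ^ s +
    (\<Sum>k\<in>UNIV. act (input_poly F G i k) (U k) s)"
proof (induction i arbitrary: s)
  case 0
  then show ?case using assms
    by (simp add: seq_sol_def row_eval_def input_poly_0 act_pCons)
next
  case (Suc i)
  have X: "X n (Suc s) = row_eval (F n) (\<lambda>n. X n s) (\<lambda>k. U k s) (0 ^ s)" for n
    using assms by (simp add: seq_sol_def)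
  have "Y (Suc i + s) = Y (i + Suc s)" by simp
  also have "\<dots> = row_eval (nu F G (Suc i)) (\<lambda>n. X n s) (\<lambda>k. U k s) (0 ^ s) +
      (\<Sum>k\<in>UNIV. act (input_poly F G i k) (U k) (Suc s))"
    unfolding Suc.IH X row_eval_step nu_Suc by simp
  also have "\<dots> = (\<Sum>n\<in>UNIV. nu F G (Suc i) (Some (Inl n)) * X n s) + nu F G (Suc i) None * 0 ^ s +
    (\<Sum>k\<in>UNIV. act (input_poly F G (Suc i) k) (U k) s)"
    by (simp add: row_eval_def input_poly_Suc act_pCons sum.distrib)
  finally show ?case .
qed

lemma seq_sol_change_output:
  assumes "seq_sol F G X U Y"
  shows "seq_sol F w X U (\<lambda>s. row_eval w (\<lambda>n. X n s) (\<lambda>k. U k s) (0 ^ s))"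
  using assms by (simp add: seq_sol_def)

definition comb :: "(nat \<Rightarrow> ('n, 'k, 'a::field) row) \<Rightarrow> 'a poly \<Rightarrow> ('n, 'k, 'a) row" where
  "comb V p = (\<lambda>o1. \<Sum>i\<le>degree p. coeff p i * V i o1)"

text \<open>The complete input part of the operator \<open>p\<close> applied to the output. Its
  constant coefficient repeats the input entry of \<open>comb (nu F G) p\<close>.\<close>

definition input_comb :: "('n::finite \<Rightarrow> ('n, 'k, 'a::field) row) \<Rightarrow> ('n, 'k, 'a) row \<Rightarrow> 'a poly \<Rightarrow> 'k \<Rightarrow> 'a poly" where
  "input_comb F G p k = (\<Sum>i\<le>degree p. smult (coeff p i) (input_poly F G i k))"

lemma comb_bound: "degree p \<le> N \<Longrightarrow> comb V p o1 = (\<Sum>i\<le>N. coeff p i * V i o1)"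
  unfolding comb_def by (rule sum.mono_neutral_left) (auto simp: coeff_eq_0)

lemma act_output:
  assumes "seq_sol F G X U Y"
  shows "act p Y s = (\<Sum>n\<in>UNIV. comb (nu F G) p (Some (Inl n)) * X n s) + comb (nu F G) p None * 0 ^ s +
    (\<Sum>k\<in>UNIV. act (input_comb F G p k) (U k) s)"
proof -
  have "act p Y s = (\<Sum>i\<le>degree p. \<Sum>n\<in>UNIV. coeff p i * nu F G i (Some (Inl n)) * X n s) +
      (\<Sum>i\<le>degree p. coeff p i * nu F G i None * 0 ^ s) +
      (\<Sum>i\<le>degree p. \<Sum>k\<in>UNIV. coeff p i * act (input_poly F G i k) (U k) s)"
    unfolding act_def seq_sol_output[OF assms] by (simp add: distrib_left sum.distrib sum_distrib_left mult.assoc)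
  also have "(\<Sum>i\<le>degree p. \<Sum>n\<in>UNIV. coeff p i * nu F G i (Some (Inl n)) * X n s) =
      (\<Sum>n\<in>UNIV. comb (nu F G) p (Some (Inl n)) * X n s)"
    by (subst sum.swap) (simp add: comb_def sum_distrib_right)
  also have "(\<Sum>i\<le>degree p. coeff p i * nu F G i None * 0 ^ s) = comb (nu F G) p None * 0 ^ s"
    by (simp add: comb_def sum_distrib_right)
  also have "(\<Sum>i\<le>degree p. \<Sum>k\<in>UNIV. coeff p i * act (input_poly F G i k) (U k) s) =
      (\<Sum>k\<in>UNIV. act (input_comb F G p k) (U k) s)"
    by (subst sum.swap) (simp add: input_comb_def act_sum act_smult)
  finally show ?thesis .
qed

lemma degree_input_comb: "degree (input_comb F G p k) \<le> degree p"
  unfolding input_comb_def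
  by (intro degree_sum_le) (auto intro: order_trans[OF degree_smult_le] order_trans[OF degree_input_poly])

lemma coeff_input_comb:
  "coeff (input_comb F G p k) m = (\<Sum>i\<in>{m..degree p}. coeff p i * nu F G (i - m) (Some (Inr k)))"
proof -
  have "coeff (input_comb F G p k) m =
      (\<Sum>i\<le>degree p. if m \<le> i then coeff p i * nu F G (i - m) (Some (Inr k)) else 0)"
    unfolding input_comb_def coeff_sum by (intro sum.cong) (auto simp: coeff_input_poly)
  also have "\<dots> = (\<Sum>i\<in>{i\<in>{..degree p}. m \<le> i}. coeff p i * nu F G (i - m) (Some (Inr k)))"
    by (subst sum.inter_filter) auto
  also have "{i\<in>{..degree p}. m \<le> i} = {m..degree p}" by auto
  finally show ?thesis .
qed

lemma comb_nu: "comb (nu F G) (monom 1 1 * p) = comb (\<lambda>i. nu F G (Suc i)) p"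
proof (rule ext)
  fix o1
  have "comb (nu F G) (monom 1 1 * p) o1 = (\<Sum>i\<le>Suc (degree p). coeff (monom 1 1 * p) i * nu F G i o1)"
    by (rule comb_bound) (use degree_mult_le[of "monom 1 1" p] in \<open>simp add: degree_monom_eq\<close>)
  then show "comb (nu F G) (monom 1 1 * p) o1 = comb (\<lambda>i. nu F G (Suc i)) p o1"
    by (simp add: sum.atMost_Suc_shift coeff_monom_mult comb_def del: sum.atMost_Suc)
qed

lemma comb_nu_Suc: "comb (\<lambda>i. nu F G (Suc i)) p = row_step F (comb (nu F G) p)"
  by (simp add: comb_def row_step_sum nu_Suc)

text \<open>The bound on the order leaves finitely many coefficients, so that the condition holds on
  a nonempty open set of inputs.\<close>

definition input_independent :: "nat \<Rightarrow> ('k::finite \<Rightarrow> nat \<Rightarrow> 'a::field) \<Rightarrow> bool" where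
  "input_independent N U \<longleftrightarrow>
     (\<forall>q. (\<forall>k. degree (q k) \<le> N) \<and> (\<forall>s. (\<Sum>k\<in>UNIV. act (q k) (U k) s) = 0) \<longrightarrow> (\<forall>k. q k = 0))"

lemma input_independentD:
  "input_independent N U \<Longrightarrow> (\<And>k. degree (q k) \<le> N) \<Longrightarrow> (\<And>s. (\<Sum>k\<in>UNIV. act (q k) (U k) s) = 0) \<Longrightarrow> q k = 0"
  unfolding input_independent_def by blast

text \<open>Applying \<open>M\<close> eliminates the states, and the inputs then occur with order at
  most \<open>degree M\<close>. The assumed relation gives the operators \<open>M * l k\<close>
  instead, whose order is too large unless \<open>l k = 0\<close>, because \<open>l k\<close> has no
  constant coefficient. So the value of \<open>w\<close> vanishes along the solution together with
  all its derivatives.\<close>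

lemma row_relation:
  assumes sol: "seq_sol F G X U Y" and U: "input_independent N U"
    and M: "lead_coeff M = 1" "comb (nu F w) M = (\<lambda>_. 0)"
    and l: "\<And>k. coeff (l k) 0 = 0" "\<And>k. degree M + degree (l k) \<le> N"
    and rel: "\<And>s. row_eval w (\<lambda>n. X n s) (\<lambda>k. U k s) (0 ^ s) + (\<Sum>k\<in>UNIV. act (l k) (U k) s) = 0"
  shows "nu F w t (Some (Inr k)) = 0" "(\<Sum>n\<in>UNIV. nu F w t (Some (Inl n)) * X n 0) + nu F w t None = 0"
proof -
  define Z where "Z s = row_eval w (\<lambda>n. X n s) (\<lambda>k. U k s) (0 ^ s)" for s
  have Z: "seq_sol F w X U Z" unfolding Z_def[abs_def] by (rule seq_sol_change_output[OF sol])
  define P where "P = input_comb F w M"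
  have 1: "act M Z s = (\<Sum>k\<in>UNIV. act (P k) (U k) s)" for s
    using act_output[OF Z, of M s] M(2) by (simp add: P_def)
  have "Z = (\<lambda>s. - (\<Sum>k\<in>UNIV. act (l k) (U k) s))"
    using rel by (auto simp: Z_def eq_neg_iff_add_eq_0)
  then have 2: "act M Z s = - (\<Sum>k\<in>UNIV. act (M * l k) (U k) s)" for s
    by (simp add: act_uminus_right act_sum_right act_mult)
  have "M * l k + P k = 0" for k
  proof (rule input_independentD[OF U])
    show "degree (M * l k + P k) \<le> N" for k
    proof (rule degree_add_le)
      show "degree (M * l k) \<le> N" by (rule order_trans[OF degree_mult_le l(2)])
      show "degree (P k) \<le> N" unfolding P_def using degree_input_comb[of F w M k] l(2)[of k] by linarith
    qed
    show "(\<Sum>k\<in>UNIV. act (M * l k + P k) (U k) s) = 0" for s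
      using trans[OF 1[of s, symmetric] 2[of s]] by (simp only: act_add sum.distrib add_eq_0_iff)
  qed
  then have Pl: "P k = - (M * l k)" for k by (simp add: add_eq_0_iff)
  have l0: "l k = 0" for k
  proof (rule ccontr)
    assume lk: "l k \<noteq> 0"
    have "degree (l k) \<noteq> 0"
    proof
      assume "degree (l k) = 0"
      then show False using l(1)[of k] lk by (metis leading_coeff_0_iff)
    qed
    moreover have "M \<noteq> 0" using M(1) by auto
    then have "degree (P k) = degree M + degree (l k)" using lk by (simp add: Pl degree_mult_eq)
    ultimately show False using degree_input_comb[of F w M k] by (simp add: P_def)
  qed
  have P0: "P k = 0" for k by (simp add: Pl l0)
  \<comment> \<open>The coefficients of \<open>P k\<close> form a triangular system for the input
    entries up to index \<open>degree M\<close>; the recurrence given by \<open>M\<close> settles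
    the later ones.\<close>
  have rec: "nu F w t (Some (Inr k)) = 0" for t k
  proof (induction t rule: less_induct)
    case (less t)
    show ?case
    proof (cases "t \<le> degree M")
      case True
      have "0 = coeff (P k) (degree M - t)" by (simp add: P0)
      also have "\<dots> = (\<Sum>i\<in>{degree M - t..degree M}. coeff M i * nu F w (i - (degree M - t)) (Some (Inr k)))"
        by (simp add: P_def coeff_input_comb)
      also have "\<dots> = (\<Sum>i\<in>{degree M}. coeff M i * nu F w (i - (degree M - t)) (Some (Inr k)))"
      proof (rule sum.mono_neutral_right)
        show "\<forall>i\<in>{degree M - t..degree M} - {degree M}. coeff M i * nu F w (i - (degree M - t)) (Some (Inr k)) = 0"
          using less.IH True by auto
      qed auto
      finally show ?thesis using M(1) True by simp
    next
      case False
      define e where "e = t - degree M"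
      have "nu F (comb (nu F w) M) e (Some (Inr k)) = 0"
        by (simp add: M(2))
      then have "0 = (\<Sum>i\<le>degree M. coeff M i * nu F w (i + e) (Some (Inr k)))"
        unfolding comb_def nu_sum nu_nu by simp
      also have "\<dots> = (\<Sum>i\<in>{degree M}. coeff M i * nu F w (i + e) (Some (Inr k)))"
      proof (rule sum.mono_neutral_right)
        show "\<forall>i\<in>{..degree M} - {degree M}. coeff M i * nu F w (i + e) (Some (Inr k)) = 0"
          using less.IH False by (auto simp: e_def)
      qed auto
      finally show ?thesis using M(1) False by (simp add: e_def)
    qed
  qed
  then show "nu F w t (Some (Inr k)) = 0" .
  have "Z t = 0" using rel by (simp add: Z_def l0)
  moreover have "input_poly F w t k = 0" for k by (simp add: input_poly_def rec)
  ultimately show "(\<Sum>n\<in>UNIV. nu F w t (Some (Inl n)) * X n 0) + nu F w t None = 0"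
    using seq_sol_output[OF Z, of t 0] by simp
qed

text \<open>
  The initial values \<open>x\<close> are generic for the derivatives \<open>1, \<dots>, r\<close> of the output.  Working with
  \<open>y'\<close> instead of \<open>y\<close> removes the constant term of the input-output equation, which is needed
  because a first integral of the system takes a different constant value on each solution.
\<close>

definition generic_initial ::
  "('n::finite \<Rightarrow> ('n, 'k, 'a::field) row) \<Rightarrow> ('n, 'k, 'a) row \<Rightarrow> nat \<Rightarrow> ('n \<Rightarrow> 'a) \<Rightarrow> bool" where
  "generic_initial F G r x \<longleftrightarrow>
     (\<forall>c. (\<forall>j. (\<forall>k. (\<Sum>i<r. c i * nu F G (Suc (i + j)) (Some (Inr k))) = 0) \<and>
               (\<Sum>i<r. c i * ((\<Sum>n\<in>UNIV. nu F G (Suc (i + j)) (Some (Inl n)) * x n) + nu F G (Suc (i + j)) None)) = 0)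
      \<longrightarrow> (\<forall>i<r. c i = 0))"

text \<open>There is one more row than there are coordinates, hence a relation, which is then made
  monic.\<close>

lemma annihilating_poly:
  fixes F :: "'n::finite \<Rightarrow> ('n, 'k::finite, 'a::field) row"
  shows "\<exists>M. lead_coeff M = 1 \<and> degree M \<le> CARD(('n + 'k) option) \<and> comb (nu F G) M = (\<lambda>_. 0)"
proof -
  let ?N = "CARD(('n + 'k) option)"
  obtain c where c: "\<exists>i\<in>{..?N}. c i \<noteq> 0" "\<And>o1. (\<Sum>i\<le>?N. c i * nu F G i o1) = 0"
    using dependent_family[of "UNIV :: ('n + 'k) option set" "{..?N}" "nu F G"] by auto
  define p where "p = (\<Sum>i\<le>?N. monom (c i) i)"
  have coeff_p: "coeff p i = (if i \<le> ?N then c i else 0)" for i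
    unfolding p_def coeff_sum by (simp add: coeff_monom)
  have degp: "degree p \<le> ?N" by (rule degree_le) (simp add: coeff_p)
  have "p \<noteq> 0" using c(1) coeff_p by (metis atMost_iff coeff_0)
  define M where "M = smult (inverse (lead_coeff p)) p"
  have "comb (nu F G) M o1 = 0" for o1
  proof -
    have "comb (nu F G) M o1 = (\<Sum>i\<le>?N. coeff M i * nu F G i o1)"
      using degp by (intro comb_bound) (simp add: M_def)
    also have "\<dots> = inverse (lead_coeff p) * (\<Sum>i\<le>?N. c i * nu F G i o1)"
      unfolding sum_distrib_left by (intro sum.cong) (auto simp: M_def coeff_p)
    finally show ?thesis using c(2) by simp
  qed
  moreover have "lead_coeff M = 1" using \<open>p \<noteq> 0\<close> by (simp add: M_def)
  moreover have "degree M \<le> ?N" using degp by (simp add: M_def)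
  ultimately show ?thesis by (intro exI[of _ M]) auto
qed

text \<open>Genericity of the initial values turns a relation along this one solution into the
  trivial one. The bound on \<open>N\<close> adds the order \<open>Suc r\<close> of the input
  operators to the degree of an annihilating polynomial.\<close>

lemma output_independent:
  fixes F :: "'n::finite \<Rightarrow> ('n, 'k::finite, 'a::field) row"
  assumes sol: "seq_sol F G X U Y" and U: "input_independent N U"
    and gen: "generic_initial F G r (\<lambda>n. X n 0)"
    and N: "Suc r + CARD(('n + 'k) option) \<le> N"
    and p: "p = 0 \<or> degree p < r"
    and d: "\<And>k. coeff (d k) 0 = 0" "\<And>k. degree (d k) \<le> Suc r"
    and rel: "\<And>s. act (pCons 0 p) Y s + (\<Sum>k\<in>UNIV. act (d k) (U k) s) = 0"
  shows "p = 0" "d k = 0"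
proof -
  define w where "w = comb (nu F G) (pCons 0 p)"
  \<comment> \<open>The inputs of order zero are already counted in \<open>row_eval w\<close>, hence
    the subtraction.\<close>
  define l where "l k = d k + input_comb F G (pCons 0 p) k - [:w (Some (Inr k)):]" for k
  have deg: "degree (pCons 0 p) \<le> r" using p by auto
  have w: "nu F w t o1 = (\<Sum>i<r. coeff p i * nu F G (Suc (i + t)) o1)" for t o1
  proof -
    have "nu F w t o1 = (\<Sum>i\<le>r. coeff (pCons 0 p) i * nu F G (i + t) o1)"
    proof -
      have "w = (\<lambda>o1. \<Sum>i\<le>r. coeff (pCons 0 p) i * nu F G i o1)"
        unfolding w_def using comb_bound[OF deg] by blast
      then show ?thesis by (simp add: nu_sum nu_nu)
    qed
    also have "\<dots> = (\<Sum>i<r. coeff p i * nu F G (Suc (i + t)) o1)"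
      by (simp add: lessThan_Suc_atMost[symmetric] sum.lessThan_Suc_shift del: sum.lessThan_Suc)
    finally show ?thesis .
  qed
  obtain M where M: "lead_coeff M = 1" "degree M \<le> CARD(('n + 'k) option)" "comb (nu F G) M = (\<lambda>_. 0)"
    using annihilating_poly by blast
  \<comment> \<open>Operators with constant coefficients commute: what annihilates the rows of
    \<open>G\<close> also annihilates those of \<open>w\<close>.\<close>
  have M2: "comb (nu F w) M = (\<lambda>_. 0)"
  proof
    fix o1
    have "nu F (comb (nu F G) M) e o1 = 0" for e o1 by (simp add: M(3))
    then have 0: "(\<Sum>t\<le>degree M. coeff M t * nu F G (t + e) o1) = 0" for e o1
      unfolding comb_def nu_sum nu_nu .
    have "comb (nu F w) M o1 = (\<Sum>t\<le>degree M. \<Sum>i<r. coeff p i * (coeff M t * nu F G (t + Suc i) o1))"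
      unfolding comb_def w by (simp add: sum_distrib_left algebra_simps)
    also have "\<dots> = 0" by (subst sum.swap) (use 0[of "Suc _"] in \<open>simp flip: sum_distrib_left\<close>)
    finally show "comb (nu F w) M o1 = 0" .
  qed
  have l0: "coeff (l k) 0 = 0" for k
  proof -
    have "coeff (input_comb F G (pCons 0 p) k) 0 = w (Some (Inr k))"
      unfolding coeff_input_comb w_def comb_def by (simp add: atMost_atLeast0)
    then show ?thesis using d(1) by (simp add: l_def)
  qed
  have l1: "degree M + degree (l k) \<le> N" for k
  proof -
    have "degree (l k) \<le> Suc r" unfolding l_def
      using d(2) le_SucI[OF order_trans[OF degree_input_comb deg]] by (intro degree_diff_le degree_add_le) auto
    then show ?thesis using M(2) N by linarith
  qed
  have rel': "row_eval w (\<lambda>n. X n s) (\<lambda>k. U k s) (0 ^ s) + (\<Sum>k\<in>UNIV. act (l k) (U k) s) = 0" for s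
    using rel[of s] unfolding act_output[OF sol] 
    by (simp add: row_eval_def w_def[symmetric] l_def act_add act_diff act_pCons sum.distrib sum_subtractf algebra_simps)
  note R = row_relation[OF sol U M(1) M2 l0 l1 rel']
  have "\<forall>i<r. coeff p i = 0"
  proof (rule gen[unfolded generic_initial_def, THEN spec[of _ "coeff p"], THEN mp], rule allI)
    fix j
    show "(\<forall>k. (\<Sum>i<r. coeff p i * nu F G (Suc (i + j)) (Some (Inr k))) = 0) \<and>
      (\<Sum>i<r. coeff p i * ((\<Sum>n\<in>UNIV. nu F G (Suc (i + j)) (Some (Inl n)) * X n 0) + nu F G (Suc (i + j)) None)) = 0"
    proof (intro conjI allI)
      show "(\<Sum>i<r. coeff p i * nu F G (Suc (i + j)) (Some (Inr k))) = 0" for k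
        using R(1)[of j k] by (simp add: w)
      have "(\<Sum>i<r. coeff p i * ((\<Sum>n\<in>UNIV. nu F G (Suc (i + j)) (Some (Inl n)) * X n 0) + nu F G (Suc (i + j)) None)) =
        (\<Sum>n\<in>UNIV. nu F w j (Some (Inl n)) * X n 0) + nu F w j None"
        unfolding w distrib_left sum.distrib sum_distrib_left sum_distrib_right
        by (subst sum.swap) (simp add: mult.assoc)
      then show "(\<Sum>i<r. coeff p i * ((\<Sum>n\<in>UNIV. nu F G (Suc (i + j)) (Some (Inl n)) * X n 0) + nu F G (Suc (i + j)) None)) = 0"
        using R(2)[of j] by simp
    qed
  qed
  then show p0: "p = 0" using p by (metis leading_coeff_0_iff)
  show "d k = 0"
  proof (rule input_independentD[OF U])
    show "degree (d k) \<le> N" for k using d(2)[of k] N by linarith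
    show "(\<Sum>k\<in>UNIV. act (d k) (U k) s) = 0" for s using rel[of s] p0 by simp
  qed
qed

section \<open>Analytic solutions\<close>

lemma sum_UNIV_sum:
  fixes h :: "'n::finite + 'k::finite \<Rightarrow> 'b::comm_monoid_add"
  shows "(\<Sum>v\<in>UNIV. h v) = (\<Sum>n\<in>UNIV. h (Inl n)) + (\<Sum>k\<in>UNIV. h (Inr k))"
  by (subst UNIV_Plus_UNIV[symmetric], subst sum.Plus) auto

lemma sum_UNIV_row:
  fixes h :: "('n::finite + 'k::finite) option \<Rightarrow> 'b::comm_monoid_add"
  shows "(\<Sum>o1\<in>UNIV. h o1) = (\<Sum>n\<in>UNIV. h (Some (Inl n))) + (\<Sum>k\<in>UNIV. h (Some (Inr k))) + h None"
  by (simp add: UNIV_option_conv sum.reindex sum_UNIV_sum ac_simps)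

section \<open>Analytic functions and their derivatives at 0\<close>

definition jet :: "(complex \<Rightarrow> complex) \<Rightarrow> nat \<Rightarrow> complex" where
  "jet f s = (deriv ^^ s) f 0"

lemma jet_fps: "f has_fps_expansion F \<Longrightarrow> jet f s = fact s * fps_nth F s"
  by (simp add: jet_def fps_nth_fps_expansion)

lemma eventually_eq_iff_jet:
  assumes "f analytic_on {0}" "g analytic_on {0}"
  shows "(\<forall>\<^sub>F t in nhds 0. f t = g t) \<longleftrightarrow> jet f = jet g"
proof
  assume "\<forall>\<^sub>F t in nhds 0. f t = g t"
  then show "jet f = jet g" by (intro ext) (simp add: jet_def higher_deriv_cong_ev)
next
  assume eq: "jet f = jet g"
  have f: "f has_fps_expansion fps_expansion f 0" and g: "g has_fps_expansion fps_expansion g 0"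
    using assms analytic_at_imp_has_fps_expansion_0 by auto
  have "fps_expansion f 0 = fps_expansion g 0"
    using eq by (simp add: fps_expansion_def jet_def fun_eq_iff)
  then have "\<forall>\<^sub>F t in nhds 0. eval_fps (fps_expansion f 0) t = f t" "\<forall>\<^sub>F t in nhds 0. eval_fps (fps_expansion f 0) t = g t"
    using f g by (auto simp: has_fps_expansion_def)
  then show "\<forall>\<^sub>F t in nhds 0. f t = g t" by eventually_elim simp
qed

definition row_fps :: "('n::finite, 'k::finite, complex) row \<Rightarrow> ('n \<Rightarrow> complex fps) \<Rightarrow> ('k \<Rightarrow> complex fps) \<Rightarrow> complex fps" where
  "row_fps w X U = (\<Sum>n\<in>UNIV. fps_const (w (Some (Inl n))) * X n) +
     (\<Sum>k\<in>UNIV. fps_const (w (Some (Inr k))) * U k) + fps_const (w None)"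

lemma row_has_fps_expansion:
  assumes "\<And>n. x n has_fps_expansion X n" "\<And>k. u k has_fps_expansion U k"
  shows "(\<lambda>t. row_eval w (\<lambda>n. x n t) (\<lambda>k. u k t) 1) has_fps_expansion row_fps w X U"
  unfolding row_eval_def row_fps_def mult_1_right
  by (intro has_fps_expansion_add has_fps_expansion_sum has_fps_expansion_mult has_fps_expansion_const assms)

lemma row_fps_nth:
  "fps_nth (row_fps w X U) s = row_eval w (\<lambda>n. fps_nth (X n) s) (\<lambda>k. fps_nth (U k) s) (0 ^ s)"
  by (simp add: row_eval_def row_fps_def fps_sum_nth power_0_left)

text \<open>Serves to pass from Taylor coefficients to derivatives: for \<open>c = 0 ^ s\<close> and
  \<open>a = fact s\<close> the condition holds, as \<open>fact 0 = 1\<close>.\<close>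

lemma row_eval_scale:
  assumes "c \<noteq> 0 \<Longrightarrow> a = 1"
  shows "a * row_eval w x u c = row_eval w (\<lambda>n. a * x n) (\<lambda>k. a * u k) c"
proof -
  have "a * (w None * c) = w None * c" using assms by (cases "c = 0") auto
  then show ?thesis by (simp add: row_eval_def distrib_left sum_distrib_left mult.left_commute)
qed

definition is_row_solution ::
  "('n::finite \<Rightarrow> ('n, 'k::finite, complex) row) \<Rightarrow> ('k \<Rightarrow> complex \<Rightarrow> complex) \<Rightarrow> ('n \<Rightarrow> complex \<Rightarrow> complex) \<Rightarrow> bool" where
  "is_row_solution F u x \<longleftrightarrow> (\<forall>n. x n analytic_on {0}) \<and>
     (\<forall>n. \<forall>\<^sub>F t in nhds 0. deriv (x n) t = row_eval (F n) (\<lambda>n. x n t) (\<lambda>k. u k t) 1)"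

lemma jet_seq_sol:
  fixes F :: "'n::finite \<Rightarrow> ('n, 'k::finite, complex) row"
  assumes u: "\<And>k. u k analytic_on {0}" and x: "is_row_solution F u x"
    and y: "\<forall>\<^sub>F t in nhds 0. y t = row_eval G (\<lambda>n. x n t) (\<lambda>k. u k t) 1"
  shows "seq_sol F G (\<lambda>n. jet (x n)) (\<lambda>k. jet (u k)) (jet y)"
proof -
  define X where "X n = fps_expansion (x n) 0" for n
  define U where "U k = fps_expansion (u k) 0" for k
  have X: "x n has_fps_expansion X n" for n
    using x analytic_at_imp_has_fps_expansion_0 by (auto simp: is_row_solution_def X_def)
  have U: "u k has_fps_expansion U k" for k
    using u analytic_at_imp_has_fps_expansion_0 by (auto simp: U_def)
  have row: "jet (\<lambda>t. row_eval w (\<lambda>n. x n t) (\<lambda>k. u k t) 1) s = row_eval w (\<lambda>n. jet (x n) s) (\<lambda>k. jet (u k) s) (0 ^ s)" for w s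
  proof -
    have "jet (\<lambda>t. row_eval w (\<lambda>n. x n t) (\<lambda>k. u k t) 1) s =
        fact s * row_eval w (\<lambda>n. fps_nth (X n) s) (\<lambda>k. fps_nth (U k) s) (0 ^ s)"
      by (simp add: jet_fps[OF row_has_fps_expansion[OF X U]] row_fps_nth)
    also have "\<dots> = row_eval w (\<lambda>n. jet (x n) s) (\<lambda>k. jet (u k) s) (0 ^ s)"
      by (subst row_eval_scale) (auto simp: jet_fps[OF X] jet_fps[OF U] power_0_left split: if_splits)
    finally show ?thesis .
  qed
  have "jet (x n) (Suc s) = row_eval (F n) (\<lambda>n. jet (x n) s) (\<lambda>k. jet (u k) s) (0 ^ s)" for n s
  proof -
    have "jet (x n) (Suc s) = (deriv ^^ s) (deriv (x n)) 0"
      unfolding jet_def by (simp add: funpow_Suc_right del: funpow.simps)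
    also have "\<dots> = jet (\<lambda>t. row_eval (F n) (\<lambda>n. x n t) (\<lambda>k. u k t) 1) s"
      unfolding jet_def using x by (intro higher_deriv_cong_ev) (auto simp: is_row_solution_def)
    finally show ?thesis by (simp add: row)
  qed
  moreover have "jet y s = jet (\<lambda>t. row_eval G (\<lambda>n. x n t) (\<lambda>k. u k t) 1) s" for s
    unfolding jet_def by (rule higher_deriv_cong_ev[OF y refl])
  ultimately show ?thesis by (simp add: seq_sol_def row)
qed

lemma fps_coeff_bound:
  fixes F :: "complex fps"
  assumes "fps_conv_radius F > 0"
  obtains M \<rho> where "M \<ge> 0" "\<rho> \<ge> 0" "\<And>s. norm (fps_nth F s) \<le> M * \<rho> ^ s"
proof -
  obtain r :: real where r: "r > 0" "ereal r < fps_conv_radius F"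
    using assms by (metis ereal_dense2 ereal_less(2) less_ereal.simps(1) zero_ereal_def)
  have "summable (\<lambda>s. fps_nth F s * of_real r ^ s)"
    by (rule summable_in_conv_radius) (use r in \<open>auto simp: fps_conv_radius_def\<close>)
  then have "Bseq (\<lambda>s. fps_nth F s * of_real r ^ s)"
    using summable_LIMSEQ_zero convergent_def convergent_imp_Bseq by blast
  then obtain M where M: "M > 0" "\<And>s. norm (fps_nth F s * of_real r ^ s) \<le> M"
    by (auto simp: Bseq_def)
  show thesis
  proof (rule that[of M "1 / r"])
    show "norm (fps_nth F s) \<le> M * (1 / r) ^ s" for s
      using M(2)[of s] r by (simp add: norm_mult norm_power field_simps)
  qed (use M r in auto)
qed

lemma fps_conv_radius_pos:
  fixes F :: "complex fps"
  assumes "\<And>s. norm (fps_nth F s) \<le> B * R ^ s" "R > 0"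
  shows "fps_conv_radius F > 0"
proof -
  let ?z = "complex_of_real (1 / (2 * R))"
  have "summable (\<lambda>s. fps_nth F s * ?z ^ s)"
  proof (rule summable_comparison_test')
    show "summable (\<lambda>s. B * (1 / 2) ^ s :: real)" by (intro summable_mult summable_geometric) simp
    fix s :: nat
    have "norm (fps_nth F s * ?z ^ s) = norm (fps_nth F s) * (1 / (2 * R)) ^ s"
      using assms(2) by (simp add: norm_mult norm_power norm_divide)
    also have "\<dots> \<le> B * R ^ s * (1 / (2 * R)) ^ s"
      using assms by (intro mult_right_mono) auto
    also have "\<dots> = B * (1 / 2) ^ s"
      using assms(2) by (simp add: power_mult_distrib power_divide)
    finally show "norm (fps_nth F s * ?z ^ s) \<le> B * (1 / 2) ^ s" .
  qed
  then have "conv_radius (fps_nth F) \<ge> norm ?z" by (rule conv_radius_geI)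
  moreover have "ereal (norm ?z) > 0" using assms(2) by simp
  ultimately show ?thesis unfolding fps_conv_radius_def by (metis order_less_le_trans)
qed

text \<open>Taylor coefficients are found recursively and bounded by the majorant
  \<open>B * R ^ s\<close>. Since the system is linear, one step multiplies the bound by at most
  \<open>R\<close>, and the divisor \<open>Suc s\<close> only helps.\<close>

lemma row_solution_exists:
  fixes F :: "'n::finite \<Rightarrow> ('n, 'k::finite, complex) row"
  assumes u: "\<And>k. u k analytic_on {0}"
  obtains x where "is_row_solution F u x" "\<And>n. x n 0 = x0 n"
proof -
  define U where "U k = fps_expansion (u k) 0" for k
  have U: "u k has_fps_expansion U k" for k
    using u analytic_at_imp_has_fps_expansion_0 by (auto simp: U_def)
  define c where "c = rec_nat x0 (\<lambda>s z n. row_eval (F n) z (\<lambda>k. fps_nth (U k) s) (0 ^ s) / of_nat (Suc s))"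
  have c0: "c 0 = x0" and cS: "c (Suc s) n = row_eval (F n) (c s) (\<lambda>k. fps_nth (U k) s) (0 ^ s) / of_nat (Suc s)" for s n
    by (simp_all add: c_def)
  have "\<forall>k. \<exists>M \<rho>. M \<ge> 0 \<and> \<rho> \<ge> 0 \<and> (\<forall>s. norm (fps_nth (U k) s) \<le> M * \<rho> ^ s)"
    using U fps_coeff_bound by (metis has_fps_expansion_def)
  then obtain M \<rho> where M: "\<And>k. M k \<ge> 0" "\<And>k. \<rho> k \<ge> (0::real)" "\<And>k s. norm (fps_nth (U k) s) \<le> M k * \<rho> k ^ s"
    by metis
  define K where "K = (\<Sum>n\<in>UNIV. \<Sum>o1\<in>UNIV. norm (F n o1))"
  have K: "(\<Sum>o1\<in>UNIV. norm (F n o1)) \<le> K" for n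
    unfolding K_def by (rule member_le_sum) (auto intro: sum_nonneg)
  have K0: "K \<ge> 0" unfolding K_def by (intro sum_nonneg) auto
  \<comment> \<open>\<open>R\<close> dominates the row sums of the system and the growth rates of
    the inputs. \<open>B\<close> dominates the initial values and the constants in the input bounds;
    it is at least 1 so that the constant term also fits.\<close>
  define R where "R = K + 1 + (\<Sum>k\<in>UNIV. \<rho> k)"
  define B where "B = 1 + (\<Sum>k\<in>UNIV. M k) + (\<Sum>n\<in>UNIV. norm (x0 n))"
  have sM: "0 \<le> (\<Sum>k\<in>UNIV. M k)" "0 \<le> (\<Sum>k\<in>UNIV. \<rho> k)" "0 \<le> (\<Sum>n\<in>UNIV. norm (x0 n))"
    using M by (auto intro: sum_nonneg)
  have R: "R \<ge> 1" "\<rho> k \<le> R" "K \<le> R" for k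
  proof -
    have "\<rho> k \<le> (\<Sum>k\<in>UNIV. \<rho> k)" using M by (intro member_le_sum) auto
    then show "R \<ge> 1" "\<rho> k \<le> R" "K \<le> R" using K0 sM by (auto simp: R_def)
  qed
  have B: "B \<ge> 1" "M k \<le> B" "norm (x0 n) \<le> B" for k n
  proof -
    have "M k \<le> (\<Sum>k\<in>UNIV. M k)" "norm (x0 n) \<le> (\<Sum>n\<in>UNIV. norm (x0 n))" using M by (intro member_le_sum; auto)+
    then show "B \<ge> 1" "M k \<le> B" "norm (x0 n) \<le> B" using sM by (auto simp: B_def)
  qed
  have Ub: "norm (fps_nth (U k) s) \<le> B * R ^ s" for k s
    by (rule order_trans[OF M(3)]) (intro mult_mono power_mono B R M zero_le_power; use B R in auto)
  have bound: "norm (c s n) \<le> B * R ^ s" for s n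
  proof (induction s arbitrary: n)
    case 0
    then show ?case using B by (simp add: c0)
  next
    case (Suc s)
    have BR: "1 \<le> B * R ^ s" using B(1) one_le_power[OF R(1), of s] by (metis mult_mono' mult_1 zero_le_one)
    have z: "norm ((0::complex) ^ s) \<le> B * R ^ s" using BR by (cases s) auto
    have "norm (row_eval (F n) (c s) (\<lambda>k. fps_nth (U k) s) (0 ^ s)) \<le>
      (\<Sum>m\<in>UNIV. norm (F n (Some (Inl m))) * (B * R ^ s)) + (\<Sum>k\<in>UNIV. norm (F n (Some (Inr k))) * (B * R ^ s)) + norm (F n None) * (B * R ^ s)"
      unfolding row_eval_def
      by (intro norm_triangle_le add_mono order_trans[OF norm_sum] sum_mono)
         (auto simp: norm_mult intro!: mult_left_mono Suc.IH Ub z)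
    also have "\<dots> = (\<Sum>o1\<in>UNIV. norm (F n o1)) * (B * R ^ s)"
      by (simp add: sum_UNIV_row distrib_right sum_distrib_right)
    also have "\<dots> \<le> R * (B * R ^ s)" using K[of n] R(3) BR by (intro mult_right_mono) auto
    finally have *: "norm (row_eval (F n) (c s) (\<lambda>k. fps_nth (U k) s) (0 ^ s)) \<le> B * R ^ Suc s" by (simp add: mult_ac)
    have "norm (c (Suc s) n) \<le> norm (row_eval (F n) (c s) (\<lambda>k. fps_nth (U k) s) (0 ^ s))"
      unfolding cS norm_divide norm_of_nat by (simp add: divide_le_eq mult_left_le_one_le mult_le_cancel_left1)
    then show ?case using * by linarith
  qed
  define X where "X n = Abs_fps (\<lambda>s. c s n)" for n
  have "fps_conv_radius (X n) > 0" for n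
    using R(1) by (intro fps_conv_radius_pos[of _ B R]) (auto simp: X_def bound)
  then have X: "eval_fps (X n) has_fps_expansion X n" for n by (rule eval_fps_has_fps_expansion)
  define x where "x n = eval_fps (X n)" for n
  have x: "x n has_fps_expansion X n" for n using X by (simp add: x_def)
  have "is_row_solution F u x"
    unfolding is_row_solution_def
  proof (intro conjI allI)
    show "x n analytic_on {0}" for n using x by (rule has_fps_expansion_imp_analytic_0)
    fix n
    have "fps_deriv (X n) = row_fps (F n) X U"
      by (rule fps_ext) (simp add: row_fps_nth X_def cS del: of_nat_Suc)
    then have d: "deriv (x n) has_fps_expansion row_fps (F n) X U" using has_fps_expansion_deriv[OF x[of n]] by simp
    have "(\<lambda>t. row_eval (F n) (\<lambda>n. x n t) (\<lambda>k. u k t) 1) has_fps_expansion row_fps (F n) X U"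
      by (rule row_has_fps_expansion[OF x U])
    then have "\<forall>\<^sub>F t in nhds 0. eval_fps (row_fps (F n) X U) t = row_eval (F n) (\<lambda>n. x n t) (\<lambda>k. u k t) 1"
      by (simp add: has_fps_expansion_def)
    moreover have "\<forall>\<^sub>F t in nhds 0. eval_fps (row_fps (F n) X U) t = deriv (x n) t"
      using d by (simp add: has_fps_expansion_def)
    ultimately show "\<forall>\<^sub>F t in nhds 0. deriv (x n) t = row_eval (F n) (\<lambda>n. x n t) (\<lambda>k. u k t) 1"
      by eventually_elim simp
  qed
  moreover have "x n 0 = x0 n" for n by (simp add: x_def eval_fps_at_0 X_def c0)
  ultimately show thesis by (rule that)
qed

text \<open>Polynomial inputs suffice. They turn a finitely supported point of an open set of
  derivative sequences into an actual input.\<close>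

lemma inputs_with_jets:
  fixes a :: "'k \<Rightarrow> nat \<Rightarrow> complex"
  assumes "\<And>k. finite {i. a k i \<noteq> 0}"
  obtains u where "\<And>k. u k analytic_on {0}" "\<And>k. jet (u k) = a k"
proof
  define p where "p k = (\<Sum>i\<in>{i. a k i \<noteq> 0}. fps_const (a k i / fact i) * fps_X ^ i)" for k
  define u where "u k t = (\<Sum>i\<in>{i. a k i \<noteq> 0}. a k i / fact i * t ^ i)" for k t
  have u: "u k has_fps_expansion p k" for k
    unfolding u_def[abs_def] p_def
    by (intro has_fps_expansion_sum has_fps_expansion_mult has_fps_expansion_const has_fps_expansion_fps_X_power)
  show "u k analytic_on {0}" for k using u by (rule has_fps_expansion_imp_analytic_0)
  show "jet (u k) = a k" for k
  proof
    fix s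
    have "fps_nth (p k) s = (\<Sum>i\<in>{i. a k i \<noteq> 0}. if i = s then a k s / fact s else 0)"
      unfolding p_def fps_sum_nth by (intro sum.cong) (auto simp: fps_X_power_nth)
    then have "fps_nth (p k) s = a k s / fact s" using assms by auto
    then show "jet (u k) s = a k s" by (simp add: jet_fps[OF u])
  qed
qed

section \<open>Linear elements of the differential ideal\<close>

lemma fps_deriv_prod:
  "finite S \<Longrightarrow> fps_deriv (\<Prod>v\<in>S. h v) = (\<Sum>v\<in>S. fps_deriv (h v) * (\<Prod>w\<in>S - {v}. h w))"
  for h :: "'v \<Rightarrow> 'a::comm_ring_1 fps"
proof (induction S rule: finite_induct)
  case (insert x S)
  have "(\<Prod>w\<in>insert x S - {v}. h w) = h x * (\<Prod>w\<in>S - {v}. h w)" if "v \<in> S" for v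
  proof -
    have "insert x S - {v} = insert x (S - {v})" using that insert.hyps by auto
    then show ?thesis using insert.hyps by simp
  qed
  then have "(\<Sum>v\<in>S. fps_deriv (h v) * (\<Prod>w\<in>insert x S - {v}. h w)) = h x * (\<Sum>v\<in>S. fps_deriv (h v) * (\<Prod>w\<in>S - {v}. h w))"
    unfolding sum_distrib_left by (intro sum.cong) (auto simp: mult.left_commute)
  moreover have "insert x S - {x} = S" using insert.hyps by auto
  ultimately show ?case using insert by simp
qed simp

lemma fps_deriv_mon_eval:
  fixes a :: "'v \<Rightarrow> 'a::comm_ring_1 fps"
  shows "fps_deriv (mon_eval a m) =
    (\<Sum>v\<in>Poly_Mapping.keys m. of_nat (Poly_Mapping.lookup m v) * mon_eval a (m - Poly_Mapping.single v 1) * fps_deriv (a v))"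
proof -
  let ?K = "Poly_Mapping.keys m"
  have "mon_eval a (m - Poly_Mapping.single v 1) =
      a v ^ (Poly_Mapping.lookup m v - 1) * (\<Prod>w\<in>?K - {v}. a w ^ Poly_Mapping.lookup m w)" if v: "v \<in> ?K" for v
  proof -
    have "Poly_Mapping.keys (m - Poly_Mapping.single v 1) \<subseteq> ?K"
      by (auto simp: in_keys_iff lookup_minus)
    then have "mon_eval a (m - Poly_Mapping.single v 1) =
        (\<Prod>w\<in>?K. a w ^ Poly_Mapping.lookup (m - Poly_Mapping.single v 1) w)"
      by (intro mon_eval_superset) auto
    also have "\<dots> = a v ^ Poly_Mapping.lookup (m - Poly_Mapping.single v 1) v *
        (\<Prod>w\<in>?K - {v}. a w ^ Poly_Mapping.lookup (m - Poly_Mapping.single v 1) w)"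
      using v by (intro prod.remove) auto
    also have "(\<Prod>w\<in>?K - {v}. a w ^ Poly_Mapping.lookup (m - Poly_Mapping.single v 1) w) =
        (\<Prod>w\<in>?K - {v}. a w ^ Poly_Mapping.lookup m w)"
      by (intro prod.cong) (auto simp: lookup_minus lookup_single_not_eq)
    finally show ?thesis by (simp add: lookup_minus)
  qed
  moreover have "fps_deriv (mon_eval a m) =
      (\<Sum>v\<in>?K. fps_deriv (a v ^ Poly_Mapping.lookup m v) * (\<Prod>w\<in>?K - {v}. a w ^ Poly_Mapping.lookup m w))"
    unfolding mon_eval_def by (rule fps_deriv_prod) simp
  ultimately show ?thesis
    by (simp add: fps_deriv_power' mult_ac)
qed

lemma fps_const_hom: "ring_hom_fun (fps_const :: 'a::comm_ring_1 \<Rightarrow> 'a fps)"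
  by (simp add: ring_hom_fun_def)

text \<open>Evaluation at power series is a homomorphism of differential rings, so its kernel is a
  differential ideal.\<close>

lemma mp_eval_dp_deriv:
  fixes a :: "'z \<Rightarrow> 'a::comm_ring_1 fps"
  defines "e \<equiv> (\<lambda>(z, i). (fps_deriv ^^ i) (a z))"
  shows "mp_eval fps_const e (dp_deriv p) = fps_deriv (mp_eval fps_const e p)"
proof -
  have e: "e (fst v, Suc (snd v)) = fps_deriv (e v)" for v
    by (simp add: e_def split: prod.split)
  have "mp_eval fps_const e (dp_deriv p) =
    (\<Sum>m\<in>Poly_Mapping.keys p. \<Sum>v\<in>Poly_Mapping.keys m.
        fps_const (of_nat (Poly_Mapping.lookup m v) * Poly_Mapping.lookup p m) *
        (mon_eval e (m - Poly_Mapping.single v 1) * fps_deriv (e v)))"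
    by (simp add: dp_deriv_def mp_eval_sum[OF fps_const_hom] mp_eval_single mon_eval_add e)
  also have "\<dots> = (\<Sum>m\<in>Poly_Mapping.keys p. fps_const (Poly_Mapping.lookup p m) * fps_deriv (mon_eval e m))"
    unfolding fps_deriv_mon_eval sum_distrib_left
    by (intro sum.cong refl) (simp add: fps_of_nat[symmetric] mult_ac flip: fps_const_mult)
  also have "\<dots> = fps_deriv (mp_eval fps_const e p)"
    by (simp add: mp_eval_def fps_deriv_sum flip: mon_eval_def)
  finally show ?thesis .
qed

text \<open>The exponential generating function: the shift of a sequence becomes the derivative of a
  power series.\<close>

definition egf :: "(nat \<Rightarrow> 'a::field) \<Rightarrow> 'a fps" where
  "egf Z = Abs_fps (\<lambda>s. Z s / of_nat (fact s))"

lemma egf_deriv: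
  fixes Z :: "nat \<Rightarrow> 'a::field"
  assumes char0: "\<forall>n>0. (of_nat n :: 'a) \<noteq> 0"
  shows "(fps_deriv ^^ i) (egf Z) = egf (\<lambda>s. Z (i + s))"
proof (induction i)
  case (Suc i)
  have "fps_deriv (egf W) = egf (\<lambda>s. W (Suc s))" for W :: "nat \<Rightarrow> 'a"
  proof (rule fps_ext)
    fix s
    have nz: "(of_nat (Suc s) :: 'a) \<noteq> 0" using char0 by blast
    have "of_nat (fact (Suc s)) = (of_nat (Suc s) * of_nat (fact s) :: 'a)"
      by (simp only: fact_Suc of_nat_mult of_nat_id)
    then show "fps_nth (fps_deriv (egf W)) s = fps_nth (egf (\<lambda>s. W (Suc s))) s"
      using nz by (simp add: egf_def del: of_nat_Suc fact_Suc)
  qed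
  then show ?case using Suc by simp
qed simp

definition coeff_row :: "('n + 'k, 'a::zero) mpoly \<Rightarrow> ('n, 'k, 'a) row" where
  "coeff_row p o1 = (case o1 of None \<Rightarrow> Poly_Mapping.lookup p 0 | Some v \<Rightarrow> lin_coeff p v)"

lemma mp_eval_coeff_row:
  fixes p :: "('n::finite + 'k::finite, 'a::zero) mpoly"
  assumes "total_degree p \<le> 1" "c 0 = 0"
  shows "mp_eval c (case_sum x u) p = c (coeff_row p None) +
    ((\<Sum>n\<in>UNIV. c (coeff_row p (Some (Inl n))) * x n) + (\<Sum>k\<in>UNIV. c (coeff_row p (Some (Inr k))) * u k))"
  using mp_eval_degree_le_1[where p = p and c = c and V = UNIV and a = "case_sum x u", OF assms]
  by (simp add: coeff_row_def sum_UNIV_sum)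

lemma I_Sigma_diff_ideal:
  assumes "is_diff_ideal J"
    "\<And>i. mp_var (State i, 1) - to_dpoly (f i) \<in> J" "\<And>j. mp_var (Output j, 0) - to_dpoly (g j) \<in> J"
  shows "I_Sigma f g \<subseteq> J"
  using assms unfolding I_Sigma_def diff_ideal_generated_def by blast

text \<open>The generators vanish at a formal solution, so the kernel of evaluation there contains
  the differential ideal they generate.\<close>

lemma I_Sigma_evaluates_to_zero:
  fixes f :: "'n::finite \<Rightarrow> ('n, 'k::finite, 'l::linorder) syspoly" and g :: "'m \<Rightarrow> ('n, 'k, 'l) syspoly"
  assumes deg: "\<And>i. total_degree (f i) \<le> 1" "\<And>j. total_degree (g j) \<le> 1"
    and sol: "\<And>j. seq_sol (\<lambda>i. coeff_row (f i)) (coeff_row (g j)) X U (Y j)"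
    and q: "q \<in> I_Sigma f g"
  defines "val \<equiv> (\<lambda>z. case z of State n \<Rightarrow> X n | Output j \<Rightarrow> Y j | Input k \<Rightarrow> U k)"
  shows "mp_eval fps_const (\<lambda>(z, i). (fps_deriv ^^ i) (egf (val z))) q = 0"
proof -
  let ?e = "\<lambda>(z, i). (fps_deriv ^^ i) (egf (val z))"
  let ?ev = "mp_eval fps_const ?e"
  note c0 = of_nat_ratfun_nonzero[where 'l = 'l]
  note hom = fps_const_hom[where 'a = "'l ratfun"]
  have val: "val (State n) = X n" "val (Output j) = Y j" "val (Input k) = U k" for n j k
    by (simp_all add: val_def)
  define J where "J = {q. ?ev q = 0}"
  have "is_diff_ideal J"
    unfolding is_diff_ideal_def J_def
    by (auto simp: mp_eval_add[OF hom] mp_eval_mult[OF hom] mp_eval_dp_deriv)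
  moreover have ev_to_dpoly: "?ev (to_dpoly p) = egf (\<lambda>s. row_eval (coeff_row p) (\<lambda>n. X n s) (\<lambda>k. U k s) (0 ^ s))"
    if "total_degree p \<le> 1" for p :: "('n, 'k, 'l) syspoly"
  proof -
    have "?ev (to_dpoly p) = fps_const (coeff_row p None) +
      ((\<Sum>n\<in>UNIV. fps_const (coeff_row p (Some (Inl n))) * egf (X n)) +
       (\<Sum>k\<in>UNIV. fps_const (coeff_row p (Some (Inr k))) * egf (U k)))"
      unfolding to_dpoly_def
      by (subst mp_eval_coeff_row[OF that])
         (simp_all add: ring_hom_funD(1)[OF mp_const_hom] mp_eval_add[OF hom] mp_eval_sum[OF hom]
           mp_eval_mult[OF hom] mp_eval_const mp_eval_var[OF hom] val)
    also have "\<dots> = egf (\<lambda>s. row_eval (coeff_row p) (\<lambda>n. X n s) (\<lambda>k. U k s) (0 ^ s))"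
      by (rule fps_ext) (simp add: egf_def row_eval_def fps_sum_nth add_divide_distrib sum_divide_distrib power_0_left)
    finally show ?thesis .
  qed
  moreover have "mp_var (State i, 1) - to_dpoly (f i) \<in> J" for i
    using sol by (simp add: J_def mp_eval_diff[OF hom] mp_eval_var[OF hom] ev_to_dpoly[OF deg(1)] val
        seq_sol_def egf_deriv[OF c0, of 1, simplified])
  moreover have "mp_var (Output j, 0) - to_dpoly (g j) \<in> J" for j
  proof -
    have "Y j = (\<lambda>s. row_eval (coeff_row (g j)) (\<lambda>n. X n s) (\<lambda>k. U k s) (0 ^ s))"
      using sol[of j] by (auto simp: seq_sol_def)
    then show ?thesis
      by (simp add: J_def mp_eval_diff[OF hom] mp_eval_var[OF hom] ev_to_dpoly[OF deg(2)] val)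
  qed
  ultimately show ?thesis using I_Sigma_diff_ideal[of J f g] q unfolding J_def by blast
qed

text \<open>The coefficient of degree 0 of that evaluation: the series of a derivative of order
  \<open>i\<close> starts with entry \<open>i\<close> of the sequence.\<close>

lemma I_Sigma_linear:
  fixes f :: "'n::finite \<Rightarrow> ('n, 'k::finite, 'l::linorder) syspoly" and g :: "'m \<Rightarrow> ('n, 'k, 'l) syspoly"
  assumes deg: "\<And>i. total_degree (f i) \<le> 1" "\<And>j. total_degree (g j) \<le> 1"
    and sol: "\<And>j. seq_sol (\<lambda>i. coeff_row (f i)) (coeff_row (g j)) X U (Y j)"
    and q: "q \<in> I_Sigma f g" "total_degree q \<le> 1"
  shows "Poly_Mapping.lookup q 0 + (\<Sum>(z, i)\<in>mp_vars q. lin_coeff q (z, i) *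
     (case z of State n \<Rightarrow> X n | Output j \<Rightarrow> Y j | Input k \<Rightarrow> U k) i) = 0"
proof -
  let ?val = "\<lambda>z. case z of State n \<Rightarrow> X n | Output j \<Rightarrow> Y j | Input k \<Rightarrow> U k"
  have nth: "fps_nth ((fps_deriv ^^ i) (egf Z)) 0 = Z i" for i and Z :: "nat \<Rightarrow> 'l ratfun"
    by (simp add: egf_deriv[OF of_nat_ratfun_nonzero]) (simp add: egf_def)
  have "fps_nth (mp_eval fps_const (\<lambda>(z, i). (fps_deriv ^^ i) (egf (?val z))) q) 0 = 0"
    using I_Sigma_evaluates_to_zero[OF deg sol q(1)] by simp
  then show ?thesis
    by (subst (asm) mp_eval_degree_le_1[OF q(2) _ finite_mp_vars subset_refl])
       (simp_all add: fps_sum_nth case_prod_beta nth)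
qed

text \<open>Turns the linear coefficients at \<open>z\<close> into an operator, so that order and
  leading coefficient in \<open>z\<close> become those of a univariate polynomial.\<close>

definition part :: "'z \<Rightarrow> ('z, 'a::comm_ring_1) dpoly \<Rightarrow> 'a poly" where
  "part z q = (\<Sum>i\<in>{i. (z, i) \<in> mp_vars q}. monom (lin_coeff q (z, i)) i)"

lemma finite_orders [simp]: "finite {i. (z, i) \<in> mp_vars q}"
  by (rule finite_subset[OF _ finite_imageI[OF finite_mp_vars, of snd]]) (auto intro: rev_image_eqI)

lemma coeff_part: "coeff (part z q) i = lin_coeff q (z, i)"
proof -
  have "coeff (part z q) i = (\<Sum>j\<in>{i. (z, i) \<in> mp_vars q}. if j = i then lin_coeff q (z, i) else 0)"
    unfolding part_def coeff_sum by (intro sum.cong) (auto simp: coeff_monom)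
  also have "\<dots> = lin_coeff q (z, i)" using lin_coeff_nonzero_vars[of q "(z, i)"] by auto
  finally show ?thesis .
qed

lemma act_part: "act (part z q) Z 0 = (\<Sum>i\<in>{i. (z, i) \<in> mp_vars q}. lin_coeff q (z, i) * Z i)"
  unfolding part_def act_sum act_monom by simp

lemma dp_ord_eq:
  assumes "total_degree q \<le> 1"
  shows "dp_ord z q = (if part z q = 0 then Minf else Fin (degree (part z q)))"
proof -
  have v: "(z, i) \<in> mp_vars q \<longleftrightarrow> coeff (part z q) i \<noteq> 0" for i
    unfolding total_degree_le_1_vars[OF assms] by (simp add: coeff_part)
  have "Max {i. (z, i) \<in> mp_vars q} = degree (part z q)" if "part z q \<noteq> 0"
    using that by (intro Max_eqI) (simp, auto simp: v intro: le_degree)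
  then show ?thesis by (auto simp: dp_ord_def v poly_eq_iff)
qed

lemma monic_in_iff:
  assumes "total_degree q \<le> 1"
  shows "monic_in z q \<longleftrightarrow> lead_coeff (part z q) = 1"
proof (cases "part z q = 0")
  case True
  then show ?thesis by (simp add: monic_in_def dp_ord_eq[OF assms])
next
  case False
  then show ?thesis by (simp add: monic_in_def dp_ord_eq[OF assms] coeff_part)
qed

text \<open>Formal solutions over the rational functions have arbitrary initial values and inputs;
  unit choices of these isolate each coefficient of \<open>q\<close>.\<close>

lemma io_relation:
  fixes f :: "'n::finite \<Rightarrow> ('n, 'k::finite, 'l::linorder) syspoly" and g :: "'m \<Rightarrow> ('n, 'k, 'l) syspoly"
  assumes deg: "\<And>i. total_degree (f i) \<le> 1" "\<And>j. total_degree (g j) \<le> 1"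
    and m: "UNIV = {j0 :: 'm}"
    and q: "q \<in> I_Sigma f g" "total_degree q \<le> 1" "mp_vars q \<subseteq> ({Output j0} \<union> range Input) \<times> UNIV"
  defines "F \<equiv> \<lambda>i. coeff_row (f i)" and "G \<equiv> coeff_row (g j0)" and "P \<equiv> part (Output j0) q"
  shows "comb (nu F G) P (Some (Inl n)) = 0" "part (Input k) q = - input_comb F G P k"
    "Poly_Mapping.lookup q 0 = - comb (nu F G) P None"
proof -
  have main: "Poly_Mapping.lookup q 0 + ((\<Sum>n\<in>UNIV. comb (nu F G) P (Some (Inl n)) * x n) + comb (nu F G) P None +
    (\<Sum>k\<in>UNIV. act (input_comb F G P k + part (Input k) q) (U k) 0)) = 0" for x and U :: "'k \<Rightarrow> nat \<Rightarrow> 'l ratfun"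
  proof -
    define Z where "Z = rec_nat x (\<lambda>s z n. row_eval (F n) z (\<lambda>k. U k s) (0 ^ s))"
    define X where "X n s = Z s n" for n s
    define Y where "Y j s = row_eval (coeff_row (g j)) (\<lambda>n. X n s) (\<lambda>k. U k s) (0 ^ s)" for j s
    have sol: "seq_sol F (coeff_row (g j)) X U (Y j)" for j
      by (simp add: seq_sol_def X_def Y_def Z_def)
    let ?val = "\<lambda>z. case z of State n \<Rightarrow> X n | Output j \<Rightarrow> Y j | Input k \<Rightarrow> U k"
    have lin: "Poly_Mapping.lookup q 0 + (\<Sum>(z, i)\<in>mp_vars q. lin_coeff q (z, i) * ?val z i) = 0"
      using I_Sigma_linear[OF deg sol[unfolded F_def] q(1,2)] .
    have "(\<Sum>(z, i)\<in>mp_vars q. lin_coeff q (z, i) * ?val z i) =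
        (\<Sum>(z, i)\<in>Sigma ({Output j0} \<union> range Input) (\<lambda>z. {i. (z, i) \<in> mp_vars q}). lin_coeff q (z, i) * ?val z i)"
      using q(3) by (intro sum.cong) auto
    also have "\<dots> = (\<Sum>z\<in>{Output j0} \<union> range Input. act (part z q) (?val z) 0)"
      unfolding act_part by (rule sum.Sigma[symmetric]) auto
    also have "\<dots> = act P (Y j0) 0 + (\<Sum>z\<in>range Input. act (part z q) (?val z) 0)"
      by (subst sum.union_disjoint) (auto simp: P_def)
    also have "(\<Sum>z\<in>range Input. act (part z q) (?val z) 0) = (\<Sum>k\<in>UNIV. act (part (Input k) q) (U k) 0)"
      by (subst sum.reindex) (auto simp: inj_on_def)
    also have "act P (Y j0) 0 = (\<Sum>n\<in>UNIV. comb (nu F G) P (Some (Inl n)) * x n) + comb (nu F G) P None +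
        (\<Sum>k\<in>UNIV. act (input_comb F G P k) (U k) 0)"
      using act_output[OF sol[of j0], of P 0] by (simp add: G_def X_def Z_def)
    finally show ?thesis using lin by (simp add: act_add sum.distrib add.assoc)
  qed
  show const: "Poly_Mapping.lookup q 0 = - comb (nu F G) P None"
    using main[of "\<lambda>_. 0" "\<lambda>_ _. 0"] by (simp add: act_def eq_neg_iff_add_eq_0)
  show "comb (nu F G) P (Some (Inl n)) = 0"
  proof -
    have "(\<Sum>m\<in>UNIV. comb (nu F G) P (Some (Inl m)) * (if m = n then 1 else 0)) = comb (nu F G) P (Some (Inl n))"
      by (simp add: if_distrib[of "\<lambda>z. _ * z"] cong: if_cong)
    then show ?thesis using main[of "\<lambda>m. if m = n then 1 else 0" "\<lambda>_ _. 0"] const by (simp add: act_def)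
  qed
  have "input_comb F G P k + part (Input k) q = 0"
  proof (rule poly_eqI)
    fix i
    \<comment> \<open>An input whose only nonzero derivative is the one of order \<open>i\<close> in
      the component \<open>k\<close>.\<close>
    let ?U = "\<lambda>(k'::'k) (i'::nat). if k' = k \<and> i' = i then 1 else (0 :: 'l ratfun)"
    have act1: "act p (?U k') 0 = (if k' = k then coeff p i else 0)" for p k'
    proof -
      have "act p (?U k') 0 = (\<Sum>j\<le>max i (degree p). coeff p j * ?U k' j)"
        using act_bound[of p "max i (degree p)" "?U k'" 0] by simp
      also have "\<dots> = (\<Sum>j\<le>max i (degree p). if j = i then (if k' = k then coeff p i else 0) else 0)"
        by (intro sum.cong) auto
      finally show ?thesis by simp
    qed
    show "coeff (input_comb F G P k + part (Input k) q) i = coeff 0 i"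
      using main[of "\<lambda>_. 0" ?U] const unfolding act1 by simp
  qed
  then show "part (Input k) q = - input_comb F G P k" by (simp add: eq_neg_iff_add_eq_0 add.commute)
qed

section \<open>Input-output equations\<close>

lemma dp_deriv_superset:
  assumes "finite S" "Poly_Mapping.keys p \<subseteq> S"
  shows "dp_deriv p = (\<Sum>m\<in>S. \<Sum>v\<in>Poly_Mapping.keys m.
        Poly_Mapping.single
          (m - Poly_Mapping.single v 1 + Poly_Mapping.single (fst v, Suc (snd v)) 1)
          (of_nat (Poly_Mapping.lookup m v) * Poly_Mapping.lookup p m))"
  unfolding dp_deriv_def
  by (rule sum.mono_neutral_left[OF assms]) (auto simp: in_keys_iff)

lemma dp_deriv_add: "dp_deriv (p + q) = dp_deriv p + dp_deriv q"
proof -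
  let ?S = "Poly_Mapping.keys p \<union> Poly_Mapping.keys q"
  have "Poly_Mapping.keys (p + q) \<subseteq> ?S" by (rule keys_add)
  then show ?thesis
    by (subst (1 2 3) dp_deriv_superset[of ?S])
       (auto simp: lookup_add distrib_left single_add sum.distrib)
qed

lemma dp_deriv_0 [simp]: "dp_deriv 0 = 0"
  by (simp add: dp_deriv_def)

lemma dp_deriv_sum: "dp_deriv (\<Sum>i\<in>I. p i) = (\<Sum>i\<in>I. dp_deriv (p i))"
  by (induction I rule: infinite_finite_induct) (auto simp: dp_deriv_add)

lemma dp_deriv_diff: "dp_deriv (p - q) = dp_deriv p - dp_deriv q"
  using dp_deriv_add[of "p - q" q] by (simp add: algebra_simps)

lemma dp_deriv_const: "dp_deriv (mp_const c) = 0"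
  by (simp add: dp_deriv_def mp_const_def)

abbreviation lterm :: "'v \<Rightarrow> 'a::comm_ring_1 \<Rightarrow> ('v, 'a) mpoly" where
  "lterm v c \<equiv> Poly_Mapping.single (Poly_Mapping.single v 1) c"

lemma const_times_lterm: "mp_const c * lterm v d = lterm v (c * d)"
  by (simp add: mp_const_def mult_single)

lemma const_times_var: "mp_const c * mp_var v = lterm v c"
  using const_times_lterm[of c v 1] by (simp add: mp_var_def)

lemma lterm_sum: "lterm v (\<Sum>i\<in>I. c i) = (\<Sum>i\<in>I. lterm v (c i))"
  by (induction I rule: infinite_finite_induct) (auto simp: single_add)

lemma single_one_eq_iff: "Poly_Mapping.single v (1::nat) = Poly_Mapping.single w 1 \<longleftrightarrow> v = w"
proof
  assume "Poly_Mapping.single v (1::nat) = Poly_Mapping.single w 1"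
  then have "Poly_Mapping.keys (Poly_Mapping.single v (1::nat)) = Poly_Mapping.keys (Poly_Mapping.single w (1::nat))"
    by (rule arg_cong)
  then show "v = w" by simp
qed simp

lemma single_one_neq_0: "Poly_Mapping.single v (1::nat) \<noteq> 0"
  using keys_eq_empty[of "Poly_Mapping.single v (1::nat)"] by (simp del: keys_eq_empty)

lemma lin_coeff_lterm: "lin_coeff (lterm v c) w = (if v = w then c else 0)"
  unfolding lookup_single single_one_eq_iff by (simp add: when_def)

lemma lookup_0_lterm: "Poly_Mapping.lookup (lterm v c) 0 = 0"
  unfolding lookup_single using single_one_neq_0[of v] by (simp add: when_def)

lemma dp_deriv_lterm: "dp_deriv (lterm (z, i) c) = lterm (z, Suc i) c"
proof -
  have "dp_deriv (lterm (z, i) c) = (\<Sum>m\<in>{Poly_Mapping.single (z, i) 1}. \<Sum>v\<in>Poly_Mapping.keys m.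
        Poly_Mapping.single
          (m - Poly_Mapping.single v 1 + Poly_Mapping.single (fst v, Suc (snd v)) 1)
          (of_nat (Poly_Mapping.lookup m v) * Poly_Mapping.lookup (lterm (z, i) c) m))"
    by (rule dp_deriv_superset) auto
  then show ?thesis by simp
qed

definition dact :: "'a::comm_ring_1 poly \<Rightarrow> 'z \<Rightarrow> ('z, 'a) dpoly" where
  "dact P z = (\<Sum>i\<le>degree P. lterm (z, i) (coeff P i))"

lemma dact_bound: "degree P \<le> N \<Longrightarrow> dact P z = (\<Sum>i\<le>N. lterm (z, i) (coeff P i))"
  unfolding dact_def by (rule sum.mono_neutral_left) (auto simp: coeff_eq_0)

lemma dact_0 [simp]: "dact 0 z = 0"
  by (simp add: dact_def)

lemma dact_add: "dact (P + Q) z = dact P z + dact Q z"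
proof -
  let ?N = "max (degree P) (degree Q)"
  have "degree (P + Q) \<le> ?N" by (rule degree_add_le_max)
  then show ?thesis by (simp add: dact_bound[of _ ?N] single_add sum.distrib)
qed

lemma dact_smult: "dact (smult c P) z = mp_const c * dact P z"
  using dact_bound[OF degree_smult_le[of c P], of z]
  by (simp add: dact_def sum_distrib_left const_times_lterm[unfolded One_nat_def])

lemma dact_sum: "dact (\<Sum>i\<in>I. P i) z = (\<Sum>i\<in>I. dact (P i) z)"
  by (induction I rule: infinite_finite_induct) (auto simp: dact_add)

lemma dact_pCons: "dact (pCons a P) z = lterm (z, 0) a + dp_deriv (dact P z)"
proof -
  have "dact (pCons a P) z = (\<Sum>i\<le>Suc (degree P). lterm (z, i) (coeff (pCons a P) i))"
    by (rule dact_bound) (simp add: degree_pCons_le)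
  also have "\<dots> = lterm (z, 0) a + (\<Sum>i\<le>degree P. lterm (z, Suc i) (coeff P i))"
    by (subst sum.atMost_Suc_shift) simp
  also have "(\<Sum>i\<le>degree P. lterm (z, Suc i) (coeff P i)) = dp_deriv (dact P z)"
    unfolding dact_def dp_deriv_sum dp_deriv_lterm ..
  finally show ?thesis .
qed

lemma lin_coeff_dact: "lin_coeff (dact P z) (z', i) = (if z' = z then coeff P i else 0)"
proof -
  have "lin_coeff (dact P z) (z', i) = (\<Sum>j\<le>max i (degree P). if j = i then (if z' = z then coeff P i else 0) else 0)"
    unfolding dact_bound[OF max.cobounded2[of "degree P" i]] lookup_sum lin_coeff_lterm
    by (intro sum.cong) auto
  then show ?thesis by simp
qed

lemma lookup_0_dact: "Poly_Mapping.lookup (dact P z) 0 = 0"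
  unfolding dact_def lookup_sum lookup_0_lterm by simp

lemma lookup_dact_nonlinear:
  "(\<And>v. m \<noteq> Poly_Mapping.single v 1) \<Longrightarrow> Poly_Mapping.lookup (dact P z) m = 0"
  unfolding dact_def lookup_sum lookup_single by (intro sum.neutral) (auto simp: when_def)

text \<open>In its uses, the input entries of \<open>w\<close> are the constant coefficients of
  \<open>Q\<close>, so they are not added a second time.\<close>

definition row_dpoly :: "('n::finite, 'k::finite, 'a::comm_ring_1) row \<Rightarrow> ('k \<Rightarrow> 'a poly) \<Rightarrow> (('n, 'm, 'k) indet, 'a) dpoly" where
  "row_dpoly w Q = (\<Sum>n\<in>UNIV. lterm (State n, 0) (w (Some (Inl n)))) + (\<Sum>k\<in>UNIV. dact (Q k) (Input k)) + mp_const (w None)"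

lemma mp_const_sum: "mp_const (\<Sum>i\<in>I. c i) = (\<Sum>i\<in>I. mp_const (c i :: 'a::comm_ring_1))"
  by (rule ring_hom_fun_sum[OF mp_const_hom])

lemma row_dpoly_sum:
  "row_dpoly (\<lambda>o1. \<Sum>i\<in>I. c i * w i o1) (\<lambda>k. \<Sum>i\<in>I. smult (c i) (Q i k)) = (\<Sum>i\<in>I. mp_const (c i) * row_dpoly (w i) (Q i))"
  unfolding row_dpoly_def lterm_sum dact_sum dact_smult mp_const_sum distrib_left sum_distrib_left
    sum.distrib const_times_lterm sum.swap[of _ UNIV I]
  by (simp add: ring_hom_funD(4)[OF mp_const_hom])

lemma to_dpoly_eq_row_dpoly:
  fixes p :: "('n::finite, 'k::finite, 'l::linorder) syspoly"
  assumes "total_degree p \<le> 1"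
  shows "to_dpoly p = row_dpoly (coeff_row p) (\<lambda>k. [:coeff_row p (Some (Inr k)):])"
  unfolding to_dpoly_def
  by (subst mp_eval_coeff_row[OF assms])
     (simp_all add: ring_hom_funD(1)[OF mp_const_hom] row_dpoly_def dact_pCons const_times_var add.commute add.left_commute)

lemma is_diff_idealD:
  assumes "is_diff_ideal J"
  shows "0 \<in> J" "p \<in> J \<Longrightarrow> q \<in> J \<Longrightarrow> p + q \<in> J" "p \<in> J \<Longrightarrow> r * p \<in> J" "p \<in> J \<Longrightarrow> dp_deriv p \<in> J"
  using assms by (auto simp: is_diff_ideal_def)

lemma is_diff_ideal_sum: "is_diff_ideal J \<Longrightarrow> (\<And>i. i \<in> I \<Longrightarrow> p i \<in> J) \<Longrightarrow> sum p I \<in> J"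
  by (induction I rule: infinite_finite_induct) (auto simp: is_diff_idealD)

text \<open>Differentiation produces first derivatives of the states; multiples of the generators
  for \<open>x'\<close> replace them by the rows of \<open>F\<close>, which is one application of
  \<open>row_step\<close>.\<close>

lemma output_derivative_in_ideal:
  fixes f :: "'n::finite \<Rightarrow> ('n, 'k::finite, 'l::linorder) syspoly" and g :: "'m \<Rightarrow> ('n, 'k, 'l) syspoly"
  assumes deg: "\<And>i. total_degree (f i) \<le> 1" "\<And>j. total_degree (g j) \<le> 1"
    and J: "is_diff_ideal J" "\<And>i. mp_var (State i, 1) - to_dpoly (f i) \<in> J" "mp_var (Output j, 0) - to_dpoly (g j) \<in> J"
  defines "F \<equiv> \<lambda>i. coeff_row (f i)" and "G \<equiv> coeff_row (g j)"
  shows "lterm (Output j, i) 1 - row_dpoly (nu F G i) (input_poly F G i) \<in> J"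
proof (induction i)
  case 0
  have "input_poly F G 0 = (\<lambda>k. [:G (Some (Inr k)):])" by (rule ext) (rule input_poly_0)
  then show ?case using J(3) by (simp add: to_dpoly_eq_row_dpoly[OF deg(2)] G_def mp_var_def)
next
  case (Suc i)
  let ?w = "nu F G i" and ?w' = "nu F G (Suc i)" and ?Q = "input_poly F G i"
  let ?D = "lterm (Output j, i) 1 - row_dpoly ?w ?Q"
  have d: "dp_deriv ?D = lterm (Output j, Suc i) 1 -
      ((\<Sum>n\<in>UNIV. lterm (State n, 1) (?w (Some (Inl n)))) + (\<Sum>k\<in>UNIV. dp_deriv (dact (?Q k) (Input k))))"
    unfolding row_dpoly_def dp_deriv_diff dp_deriv_add dp_deriv_sum dp_deriv_lterm dp_deriv_const by simp
  have s: "(\<Sum>n\<in>UNIV. mp_const (?w (Some (Inl n))) * (mp_var (State n, 1) - (to_dpoly (f n) :: ('n, 'm, 'k, 'l) iopoly))) =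
      (\<Sum>n\<in>UNIV. lterm (State n, 1) (?w (Some (Inl n)))) - row_dpoly ?w' (\<lambda>k. [:?w' (Some (Inr k)):])"
  proof -
    have "(\<Sum>n\<in>UNIV. mp_const (?w (Some (Inl n))) * (to_dpoly (f n) :: ('n, 'm, 'k, 'l) iopoly)) =
        row_dpoly (\<lambda>o1. \<Sum>n\<in>UNIV. ?w (Some (Inl n)) * F n o1) (\<lambda>k. \<Sum>n\<in>UNIV. smult (?w (Some (Inl n))) [:F n (Some (Inr k)):])"
      unfolding row_dpoly_sum by (simp add: to_dpoly_eq_row_dpoly[OF deg(1)] F_def)
    also have "(\<lambda>o1. \<Sum>n\<in>UNIV. ?w (Some (Inl n)) * F n o1) = ?w'"
      by (simp add: nu_Suc row_step_def)
    also have "(\<lambda>k. \<Sum>n\<in>UNIV. smult (?w (Some (Inl n))) [:F n (Some (Inr k)):]) = (\<lambda>k. [:?w' (Some (Inr k)):])"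
      by (rule ext, rule poly_eqI) (simp add: coeff_sum nu_Suc row_step_def coeff_pCons split: nat.split)
    finally show ?thesis
      by (simp only: right_diff_distrib sum_subtractf const_times_var)
  qed
  have "(row_dpoly ?w' (input_poly F G (Suc i)) :: ('n, 'm, 'k, 'l) iopoly) =
      row_dpoly ?w' (\<lambda>k. [:?w' (Some (Inr k)):]) + (\<Sum>k\<in>UNIV. dp_deriv (dact (?Q k) (Input k)))"
    by (simp add: row_dpoly_def input_poly_Suc dact_pCons sum.distrib)
  then have "lterm (Output j, Suc i) 1 - row_dpoly ?w' (input_poly F G (Suc i)) =
      dp_deriv ?D + (\<Sum>n\<in>UNIV. mp_const (?w (Some (Inl n))) * (mp_var (State n, 1) - to_dpoly (f n)))"
    unfolding d s by simp
  also have "\<dots> \<in> J"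
    using Suc.IH J(2) by (intro is_diff_idealD[OF J(1)] is_diff_ideal_sum[OF J(1)])
  finally show ?case .
qed

text \<open>If the state entries of \<open>comb (nu F G) P\<close> vanish, this is the linear
  element of the ideal with output part \<open>P\<close>; \<open>io_relation\<close> shows that its
  other coefficients are forced.\<close>

definition io_poly :: "('n::finite \<Rightarrow> ('n, 'k::finite, 'a::field) row) \<Rightarrow> ('n, 'k, 'a) row \<Rightarrow> 'm \<Rightarrow> 'a poly \<Rightarrow> (('n, 'm, 'k) indet, 'a) dpoly" where
  "io_poly F G j P = dact P (Output j) - (\<Sum>k\<in>UNIV. dact (input_comb F G P k) (Input k)) - mp_const (comb (nu F G) P None)"

lemma io_poly_in_I_Sigma:
  fixes f :: "'n::finite \<Rightarrow> ('n, 'k::finite, 'l::linorder) syspoly" and g :: "'m \<Rightarrow> ('n, 'k, 'l) syspoly"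
    and j :: 'm
  assumes deg: "\<And>i. total_degree (f i) \<le> 1" "\<And>j. total_degree (g j) \<le> 1"
  defines "F \<equiv> \<lambda>i. coeff_row (f i)" and "G \<equiv> coeff_row (g j)"
  assumes P: "\<And>n. comb (nu F G) P (Some (Inl n)) = 0"
  shows "io_poly F G j P \<in> I_Sigma f g"
  unfolding I_Sigma_def diff_ideal_generated_def
proof (rule InterI, elim CollectE conjE)
  fix J assume J: "is_diff_ideal J" and sub: "range (\<lambda>i. mp_var (State i, 1) - to_dpoly (f i)) \<union>
    range (\<lambda>j. mp_var (Output j, 0) - to_dpoly (g j)) \<subseteq> J"
  have "(\<Sum>i\<le>degree P. mp_const (coeff P i) * (lterm (Output j, i) 1 - row_dpoly (nu F G i) (input_poly F G i))) \<in> J"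
    unfolding F_def G_def using sub
    by (intro is_diff_ideal_sum[OF J] is_diff_idealD(3)[OF J] output_derivative_in_ideal[OF deg J]) auto
  also have "(\<Sum>i\<le>degree P. mp_const (coeff P i) * (lterm (Output j, i) 1 - row_dpoly (nu F G i) (input_poly F G i))) =
      dact P (Output j) - row_dpoly (comb (nu F G) P) (input_comb F G P)"
    unfolding right_diff_distrib sum_subtractf const_times_lterm row_dpoly_sum[symmetric]
    by (simp add: dact_def comb_def[abs_def] input_comb_def[abs_def])
  also have "\<dots> = io_poly F G j P"
    by (simp add: row_dpoly_def P io_poly_def)
  finally show "io_poly F G j P \<in> J" .
qed

lemma io_poly_coeffs:
  fixes j :: "'m"
  shows "part (Output j) (io_poly F G j P) = P" "part (Input k) (io_poly F G j P) = - input_comb F G P k"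
    "Poly_Mapping.lookup (io_poly F G j P) 0 = - comb (nu F G) P None"
    "lin_coeff (io_poly F G j P) (State n, i) = 0" "j' \<noteq> j \<Longrightarrow> lin_coeff (io_poly F G j P) (Output j', i) = 0"
    "total_degree (io_poly F G j P) \<le> 1"
proof -
  have const: "lin_coeff (mp_const c) v = 0" for c v
    unfolding mp_const_def lookup_single using single_one_neq_0[of v] by (auto simp: when_def)
  note simps = io_poly_def lookup_minus lookup_sum lin_coeff_dact const
  show "part (Output j) (io_poly F G j P) = P"
    by (rule poly_eqI) (unfold coeff_part simps, simp)
  show "part (Input k) (io_poly F G j P) = - input_comb F G P k"
    by (rule poly_eqI) (unfold coeff_part simps, simp)
  show "Poly_Mapping.lookup (io_poly F G j P) 0 = - comb (nu F G) P None"
    by (simp add: io_poly_def lookup_minus lookup_sum lookup_0_dact) (simp add: mp_const_def)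
  show "lin_coeff (io_poly F G j P) (State n, i) = 0" 
    unfolding simps by simp
  show "lin_coeff (io_poly F G j P) (Output j', i) = 0" if "j' \<noteq> j"
    using that unfolding simps by simp
  show "total_degree (io_poly F G j P) \<le> 1"
  proof (rule total_degree_le_1I, rule ccontr)
    fix m assume m: "m \<in> Poly_Mapping.keys (io_poly F G j P)" "\<not> (m = 0 \<or> (\<exists>v. m = Poly_Mapping.single v 1))"
    then have "m \<noteq> Poly_Mapping.single v 1" for v by blast
    then have "Poly_Mapping.lookup (io_poly F G j P) m = 0"
      using m(2) by (simp add: io_poly_def lookup_minus lookup_sum lookup_dact_nonlinear) (simp add: mp_const_def lookup_single when_def)
    then show False using m by (simp add: in_keys_iff)
  qed
qed

text \<open>The input-output equation of minimal order is determined by its coefficients at the output, which form \<open>P\<close>.\<close>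

definition min_relation :: "('n::finite \<Rightarrow> ('n, 'k::finite, 'a::field) row) \<Rightarrow> ('n, 'k, 'a) row \<Rightarrow> 'a poly \<Rightarrow> bool" where
  "min_relation F G P \<longleftrightarrow> lead_coeff P = 1 \<and> (\<forall>n. comb (nu F G) P (Some (Inl n)) = 0) \<and>
     (\<forall>Q. lead_coeff Q = 1 \<and> (\<forall>n. comb (nu F G) Q (Some (Inl n)) = 0) \<longrightarrow> degree P \<le> degree Q)"

text \<open>Up to signs and zeros, the coefficients of the input-output equation with output part
  \<open>P\<close>.\<close>

definition relation_coeffs :: "('n::finite \<Rightarrow> ('n, 'k::finite, 'a::field) row) \<Rightarrow> ('n, 'k, 'a) row \<Rightarrow> 'a poly \<Rightarrow> 'a set" where
  "relation_coeffs F G P = range (coeff P) \<union> (\<Union>k. range (coeff (input_comb F G P k))) \<union> {comb (nu F G) P None}"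

lemma min_relation_exists:
  fixes F :: "'n::finite \<Rightarrow> ('n, 'k::finite, 'a::field) row"
  shows "\<exists>P. min_relation F G P"
proof -
  obtain M where "lead_coeff M = 1" "comb (nu F G) M = (\<lambda>_. 0)" using annihilating_poly by blast
  then have M: "lead_coeff M = 1 \<and> (\<forall>n. comb (nu F G) M (Some (Inl n)) = 0)" by simp
  from ex_has_least_nat[of "\<lambda>P. lead_coeff P = 1 \<and> (\<forall>n. comb (nu F G) P (Some (Inl n)) = 0)", OF M, of degree]
  show ?thesis unfolding min_relation_def by blast
qed

lemma field_generated_cong:
  assumes "\<And>F. is_subfield F \<Longrightarrow> A \<subseteq> F \<longleftrightarrow> B \<subseteq> F"
  shows "field_generated A = field_generated B"
  unfolding field_generated_def using assms by (intro arg_cong[of _ _ Inter] Collect_cong) blast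

text \<open>With one output there are no earlier equations. The candidates correspond to the monic
  operators \<open>P\<close> whose row has no state entries, and their order is
  \<open>degree P\<close>.\<close>

theorem IO_identifiable_iff:
  fixes f :: "'n::finite \<Rightarrow> ('n, 'k::finite, 'l::linorder) syspoly" and g :: "'m::finite \<Rightarrow> ('n, 'k, 'l) syspoly"
  assumes deg: "\<And>i. total_degree (f i) \<le> 1" "\<And>j. total_degree (g j) \<le> 1"
    and m: "UNIV = {j0 :: 'm}"
  defines "F \<equiv> \<lambda>i. coeff_row (f i)" and "G \<equiv> coeff_row (g j0)"
  shows "IO_identifiable f g h \<longleftrightarrow>
    (\<exists>P. min_relation F G P \<and> h \<in> field_generated (range rf_const \<union> relation_coeffs F G P))"
proof -
  have j0: "j = j0" for j :: 'm using m by auto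
  have card: "CARD('m) = 1" by (simp add: m)
  define cand where "cand = {q \<in> I_Sigma f g. total_degree q \<le> 1 \<and>
    mp_vars q \<subseteq> ({Output j0} \<union> range Input) \<times> UNIV \<and> monic_in (Output j0) q}"
  have cand: "io_candidates f g \<sigma> p 0 = cand" for \<sigma> p
    unfolding io_candidates_def cand_def by (simp add: j0[of "\<sigma> 0"])
  have full: "full_set_io_equations f g p \<longleftrightarrow> p j0 \<in> cand \<and>
      (\<forall>q\<in>cand. dp_ord (Output j0) (p j0) \<le> dp_ord (Output j0) q)" for p
  proof -
    have "bij_betw (\<lambda>_. j0) {..<CARD('m)} (UNIV :: 'm set)"
      unfolding card m by (simp add: bij_betw_def lessThan_Suc)
    then have ex: "(\<exists>\<sigma>. bij_betw \<sigma> {..<CARD('m)} (UNIV :: 'm set) \<and> R (\<sigma> 0)) \<longleftrightarrow> R j0" for R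
      using j0 by metis
    have "full_set_io_equations f g p \<longleftrightarrow> (\<exists>\<sigma>. bij_betw \<sigma> {..<CARD('m)} (UNIV :: 'm set) \<and>
        (\<lambda>j. p j \<in> cand \<and> (\<forall>q\<in>cand. dp_ord (Output j) (p j) \<le> dp_ord (Output j) q)) (\<sigma> 0))"
      unfolding full_set_io_equations_def card by (simp add: cand)
    then show ?thesis
      using ex[of "\<lambda>j. p j \<in> cand \<and> (\<forall>q\<in>cand. dp_ord (Output j) (p j) \<le> dp_ord (Output j) q)"] by (rule trans)
  qed
  have cand_part: "lead_coeff (part (Output j0) q) = 1 \<and> (\<forall>n. comb (nu F G) (part (Output j0) q) (Some (Inl n)) = 0) \<and>
      dp_ord (Output j0) q = Fin (degree (part (Output j0) q))" if "q \<in> cand" for q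
  proof -
    have q: "q \<in> I_Sigma f g" "total_degree q \<le> 1" "mp_vars q \<subseteq> ({Output j0} \<union> range Input) \<times> UNIV" "monic_in (Output j0) q"
      using that by (auto simp: cand_def)
    have "lead_coeff (part (Output j0) q) = 1" using q(4) monic_in_iff[OF q(2)] by blast
    then show ?thesis using io_relation(1)[OF deg m q(1-3)] dp_ord_eq[OF q(2), of "Output j0"]
      by (auto simp: F_def G_def)
  qed
  have io_cand: "io_poly F G j0 P \<in> cand" 
    if "lead_coeff P = 1" "\<forall>n. comb (nu F G) P (Some (Inl n)) = 0" for P
  proof -
    have "mp_vars (io_poly F G j0 P) \<subseteq> ({Output j0} \<union> range Input) \<times> UNIV"
    proof
      fix v assume "v \<in> mp_vars (io_poly F G j0 P)"
      then have nz: "lin_coeff (io_poly F G j0 P) v \<noteq> 0"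
        by (simp add: total_degree_le_1_vars[OF io_poly_coeffs(6)])
      obtain z i where v: "v = (z, i)" by (cases v)
      show "v \<in> ({Output j0} \<union> range Input) \<times> UNIV"
        using nz io_poly_coeffs(4)[of F G j0 P] unfolding v by (cases z) (auto simp: j0)
    qed
    moreover have "io_poly F G j0 P \<in> I_Sigma f g" unfolding F_def G_def
      by (intro io_poly_in_I_Sigma deg) (use that in \<open>simp add: F_def G_def\<close>)
    ultimately show ?thesis unfolding cand_def
      using that io_poly_coeffs(6)[of F G j0 P]
      by (auto simp: monic_in_iff[OF io_poly_coeffs(6)] io_poly_coeffs(1) F_def G_def)
  qed
  have min: "min_relation F G (part (Output j0) q) \<longleftrightarrow> (\<forall>q'\<in>cand. dp_ord (Output j0) q \<le> dp_ord (Output j0) q')"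
    if q: "q \<in> cand" for q
  proof
    assume "min_relation F G (part (Output j0) q)"
    then show "\<forall>q'\<in>cand. dp_ord (Output j0) q \<le> dp_ord (Output j0) q'"
      using cand_part q by (auto simp: min_relation_def)
  next
    assume le: "\<forall>q'\<in>cand. dp_ord (Output j0) q \<le> dp_ord (Output j0) q'"
    show "min_relation F G (part (Output j0) q)"
      unfolding min_relation_def
    proof (intro conjI allI impI)
      fix Q assume Q: "lead_coeff Q = 1 \<and> (\<forall>n. comb (nu F G) Q (Some (Inl n)) = 0)"
      have "dp_ord (Output j0) q \<le> dp_ord (Output j0) (io_poly F G j0 Q)" using le io_cand Q by blast
      then show "degree (part (Output j0) q) \<le> degree Q"
        using cand_part[OF q] cand_part[OF io_cand, of Q] Q by (simp add: io_poly_coeffs(1))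
    qed (use cand_part[OF q] in auto)
  qed
  \<comment> \<open>The two sets of generators differ only by signs and zeros, which a subfield does
    not notice.\<close>
  have fieldeq: "io_field p = field_generated (range rf_const \<union> relation_coeffs F G (part (Output j0) (p j0)))"
    if q: "p j0 \<in> cand" for p
    unfolding io_field_def
  proof (rule field_generated_cong)
    fix E :: "'l ratfun set" assume E: "is_subfield E"
    let ?q = "p j0" and ?P = "part (Output j0) (p j0)"
    have q: "?q \<in> I_Sigma f g" "total_degree ?q \<le> 1" "mp_vars ?q \<subseteq> ({Output j0} \<union> range Input) \<times> UNIV"
      using that by (auto simp: cand_def)
    note rel = io_relation[OF deg m q, folded F_def G_def]
    have neg: "- x \<in> E \<longleftrightarrow> x \<in> E" for x using is_subfieldD(5)[OF E] by (metis minus_minus)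
    have inp: "lin_coeff ?q (Input k, i) = - coeff (input_comb F G ?P k) i" for k i
      using rel(2)[of k] coeff_part[of "Input k" ?q i] by simp
    have outp: "lin_coeff ?q (Output j0, i) = coeff ?P i" for i
      by (simp add: coeff_part)
    have "range (Poly_Mapping.lookup ?q) \<subseteq> E \<longleftrightarrow> relation_coeffs F G ?P \<subseteq> E"
    proof
      assume sub: "range (Poly_Mapping.lookup ?q) \<subseteq> E"
      have "coeff ?P i \<in> E" for i using sub unfolding outp[symmetric] by blast
      moreover have "coeff (input_comb F G ?P k) i \<in> E" for k i
        using sub neg inp[of k i] by (metis rangeI subsetD)
      moreover have "comb (nu F G) ?P None \<in> E" using sub neg rel(3) by (metis rangeI subsetD)
      ultimately show "relation_coeffs F G ?P \<subseteq> E" by (auto simp: relation_coeffs_def)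
    next
      assume sub: "relation_coeffs F G ?P \<subseteq> E"
      show "range (Poly_Mapping.lookup ?q) \<subseteq> E"
      proof safe
        fix m
        show "Poly_Mapping.lookup ?q m \<in> E"
        proof (cases "m \<in> Poly_Mapping.keys ?q")
          case False
          then show ?thesis using is_subfieldD(1)[OF E] by (simp add: in_keys_iff)
        next
          case True
          from total_degree_le_1_keys[OF q(2) True] consider "m = 0" | v where "m = Poly_Mapping.single v 1" by blast
          then show ?thesis
          proof cases
            case 1
            then show ?thesis using sub rel(3) neg by (auto simp: relation_coeffs_def)
          next
            case (2 v)
            then have "lin_coeff ?q v \<noteq> 0" using True by (simp add: in_keys_iff)
            then have "v \<in> ({Output j0} \<union> range Input) \<times> UNIV" by (intro subsetD[OF q(3)] lin_coeff_nonzero_vars)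
            then consider i where "v = (Output j0, i)" | k i where "v = (Input k, i)" by auto
            then show ?thesis
            proof cases
              case 1
              show ?thesis unfolding 2 1 outp using sub by (auto simp: relation_coeffs_def)
            next
              case (2 k i)
              show ?thesis unfolding \<open>m = _\<close> 2 inp neg using sub unfolding relation_coeffs_def by blast
            qed
          qed
        qed
      qed
    qed
    then show "range rf_const \<union> (\<Union>j. range (Poly_Mapping.lookup (p j))) \<subseteq> E \<longleftrightarrow>
        range rf_const \<union> relation_coeffs F G ?P \<subseteq> E"
      by (simp add: m)
  qed
  show ?thesis
  proof
    assume "IO_identifiable f g h"
    then show "\<exists>P. min_relation F G P \<and> h \<in> field_generated (range rf_const \<union> relation_coeffs F G P)"
      unfolding IO_identifiable_def full using min fieldeq by metis
  next
    assume "\<exists>P. min_relation F G P \<and> h \<in> field_generated (range rf_const \<union> relation_coeffs F G P)"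
    then obtain P where P: "min_relation F G P" "h \<in> field_generated (range rf_const \<union> relation_coeffs F G P)" by blast
    have c: "io_poly F G j0 P \<in> cand" using P(1) by (intro io_cand) (auto simp: min_relation_def)
    show "IO_identifiable f g h"
      unfolding IO_identifiable_def full using c min[OF c] fieldeq[of "\<lambda>_. io_poly F G j0 P"] P
      by (intro exI[of _ "\<lambda>_. io_poly F G j0 P"]) (simp add: io_poly_coeffs(1))
  qed
qed

section \<open>Generic points\<close>

lemma comb_add: "comb V (p + q) o1 = comb V p o1 + comb V q o1"
proof -
  let ?N = "max (degree p) (degree q)"
  have "degree (p + q) \<le> ?N" by (rule degree_add_le_max)
  then show ?thesis by (simp add: comb_bound[of _ ?N] distrib_right sum.distrib)
qed

lemma comb_smult: "comb V (smult a p) o1 = a * comb V p o1"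
  using comb_bound[OF degree_smult_le[of a p], of V o1]
  by (simp add: comb_def sum_distrib_left mult.assoc)

lemma nu_add: "nu F (\<lambda>o1. v o1 + w o1) j o1 = nu F v j o1 + nu F w j o1"
  by (induction j arbitrary: o1) (simp_all add: nu_Suc row_step_def distrib_right sum.distrib)

lemma nu_scale: "nu F (\<lambda>o1. a * w o1) j o1 = a * nu F w j o1"
  by (induction j arbitrary: o1) (simp_all add: nu_Suc row_step_def sum_distrib_left mult.assoc)

lemma avoid_hyperplanes:
  fixes \<alpha> :: "'i \<Rightarrow> 'n::finite \<Rightarrow> complex"
  assumes "finite I"
  shows "\<exists>x. \<forall>i\<in>I. (\<exists>n. \<alpha> i n \<noteq> 0) \<longrightarrow> (\<Sum>n\<in>UNIV. \<alpha> i n * x n) + \<gamma> i \<noteq> 0"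
proof -
  obtain e :: "'n \<Rightarrow> nat" where e: "inj e"
    using finite_imp_inj_to_nat_seg[of "UNIV :: 'n set"] by auto
  \<comment> \<open>Points on a moment curve.\<close>
  define p where "p i = (\<Sum>n\<in>UNIV. monom (\<alpha> i n) (Suc (e n))) + [:\<gamma> i:]" for i
  have "p i \<noteq> 0" if "\<alpha> i n \<noteq> 0" for i n
  proof -
    \<comment> \<open>The exponents start at 1, so the affine term \<open>\<gamma> i\<close> does
      not interfere with these coefficients.\<close>
    have "coeff (p i) (Suc (e n)) = \<alpha> i n"
      unfolding p_def by (simp add: coeff_sum coeff_monom inj_eq[OF e])
    then show ?thesis using that by auto
  qed
  then have "finite (\<Union>i\<in>{i\<in>I. \<exists>n. \<alpha> i n \<noteq> 0}. {t. poly (p i) t = 0})"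
    using assms by (intro finite_UN_I poly_roots_finite) auto
  then obtain t where t: "t \<notin> (\<Union>i\<in>{i\<in>I. \<exists>n. \<alpha> i n \<noteq> 0}. {t. poly (p i) t = 0})"
    using ex_new_if_finite[OF infinite_UNIV_char_0] by blast
  have "poly (p i) t = (\<Sum>n\<in>UNIV. \<alpha> i n * t ^ Suc (e n)) + \<gamma> i" for i
    by (simp add: p_def poly_sum poly_monom)
  then show ?thesis using t by (intro exI[of _ "\<lambda>n. t ^ Suc (e n)"]) auto
qed

text \<open>The operators whose rows vanish along the solution starting at \<open>x\<close> form an
  ideal that contains \<open>p\<close>. If it is larger than the ideal of \<open>p\<close>, it
  contains the cofactor of some linear factor of \<open>p\<close>, because the complex numbers are
  algebraically closed. One affine condition on \<open>x\<close> for each of the finitely many roots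
  of \<open>p\<close> thus suffices.\<close>

lemma generic_initial_exists:
  fixes F :: "'n::finite \<Rightarrow> ('n, 'k::finite, complex) row"
  assumes p: "lead_coeff p = 1" "comb (\<lambda>i. nu F G (Suc i)) p = (\<lambda>_. 0)"
    and indep: "\<And>c. (\<And>o1. (\<Sum>i<degree p. c i * nu F G (Suc i) o1) = 0) \<Longrightarrow> \<forall>i<degree p. c i = 0"
  shows "\<exists>x. generic_initial F G (degree p) x"
proof -
  define V where "V = nu F (nu F G 1)"
  have V: "V i = nu F G (Suc i)" for i by (simp add: V_def nu_nu)
  then have V': "V = (\<lambda>i. nu F G (Suc i))" by (rule ext)
  define W where "W = comb V"
  have Wp: "W p = (\<lambda>_. 0)" using p(2) by (simp add: W_def V')
  have W_nz: "\<exists>o1. W q o1 \<noteq> 0" if "q \<noteq> 0" "degree q < degree p" for q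
  proof (rule ccontr)
    assume "\<not> ?thesis"
    then have "(\<Sum>i<degree p. coeff q i * V i o1) = 0" for o1
      using comb_bound[of q "degree p - 1" V o1] that(2) 
      by (simp add: W_def lessThan_Suc_atMost[symmetric])
    then have "\<forall>i<degree p. coeff q i = 0" by (intro indep) (simp add: V)
    then have "lead_coeff q = 0" using that(2) by blast
    then show False using that(1) by simp
  qed
  define Q where "Q l = p div [:- l, 1:]" for l
  define R where "R = {l. poly p l = 0}"
  have "p \<noteq> 0" using p(1) by auto
  then have "finite R" unfolding R_def by (rule poly_roots_finite)
  then obtain x where x: "\<And>l. l \<in> R \<Longrightarrow> \<exists>n. W (Q l) (Some (Inl n)) \<noteq> 0 \<Longrightarrow>
      (\<Sum>n\<in>UNIV. W (Q l) (Some (Inl n)) * x n) + W (Q l) None \<noteq> 0"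
    using avoid_hyperplanes[of R "\<lambda>l n. W (Q l) (Some (Inl n))" "\<lambda>l. W (Q l) None"] by blast
  define z where "z w \<longleftrightarrow> (\<forall>k. w (Some (Inr k)) = 0) \<and> (\<Sum>n\<in>UNIV. w (Some (Inl n)) * x n) + w None = 0"
    for w :: "('n, 'k, complex) row"
  \<comment> \<open>The set \<open>J\<close> is an ideal of the polynomial ring.\<close>
  define J where "J q \<longleftrightarrow> (\<forall>j. z (nu F (W q) j))" for q
  have J_add: "J (q + q')" if "J q" "J q'" for q q'
  proof -
    have W: "W (q + q') = (\<lambda>o1. W q o1 + W q' o1)" by (rule ext) (simp add: W_def comb_add)
    have "nu F (W (q + q')) j = (\<lambda>o1. nu F (W q) j o1 + nu F (W q') j o1)" for j
      unfolding W by (rule ext) (rule nu_add)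
    moreover have "z (\<lambda>o1. v o1 + w o1)" if "z v" "z w" for v w
      using that unfolding z_def by (simp add: distrib_right sum.distrib add_eq_0_iff)
    ultimately show ?thesis using that by (simp add: J_def)
  qed
  have J_smult: "J (smult a q)" if "J q" for a q
  proof -
    have W: "W (smult a q) = (\<lambda>o1. a * W q o1)" by (rule ext) (simp add: W_def comb_smult)
    have "nu F (W (smult a q)) j = (\<lambda>o1. a * nu F (W q) j o1)" for j
      unfolding W by (rule ext) (rule nu_scale)
    moreover have "z (\<lambda>o1. a * v o1)" if "z v" for v
    proof -
      have "(\<Sum>n\<in>UNIV. a * v (Some (Inl n)) * x n) + a * v None = a * ((\<Sum>n\<in>UNIV. v (Some (Inl n)) * x n) + v None)"
        by (simp add: distrib_left sum_distrib_left mult.assoc)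
      then show ?thesis using that unfolding z_def by simp
    qed
    ultimately show ?thesis using that by (simp add: J_def)
  qed
  have J_shift: "J (pCons 0 q)" if "J q" for q
  proof -
    have "W (monom 1 1 * q) = row_step F (W q)"
      unfolding W_def V_def comb_nu comb_nu_Suc ..
    then have W: "W (pCons 0 q) = nu F (W q) 1" by (simp add: monom_Suc monom_0 nu_Suc)
    show ?thesis unfolding J_def W nu_nu using that by (simp add: J_def)
  qed
  have J_mult: "J (s * q)" if "J q" for s q
  proof (induction s)
    case 0
    then show ?case using J_smult[OF that, of 0] by simp
  next
    case (pCons a s)
    then show ?case using J_add[OF J_smult[OF that, of a] J_shift[of "s * q"]] by simp
  qed
  have Jp: "J p" unfolding J_def Wp nu_zero by (simp add: z_def)
  have JQ: "\<not> J (Q l)" if l: "l \<in> R" for l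
  proof
    assume J: "J (Q l)"
    have "[:- l, 1:] dvd p" using l unfolding R_def by (simp add: poly_eq_0_iff_dvd)
    then have pQ: "p = [:- l, 1:] * Q l" unfolding Q_def by (rule dvd_mult_div_cancel[symmetric])
    then have "Q l \<noteq> 0" using \<open>p \<noteq> 0\<close> by auto
    then have "degree p = 1 + degree (Q l)" by (subst pQ, subst degree_mult_eq) auto
    then obtain o1 where nz: "W (Q l) o1 \<noteq> 0" using W_nz[OF \<open>Q l \<noteq> 0\<close>] by auto
    have zW: "z (W (Q l))" using J unfolding J_def by (metis nu_0)
    show False
    proof (cases "\<exists>n. W (Q l) (Some (Inl n)) \<noteq> 0")
      case True
      then show False using x[OF l] zW unfolding z_def by blast
    next
      case False
      \<comment> \<open>Without state entries the value at \<open>x\<close> is the constant term, so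
        \<open>z\<close> makes every entry of the row vanish.\<close>
      then have "W (Q l) None = 0" using zW unfolding z_def by simp
      then have "W (Q l) o1 = 0" using False zW unfolding z_def
        by (cases o1; cases "the o1") auto
      then show False using nz by simp
    qed
  qed
  have J_small: "q = 0" if q: "J q" "q = 0 \<or> degree q < degree p" for q
  proof (rule ccontr)
    assume "q \<noteq> 0"
    then have q': "q \<noteq> 0 \<and> J q \<and> degree q < degree p" using q by auto
    \<comment> \<open>An element of least degree divides \<open>p\<close>, since the remainder lies
      in \<open>J\<close> again.\<close>
    from ex_has_least_nat[of "\<lambda>q. q \<noteq> 0 \<and> J q \<and> degree q < degree p", OF q', of degree]
    obtain d where d: "d \<noteq> 0" "J d" "degree d < degree p"
      and least: "\<And>q. q \<noteq> 0 \<Longrightarrow> J q \<Longrightarrow> degree q < degree p \<Longrightarrow> degree d \<le> degree q" by (elim exE conjE) blast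
    have "p = (p div d) * d + p mod d" by simp
    have "J (p mod d)"
    proof -
      have "p mod d = p + smult (- 1) ((p div d) * d)" by (simp add: minus_div_mult_eq_mod[symmetric])
      then show ?thesis using J_add[OF Jp J_smult[OF J_mult[OF d(2)]]] by (simp only:)
    qed
    moreover have "p mod d = 0 \<or> degree (p mod d) < degree d" using d(1) by (rule degree_mod_less)
    ultimately have "p mod d = 0" using least[of "p mod d"] d(3) by fastforce
    then have pe: "p = (p div d) * d" using \<open>p = (p div d) * d + p mod d\<close> by simp
    define e where "e = p div d"
    have "e \<noteq> 0" using pe \<open>p \<noteq> 0\<close> by (auto simp: e_def)
    then have "degree p = degree e + degree d" using pe d(1) degree_mult_eq[of e d] by (simp add: e_def)
    then have "degree e \<noteq> 0" using d(3) by simp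
    then have "\<not> constant (poly e)" by (simp add: constant_degree)
    \<comment> \<open>For a root \<open>l\<close> of the cofactor, \<open>Q l\<close> is a multiple
      of \<open>d\<close> and therefore lies in \<open>J\<close>.\<close>
    then obtain l where l: "poly e l = 0" using Fundamental_Theorem_Algebra.fundamental_theorem_of_algebra by blast
    then obtain e' where e': "e = [:- l, 1:] * e'" by (auto simp: poly_eq_0_iff_dvd elim: dvdE)
    have p_eq: "p = [:- l, 1:] * (e' * d)" using pe unfolding e_def[symmetric] e' by (simp only: mult.assoc)
    have "Q l = e' * d" unfolding Q_def by (subst p_eq, rule nonzero_mult_div_cancel_left) simp
    then have "J (Q l)" using J_mult[OF d(2)] by simp
    moreover have "l \<in> R" unfolding R_def by (subst p_eq) simp
    ultimately show False using JQ by blast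
  qed
  have "generic_initial F G (degree p) x"
    unfolding generic_initial_def
  proof (intro allI impI)
    fix c i
    assume c: "\<forall>j. (\<forall>k. (\<Sum>i<degree p. c i * nu F G (Suc (i + j)) (Some (Inr k))) = 0) \<and>
       (\<Sum>i<degree p. c i * ((\<Sum>n\<in>UNIV. nu F G (Suc (i + j)) (Some (Inl n)) * x n) + nu F G (Suc (i + j)) None)) = 0"
      and i: "i < degree p"
    define q where "q = (\<Sum>i<degree p. monom (c i) i)"
    have cq: "coeff q i = (if i < degree p then c i else 0)" for i
      unfolding q_def coeff_sum by (simp add: coeff_monom)
    have degq: "q = 0 \<or> degree q < degree p"
    proof (rule ccontr)
      assume "\<not> ?thesis"
      then have "q \<noteq> 0" "coeff q (degree q) = 0" by (auto simp: cq)
      then show False by simp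
    qed
    have nuW: "nu F (W q) j o1 = (\<Sum>i<degree p. c i * nu F G (Suc (i + j)) o1)" for j o1
    proof -
      have "degree q \<le> degree p" using degq by auto
      from comb_bound[OF this, of V] have "W q = (\<lambda>o1. \<Sum>i\<le>degree p. coeff q i * V i o1)"
        unfolding W_def by (rule ext)
      also have "\<dots> = (\<lambda>o1. \<Sum>i\<in>{..<degree p}. c i * nu F G (Suc i) o1)"
        by (rule ext, rule sum.mono_neutral_cong_right) (auto simp: cq V)
      finally show ?thesis by (simp add: nu_sum nu_nu)
    qed
    have "J q"
      unfolding J_def
    proof
      fix j
      have "(\<Sum>n\<in>UNIV. nu F (W q) j (Some (Inl n)) * x n) + nu F (W q) j None =
        (\<Sum>i<degree p. c i * ((\<Sum>n\<in>UNIV. nu F G (Suc (i + j)) (Some (Inl n)) * x n) + nu F G (Suc (i + j)) None))"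
        unfolding nuW distrib_left sum.distrib sum_distrib_left sum_distrib_right
        by (subst sum.swap) (simp add: mult.assoc)
      then show "z (nu F (W q) j)" using c nuW by (simp add: z_def)
    qed
    then have "q = 0" using J_small degq by blast
    then show "c i = 0" using cq[of i] i by simp
  qed
  then show ?thesis by blast
qed

section \<open>Rows at a parameter value and open conditions\<close>

definition rows_defined :: "('n \<Rightarrow> ('n, 'k, 'l::linorder ratfun) row) \<Rightarrow> ('n, 'k, 'l ratfun) row \<Rightarrow> ('l \<Rightarrow> complex) \<Rightarrow> bool" where
  "rows_defined F G a \<longleftrightarrow> (\<forall>n o1. rf_defined (F n o1) a) \<and> (\<forall>o1. rf_defined (G o1) a)"

abbreviation eval_row :: "('l \<Rightarrow> complex) \<Rightarrow> ('n, 'k, 'l::linorder ratfun) row \<Rightarrow> ('n, 'k, complex) row" where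
  "eval_row a w \<equiv> (\<lambda>o1. rf_eval a (w o1))"

abbreviation eval_rows :: "('l \<Rightarrow> complex) \<Rightarrow> ('n \<Rightarrow> ('n, 'k, 'l::linorder ratfun) row) \<Rightarrow> 'n \<Rightarrow> ('n, 'k, complex) row" where
  "eval_rows a F \<equiv> (\<lambda>n. eval_row a (F n))"

lemma nu_eval:
  fixes F :: "'n::finite \<Rightarrow> ('n, 'k, 'l::linorder ratfun) row"
  assumes "rows_defined F G a"
  shows "rf_defined (nu F G i o1) a" "rf_eval a (nu F G i o1) = nu (eval_rows a F) (eval_row a G) i o1"
proof -
  have F: "rf_defined (F n o1) a" for n o1 using assms by (simp add: rows_defined_def)
  have "\<forall>o1. rf_defined (nu F G i o1) a \<and> rf_eval a (nu F G i o1) = nu (eval_rows a F) (eval_row a G) i o1"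
  proof (induction i)
    case 0
    then show ?case using assms by (simp add: rows_defined_def)
  next
    case (Suc i)
    then show ?case by (simp add: nu_Suc row_step_def rf_sum rf_mult F)
  qed
  then show "rf_defined (nu F G i o1) a" "rf_eval a (nu F G i o1) = nu (eval_rows a F) (eval_row a G) i o1"
    by auto
qed

text \<open>Genericity is independence of \<open>r\<close> vectors with infinitely many coordinates:
  for every \<open>j\<close> the input entries and the value at the initial point. Elimination
  selects only \<open>r\<close> pivots, so a single polynomial in initial values and parameters
  suffices.\<close>

lemma generic_initial_open:
  fixes F :: "'n::finite \<Rightarrow> ('n, 'k::finite, 'l::linorder ratfun) row"
  assumes a0: "rows_defined F G a0" and gen: "generic_initial (eval_rows a0 F) (eval_row a0 G) r x0"
  shows "\<exists>P :: ('n + 'l \<Rightarrow> complex) \<Rightarrow> complex. poly_fun P \<and> P (case_sum x0 a0) \<noteq> 0 \<and>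
    (\<forall>x a. P (case_sum x a) \<noteq> 0 \<and> rows_defined F G a \<longrightarrow> generic_initial (eval_rows a F) (eval_row a G) r x)"
proof -
  let ?e = "\<lambda>(z :: 'n + 'l \<Rightarrow> complex) \<kappa>. rf_eval (\<lambda>l. z (Inr l)) \<kappa>"
  define v where "v i s z = (case s of (j, Some k) \<Rightarrow> ?e z (nu F G (Suc (i + j)) (Some (Inr k)))
    | (j, None) \<Rightarrow> (\<Sum>n\<in>UNIV. ?e z (nu F G (Suc (i + j)) (Some (Inl n))) * z (Inl n)) + ?e z (nu F G (Suc (i + j)) None))"
    for i and s :: "nat \<times> 'k option" and z
  have gen_iff: "generic_initial (eval_rows a F) (eval_row a G) r x \<longleftrightarrow>
      (\<forall>c. (\<forall>s. (\<Sum>i<r. c i * v i s (case_sum x a)) = 0) \<longrightarrow> (\<forall>i\<in>{..<r}. c i = 0))" if "rows_defined F G a" for x a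
  proof -
    have vals: "v i (j, Some k) (case_sum x a) = nu (eval_rows a F) (eval_row a G) (Suc (i + j)) (Some (Inr k))"
      "v i (j, None) (case_sum x a) = (\<Sum>n\<in>UNIV. nu (eval_rows a F) (eval_row a G) (Suc (i + j)) (Some (Inl n)) * x n) +
          nu (eval_rows a F) (eval_row a G) (Suc (i + j)) None" for i j k
      by (simp_all add: v_def nu_eval[OF that])
    have all: "(\<forall>s. R s) \<longleftrightarrow> (\<forall>j. (\<forall>k. R (j, Some k)) \<and> R (j, None))" for R :: "nat \<times> 'k option \<Rightarrow> bool"
      by (metis option.exhaust surj_pair)
    show ?thesis
      unfolding generic_initial_def all vals Ball_def lessThan_iff ..
  qed
  have "\<exists>P. poly_fun P \<and> P (case_sum x0 a0) \<noteq> 0 \<and>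
    (\<forall>z. P z \<noteq> 0 \<longrightarrow> (\<forall>c. (\<forall>s. (\<Sum>i<r. c i * v i s z) = 0) \<longrightarrow> (\<forall>i\<in>{..<r}. c i = 0)))"
  proof (rule independent_open)
    show "regular_at (case_sum x0 a0) (v i s)" for i s
    proof -
      have reg: "regular_at (case_sum x0 a0) (\<lambda>z. ?e z (nu F G i o1))" for i o1
        using nu_eval(1)[OF a0] by (intro regular_at_rf_eval) simp
      obtain j o1 where s: "s = (j, o1)" by (cases s)
      show ?thesis
      proof (cases o1)
        case None
        then show ?thesis unfolding s
          by (simp add: v_def[abs_def])
             (intro regular_at_add regular_at_sum regular_at_mult reg regular_at_poly poly_fun_var)
      next
        case (Some k)
        then show ?thesis unfolding s by (simp add: v_def[abs_def] reg)
      qed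
    qed
    fix c assume "\<And>s. (\<Sum>i<r. c i * v i s (case_sum x0 a0)) = 0"
    then show "\<forall>i\<in>{..<r}. c i = 0" using gen gen_iff[OF a0] by blast
  qed simp
  then obtain P where P: "poly_fun P" "P (case_sum x0 a0) \<noteq> 0"
    "\<forall>z. P z \<noteq> 0 \<longrightarrow> (\<forall>c. (\<forall>s. (\<Sum>i<r. c i * v i s z) = 0) \<longrightarrow> (\<forall>i\<in>{..<r}. c i = 0))"
    by (elim exE conjE)
  show ?thesis
  proof (intro exI[of _ P] conjI allI impI P(1,2))
    fix x a assume "P (case_sum x a) \<noteq> 0 \<and> rows_defined F G a"
    then show "generic_initial (eval_rows a F) (eval_row a G) r x"
      using spec[OF P(3), of "case_sum x a"] gen_iff[of a x] by (elim conjE) (simp only: simp_thms not_False_eq_True)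
  qed
qed

text \<open>The finitely supported point is provided so that the open set can be seen to contain an
  analytic input.\<close>

lemma input_independent_open:
  "\<exists>P :: (('k::finite \<times> nat \<Rightarrow> complex) \<Rightarrow> complex). poly_fun P \<and>
     (\<forall>z. P z \<noteq> 0 \<longrightarrow> input_independent N (\<lambda>k i. z (k, i))) \<and>
     (\<exists>z. P z \<noteq> 0 \<and> (\<forall>k. finite {i. z (k, i) \<noteq> 0}))"
proof -
  obtain e :: "'k \<Rightarrow> nat" where e: "inj e"
    using finite_imp_inj_to_nat_seg[of "UNIV :: 'k set"] by auto
  \<comment> \<open>Unit impulses at distinct multiples of \<open>Suc N\<close>: shifts by at most
    \<open>N\<close> cannot make two of them coincide.\<close>
  define m where "m k = Suc N * Suc (e k)" for k
  define z0 where "z0 = (\<lambda>(k, i). if i = m k then 1 else 0 :: complex)"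
  define v where "v = (\<lambda>(k :: 'k, j) (s :: nat) (z :: 'k \<times> nat \<Rightarrow> complex). z (k, j + s))"
  let ?I = "(UNIV :: 'k set) \<times> {..N}"
  have "\<exists>P. poly_fun P \<and> P z0 \<noteq> 0 \<and>
    (\<forall>z. P z \<noteq> 0 \<longrightarrow> (\<forall>c. (\<forall>s. (\<Sum>i\<in>?I. c i * v i s z) = 0) \<longrightarrow> (\<forall>i\<in>?I. c i = 0)))"
  proof (rule independent_open)
    show "regular_at z0 (v i s)" for i s
      unfolding v_def by (cases i) (auto intro!: regular_at_poly poly_fun_var)
    fix c assume c: "\<And>s. (\<Sum>i\<in>?I. c i * v i s z0) = 0"
    show "\<forall>i\<in>?I. c i = 0"
    proof
      fix i0 assume i0: "i0 \<in> ?I"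
      obtain k0 j0 where kj: "i0 = (k0, j0)" "j0 \<le> N" using i0 by auto
      \<comment> \<open>This shift isolates the term \<open>(k0, j0)\<close>. The subtraction is
        exact, as \<open>m k0\<close> is at least \<open>Suc N\<close>.\<close>
      define s where "s = m k0 - j0"
      have ms: "m k0 = j0 + s" using kj by (simp add: s_def m_def)
      have "v i s z0 = (if i = i0 then 1 else 0)" if i: "i \<in> ?I" for i
      proof -
        obtain k j where k: "i = (k, j)" "j \<le> N" using i by auto
        have "k = k0 \<and> j = j0" if eq: "j + s = m k"
        proof -
          have "j + m k0 = j0 + m k" using eq ms by simp
          then have "(j + m k0) mod Suc N = (j0 + m k) mod Suc N" by (rule arg_cong)
          then have "j = j0" using k kj unfolding m_def mod_mult_self2 by simp
          then have "m k0 = m k" using \<open>j + m k0 = j0 + m k\<close> by simp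
          then have "e k0 = e k" unfolding m_def mult_cancel1 by blast
          then show ?thesis using e \<open>j = j0\<close> by (simp add: inj_eq)
        qed
        then have "j + s = m k \<longleftrightarrow> i = i0" using ms[symmetric] kj(1) k(1) by blast
        then show ?thesis by (simp add: v_def z0_def k(1))
      qed
      then have "0 = (\<Sum>i\<in>?I. c i * (if i = i0 then 1 else 0))" using c[of s] by simp
      also have "\<dots> = c i0" using i0 by (simp add: if_distrib[of "\<lambda>x. _ * x"] cong: if_cong)
      finally show "c i0 = 0" by simp
    qed
  qed simp
  then obtain P where P0: "poly_fun P" "P z0 \<noteq> 0"
    "\<forall>z. P z \<noteq> 0 \<longrightarrow> (\<forall>c. (\<forall>s. (\<Sum>i\<in>?I. c i * v i s z) = 0) \<longrightarrow> (\<forall>i\<in>?I. c i = 0))"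
    by (elim exE conjE)
  have P: "\<forall>i\<in>?I. c i = 0" if "P z \<noteq> 0" "\<And>s. (\<Sum>i\<in>?I. c i * v i s z) = 0" for z c
    using P0(3) that by simp
  have "input_independent N (\<lambda>k i. z (k, i))" if z: "P z \<noteq> 0" for z
    unfolding input_independent_def
  proof (intro allI impI, elim conjE)
    fix q k assume deg: "\<forall>k. degree (q k) \<le> N" and rel: "\<forall>s. (\<Sum>k\<in>UNIV. act (q k) (\<lambda>i. z (k, i)) s) = 0"
    have "\<forall>i\<in>?I. (\<lambda>(k, j). coeff (q k) j) i = 0"
    proof (rule P[OF z])
      fix s
      have "(\<Sum>i\<in>?I. (\<lambda>(k, j). coeff (q k) j) i * v i s z) = (\<Sum>k\<in>UNIV. \<Sum>j\<le>N. coeff (q k) j * z (k, j + s))"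
        by (subst sum.cartesian_product) (auto intro!: sum.cong simp: v_def)
      also have "\<dots> = (\<Sum>k\<in>UNIV. act (q k) (\<lambda>i. z (k, i)) s)"
        by (intro sum.cong refl act_bound[symmetric]) (use deg in auto)
      finally show "(\<Sum>i\<in>?I. (\<lambda>(k, j). coeff (q k) j) i * v i s z) = 0" using rel by simp
    qed
    then have "coeff (q k) j = 0" if "j \<le> N" for j using that by force
    then have "lead_coeff (q k) = 0" using deg by blast
    then show "q k = 0" by simp
  qed
  moreover have "finite {i. z0 (k, i) \<noteq> 0}" for k
    by (rule finite_subset[of _ "{m k}"]) (auto simp: z0_def)
  ultimately show ?thesis using P0(1,2) by (intro exI[of _ P]) auto
qed

section \<open>Solutions at a parameter value\<close>

lemma mp_eval_row_eval:
  fixes p :: "('n::finite, 'k::finite, 'l::linorder) syspoly"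
  assumes "total_degree p \<le> 1"
  shows "mp_eval (rf_eval a) (case_sum x u) p = row_eval (eval_row a (coeff_row p)) x u 1"
  using mp_eval_coeff_row[OF assms, of "rf_eval a" x u] by (simp add: row_eval_def)

text \<open>A solution exists, so the choice in \<open>Y_out\<close> picks the output of a genuine
  one; its derivatives at 0 then satisfy the recurrence with the given initial values.\<close>

lemma Y_out_jet:
  fixes f :: "'n::finite \<Rightarrow> ('n, 'k::finite, 'l::linorder) syspoly" and g :: "'m \<Rightarrow> ('n, 'k, 'l) syspoly" and j :: 'm
  assumes deg: "\<And>i. total_degree (f i) \<le> 1" "\<And>j. total_degree (g j) \<le> 1" and u: "\<And>k. u k analytic_on {0}"
  shows "Y_out f g x0 a u j analytic_on {0}"
    "\<exists>X. seq_sol (eval_rows a (\<lambda>i. coeff_row (f i))) (eval_row a (coeff_row (g j))) X (\<lambda>k. jet (u k)) (jet (Y_out f g x0 a u j))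
      \<and> (\<forall>n. X n 0 = x0 n)"
proof -
  let ?F = "eval_rows a (\<lambda>i. coeff_row (f i))"
  obtain x where x: "is_row_solution ?F u x" "\<And>n. x n 0 = x0 n" using row_solution_exists[of u ?F x0] u by blast
  define y where "y j t = row_eval (eval_row a (coeff_row (g j))) (\<lambda>n. x n t) (\<lambda>k. u k t) 1" for j :: 'm and t
  have "y j analytic_on {0}" for j
  proof (rule has_fps_expansion_imp_analytic_0)
    show "y j has_fps_expansion row_fps (eval_row a (coeff_row (g j))) (\<lambda>n. fps_expansion (x n) 0) (\<lambda>k. fps_expansion (u k) 0)"
      unfolding y_def[abs_def] using x(1) u
      by (intro row_has_fps_expansion analytic_at_imp_has_fps_expansion_0) (auto simp: is_row_solution_def)
  qed
  then have "is_solution f g x0 a u x y"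
    using x by (simp add: is_solution_def is_row_solution_def mp_eval_row_eval[OF deg(1)] mp_eval_row_eval[OF deg(2)] y_def)
  then have "\<exists>y x. is_solution f g x0 a u x y" by blast
  from someI_ex[OF this] obtain x where sol: "is_solution f g x0 a u x (Y_out f g x0 a u)"
    unfolding Y_out_def by blast
  then show "Y_out f g x0 a u j analytic_on {0}" by (simp add: is_solution_def)
  have "is_row_solution ?F u x" "\<forall>\<^sub>F t in nhds 0. Y_out f g x0 a u j t = row_eval (eval_row a (coeff_row (g j))) (\<lambda>n. x n t) (\<lambda>k. u k t) 1"
    using sol by (simp_all add: is_solution_def is_row_solution_def mp_eval_row_eval[OF deg(1)] mp_eval_row_eval[OF deg(2)])
  then have "seq_sol ?F (eval_row a (coeff_row (g j))) (\<lambda>n. jet (x n)) (\<lambda>k. jet (u k)) (jet (Y_out f g x0 a u j))"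
    using u by (intro jet_seq_sol)
  moreover have "jet (x n) 0 = x0 n" for n using sol by (simp add: jet_def is_solution_def)
  ultimately show "\<exists>X. seq_sol ?F (eval_row a (coeff_row (g j))) X (\<lambda>k. jet (u k)) (jet (Y_out f g x0 a u j))
      \<and> (\<forall>n. X n 0 = x0 n)" by blast
qed

lemma same_germs_iff_jet:
  fixes y z :: "'m \<Rightarrow> complex \<Rightarrow> complex"
  assumes m: "UNIV = {j0 :: 'm}" and "y j0 analytic_on {0}" "z j0 analytic_on {0}"
  shows "same_germs y z \<longleftrightarrow> jet (y j0) = jet (z j0)"
proof -
  have "(\<forall>j. R j) \<longleftrightarrow> R j0" for R using m by (metis UNIV_I singletonD)
  then show ?thesis unfolding same_germs_def using eventually_eq_iff_jet[OF assms(2,3)] by simp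
qed

lemma Omega_iff:
  fixes f :: "'n::finite \<Rightarrow> ('n, 'k::finite, 'l::linorder) syspoly" and g :: "'m \<Rightarrow> ('n, 'k, 'l) syspoly"
  assumes deg: "\<And>i. total_degree (f i) \<le> 1" "\<And>j. total_degree (g j) \<le> 1" and m: "UNIV = {j0 :: 'm}"
  shows "a \<in> Omega f g \<longleftrightarrow> rows_defined (\<lambda>i. coeff_row (f i)) (coeff_row (g j0)) a"
proof -
  have "(\<forall>m. rf_defined (Poly_Mapping.lookup p m) a) \<longleftrightarrow> (\<forall>o1. rf_defined (coeff_row p o1) a)"
    if "total_degree p \<le> 1" for p :: "('n, 'k, 'l) syspoly"
  proof (intro iffI allI)
    fix o1 assume "\<forall>m. rf_defined (Poly_Mapping.lookup p m) a"
    then show "rf_defined (coeff_row p o1) a" by (simp add: coeff_row_def split: option.split)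
  next
    fix m assume o1: "\<forall>o1. rf_defined (coeff_row p o1) a"
    show "rf_defined (Poly_Mapping.lookup p m) a"
    proof (cases "m \<in> Poly_Mapping.keys p")
      case True
      then show ?thesis
        using total_degree_le_1_keys[OF that True] spec[OF o1, of None] spec[OF o1, of "Some _"]
        by (auto simp: coeff_row_def)
    qed (simp add: in_keys_iff)
  qed
  moreover have "(\<forall>j. R j) \<longleftrightarrow> R j0" for R using m by (metis UNIV_I singletonD)
  ultimately show ?thesis using deg by (simp add: Omega_def rows_defined_def)
qed

definition defined_coeffs :: "'l::linorder ratfun poly \<Rightarrow> ('l \<Rightarrow> complex) \<Rightarrow> bool" where
  "defined_coeffs p a \<longleftrightarrow> (\<forall>i. rf_defined (coeff p i) a)"

abbreviation eval_poly :: "('l \<Rightarrow> complex) \<Rightarrow> 'l::linorder ratfun poly \<Rightarrow> complex poly" where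
  "eval_poly a \<equiv> map_poly (rf_eval a)"

lemma coeff_eval_poly: "coeff (eval_poly a p) i = rf_eval a (coeff p i)"
  by (simp add: coeff_map_poly)

lemma degree_eval_poly_le: "degree (eval_poly a p) \<le> degree p"
  by (rule degree_le) (simp add: coeff_eval_poly coeff_eq_0)

lemma monic_eval_poly:
  assumes "lead_coeff p = 1"
  shows "degree (eval_poly a p) = degree p" "lead_coeff (eval_poly a p) = 1"
proof -
  have "coeff (eval_poly a p) (degree p) = 1" using assms by (simp add: coeff_eval_poly)
  then show "degree (eval_poly a p) = degree p"
    using degree_eval_poly_le[of a p] by (metis antisym le_degree zero_neq_one)
  then show "lead_coeff (eval_poly a p) = 1" using assms by (simp add: coeff_eval_poly)
qed

lemma eval_poly_pCons: "eval_poly a (pCons 0 p) = pCons 0 (eval_poly a p)"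
  by (rule poly_eqI) (simp add: coeff_eval_poly coeff_pCons split: nat.split)

lemma comb_eval:
  fixes F :: "'n::finite \<Rightarrow> ('n, 'k::finite, 'l::linorder ratfun) row"
  assumes "rows_defined F G a" "defined_coeffs p a"
  shows "rf_defined (comb (nu F G) p o1) a"
    "rf_eval a (comb (nu F G) p o1) = comb (nu (eval_rows a F) (eval_row a G)) (eval_poly a p) o1"
proof -
  have d: "rf_defined (coeff p i * nu F G i o1) a" for i
    using assms(2) nu_eval(1)[OF assms(1)] by (auto simp: defined_coeffs_def intro: rf_mult)
  then show "rf_defined (comb (nu F G) p o1) a" unfolding comb_def by (intro rf_sum)
  show "rf_eval a (comb (nu F G) p o1) = comb (nu (eval_rows a F) (eval_row a G)) (eval_poly a p) o1"
    by (subst comb_bound[OF degree_eval_poly_le])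
      (use assms(2) in \<open>simp add: comb_def rf_sum d rf_mult defined_coeffs_def nu_eval[OF assms(1)] coeff_eval_poly\<close>)
qed

lemma input_comb_eval:
  fixes F :: "'n::finite \<Rightarrow> ('n, 'k::finite, 'l::linorder ratfun) row"
  assumes "rows_defined F G a" "defined_coeffs p a"
  shows "rf_defined (coeff (input_comb F G p k) m) a"
    "rf_eval a (coeff (input_comb F G p k) m) = coeff (input_comb (eval_rows a F) (eval_row a G) (eval_poly a p) k) m"
proof -
  have d: "rf_defined (coeff p i * nu F G j o1) a" for i j o1
    using assms(2) nu_eval(1)[OF assms(1)] by (auto simp: defined_coeffs_def intro: rf_mult)
  then show "rf_defined (coeff (input_comb F G p k) m) a" unfolding coeff_input_comb by (intro rf_sum)
  have "coeff (input_comb (eval_rows a F) (eval_row a G) (eval_poly a p) k) m =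
      (\<Sum>i\<in>{m..degree p}. coeff (eval_poly a p) i * nu (eval_rows a F) (eval_row a G) (i - m) (Some (Inr k)))"
    unfolding coeff_input_comb using degree_eval_poly_le[of a p]
    by (intro sum.mono_neutral_left) (auto simp: coeff_eq_0)
  then show "rf_eval a (coeff (input_comb F G p k) m) = coeff (input_comb (eval_rows a F) (eval_row a G) (eval_poly a p) k) m"
    using assms(2) by (simp add: coeff_input_comb rf_sum d rf_mult defined_coeffs_def nu_eval[OF assms(1)] coeff_eval_poly)
qed

lemma input_comb_pCons:
  "input_comb F G (pCons 0 p) k = pCons (comb (\<lambda>i. nu F G (Suc i)) p (Some (Inr k))) (input_comb F G p k)"
proof (cases "p = 0")
  case True
  then show ?thesis by (simp add: input_comb_def comb_def)
next
  case False
  show ?thesis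
  proof (rule poly_eqI)
    fix m
    show "coeff (input_comb F G (pCons 0 p) k) m = coeff (pCons (comb (\<lambda>i. nu F G (Suc i)) p (Some (Inr k))) (input_comb F G p k)) m"
    proof (cases m)
      case 0
      then show ?thesis using False
        by (simp add: coeff_input_comb comb_def atLeast0AtMost sum.atMost_Suc_shift del: sum.atMost_Suc sum.cl_ivl_Suc)
    next
      case (Suc m')
      have "(\<Sum>i = Suc m'..Suc (degree p). coeff (pCons 0 p) i * nu F G (i - Suc m') (Some (Inr k))) =
          (\<Sum>i = m'..degree p. coeff p i * nu F G (i - m') (Some (Inr k)))"
        by (subst sum.shift_bounds_cl_Suc_ivl) simp
      then show ?thesis using False Suc by (simp add: coeff_input_comb)
    qed
  qed
qed

lemma comb_pCons: "comb (nu F G) (pCons 0 p) = comb (\<lambda>i. nu F G (Suc i)) p"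
  using comb_nu[of F G p] by (simp add: monom_Suc monom_0)

lemma comb_diff: "comb V (p - q) o1 = comb V p o1 - comb V q o1"
  using comb_add[of V "p - q" q o1] by simp

text \<open>Both outputs obey the recurrence of order \<open>degree P\<close> given by
  \<open>P\<close>, with the same right-hand side.\<close>

lemma outputs_eq:
  assumes sol: "seq_sol F G X U Y" "seq_sol F' G' X' U Y'"
    and P: "lead_coeff P = 1" "\<And>n. comb (nu F G) P (Some (Inl n)) = 0" "\<And>n. comb (nu F' G') P (Some (Inl n)) = 0"
    and eq: "\<And>k. input_comb F G P k = input_comb F' G' P k" "comb (nu F G) P None = comb (nu F' G') P None"
    and init: "\<And>i. i < degree P \<Longrightarrow> Y i = Y' i"
  shows "Y = Y'"
proof
  fix i
  show "Y i = Y' i"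
  proof (induction i rule: less_induct)
    case (less i)
    show ?case
    proof (cases "i < degree P")
      case False
      define s where "s = i - degree P"
      have i: "i = degree P + s" using False by (simp add: s_def)
      have act: "act P Z s = (\<Sum>j<degree P. coeff P j * Z (j + s)) + Z i" for Z
        using P(1) by (simp add: act_def lessThan_Suc_atMost[symmetric] i)
      have "act P Y s = act P Y' s"
        unfolding act_output[OF sol(1)] act_output[OF sol(2)] using P eq by simp
      moreover have "(\<Sum>j<degree P. coeff P j * Y (j + s)) = (\<Sum>j<degree P. coeff P j * Y' (j + s))"
        using less.IH i by (intro sum.cong) auto
      ultimately show ?thesis by (simp add: act)
    qed (rule init)
  qed
qed

lemma poly_of_coeffs:
  obtains q :: "'a::comm_ring_1 poly" where "\<And>i. coeff q i = (if i < r then c i else 0)" "q = 0 \<or> degree q < r"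
proof
  define q where "q = (\<Sum>i<r. monom (c i) i)"
  show cq: "coeff q i = (if i < r then c i else 0)" for i
    unfolding q_def coeff_sum by (simp add: coeff_monom)
  show "q = 0 \<or> degree q < r"
  proof (rule ccontr)
    assume "\<not> ?thesis"
    then have "q \<noteq> 0" "coeff q (degree q) = 0" by (auto simp: cq)
    then show False by simp
  qed
qed

lemma comb_lessThan:
  assumes "\<And>i. coeff q i = (if i < r then c i else 0)"
  shows "comb V q o1 = (\<Sum>i<r. c i * V i o1)"
proof -
  have "degree q \<le> r" by (rule degree_le) (simp add: assms)
  from comb_bound[OF this, of V o1] show ?thesis
    by (simp add: assms lessThan_Suc_atMost[symmetric])
qed

text \<open>Made monic, a nonzero \<open>Q\<close> would contradict the minimality of
  \<open>P\<close>.\<close>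

lemma min_relation_small:
  assumes P: "min_relation F G P" and Q: "\<And>n. comb (nu F G) Q (Some (Inl n)) = 0" "Q = 0 \<or> degree Q < degree P"
  shows "Q = 0"
proof (rule ccontr)
  assume nz: "Q \<noteq> 0"
  define Q' where "Q' = smult (inverse (lead_coeff Q)) Q"
  have "lead_coeff Q' = 1" using nz by (simp add: Q'_def)
  moreover have "comb (nu F G) Q' (Some (Inl n)) = 0" for n by (simp add: Q'_def comb_smult Q)
  ultimately have "degree P \<le> degree Q'" using P unfolding min_relation_def by blast
  then show False using Q(2) nz by (simp add: Q'_def)
qed

lemma min_relation_independent:
  assumes P: "min_relation F G P" and c: "\<And>n. (\<Sum>i<degree P. c i * nu F G i (Some (Inl n))) = 0"
  shows "\<forall>i<degree P. c i = 0"
proof -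
  obtain q where q: "\<And>i. coeff q i = (if i < degree P then c i else 0)" "q = 0 \<or> degree q < degree P"
    using poly_of_coeffs by blast
  have "q = 0" using c q(2) by (intro min_relation_small[OF P]) (auto simp: comb_lessThan[OF q(1)])
  then show ?thesis using q(1) by (metis coeff_0)
qed

text \<open>
  The minimal relation between \<open>y', y'', \<dots>\<close> without constant term: it is the input-output equation
  itself if that is the derivative of a first integral, and its derivative otherwise.
\<close>

lemma reduced_relation:
  assumes P: "min_relation F G P"
  obtains p where "lead_coeff p = 1" "comb (\<lambda>i. nu F G (Suc i)) p = (\<lambda>_. 0)"
    "\<And>c. (\<And>o1. (\<Sum>i<degree p. c i * nu F G (Suc i) o1) = 0) \<Longrightarrow> \<forall>i<degree p. c i = 0"
    "P = p \<or> P = pCons 0 p"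
proof (cases "\<exists>p. P = pCons 0 p \<and> comb (\<lambda>i. nu F G (Suc i)) p = (\<lambda>_. 0)")
  case True
  then obtain p where p: "P = pCons 0 p" "comb (\<lambda>i. nu F G (Suc i)) p = (\<lambda>_. 0)" by blast
  have lcP: "lead_coeff P = 1" using P by (simp add: min_relation_def)
  then have "p \<noteq> 0" using p(1) by auto
  show thesis
  proof (rule that)
    show "lead_coeff p = 1" using lcP p(1) \<open>p \<noteq> 0\<close> by simp
    fix c assume c: "\<And>o1. (\<Sum>i<degree p. c i * nu F G (Suc i) o1) = 0"
    have dP: "degree P = Suc (degree p)" using p(1) \<open>p \<noteq> 0\<close> by simp
    \<comment> \<open>A relation among the rows from index 1 on is a relation among all rows with
      coefficient 0 at index 0.\<close>
    have "\<forall>i<degree P. (case i of 0 \<Rightarrow> 0 | Suc i \<Rightarrow> c i) = 0"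
      using c by (intro min_relation_independent[OF P]) (simp add: dP sum.lessThan_Suc_shift del: sum.lessThan_Suc)
    then show "\<forall>i<degree p. c i = 0" unfolding dP by auto
  qed (use p in auto)
next
  case False
  have lcP: "lead_coeff P = 1" and st: "\<And>n. comb (nu F G) P (Some (Inl n)) = 0" using P by (auto simp: min_relation_def)
  show thesis
  proof (rule that)
    show "lead_coeff P = 1" by fact
    \<comment> \<open>The derivative of a row without state entries consists of input derivatives,
      which \<open>row_step\<close> drops.\<close>
    show "comb (\<lambda>i. nu F G (Suc i)) P = (\<lambda>_. 0)"
      unfolding comb_nu_Suc by (rule ext) (rule row_step_state_zero, rule st)
    fix c assume c: "\<And>o1. (\<Sum>i<degree P. c i * nu F G (Suc i) o1) = 0"
    obtain q where q: "\<And>i. coeff q i = (if i < degree P then c i else 0)" "q = 0 \<or> degree q < degree P"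
      using poly_of_coeffs by blast
    have combq: "comb (\<lambda>i. nu F G (Suc i)) q o1 = 0" for o1 using c by (simp add: comb_lessThan[OF q(1)])
    have "q = 0"
    proof (rule ccontr)
      assume nz: "q \<noteq> 0"
      define q' where "q' = smult (inverse (lead_coeff q)) q"
      have q': "q' \<noteq> 0" "lead_coeff q' = 1" "degree q' = degree q" using nz by (auto simp: q'_def)
      have combq': "comb (\<lambda>i. nu F G (Suc i)) q' = (\<lambda>_. 0)" by (rule ext) (simp add: q'_def comb_smult combq)
      \<comment> \<open>\<open>pCons 0 q'\<close> competes with \<open>P\<close>: minimality forces
        equal degrees, then the difference is zero, which puts \<open>P\<close> into the case
        already treated.\<close>
      then have combQ: "comb (nu F G) (pCons 0 q') = (\<lambda>_. 0)" by (simp add: comb_pCons)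
      have lcQ: "lead_coeff (pCons 0 q') = 1" using q' by simp
      have "\<forall>n. comb (nu F G) (pCons 0 q') (Some (Inl n)) = 0" by (simp add: combQ)
      then have "degree P \<le> degree (pCons 0 q')" using P lcQ unfolding min_relation_def by blast
      then have dQ: "degree (pCons 0 q') = degree P" using q(2) nz q' by simp
      have "P - pCons 0 q' = 0"
      proof (rule min_relation_small[OF P])
        show "comb (nu F G) (P - pCons 0 q') (Some (Inl n)) = 0" for n by (simp add: comb_diff st combQ)
        have "coeff (P - pCons 0 q') (degree P) = 0" using lcP lcQ dQ by simp
        moreover have "degree (P - pCons 0 q') \<le> degree P" using dQ by (intro degree_diff_le) auto
        ultimately show "P - pCons 0 q' = 0 \<or> degree (P - pCons 0 q') < degree P"
          by (metis le_neq_implies_less leading_coeff_0_iff)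
      qed
      then show False using False combq' by simp
    qed
    then show "\<forall>i<degree P. c i = 0" using q(1) by (metis coeff_0)
  qed simp
qed

text \<open>Being defined at \<open>b\<close> is part of the notion, because \<open>b\<close> need
  not be generic.\<close>

definition agree :: "('l \<Rightarrow> complex) \<Rightarrow> ('l \<Rightarrow> complex) \<Rightarrow> 'l::linorder ratfun \<Rightarrow> bool" where
  "agree a b \<kappa> \<longleftrightarrow> rf_defined \<kappa> a \<and> rf_defined \<kappa> b \<and> rf_eval a \<kappa> = rf_eval b \<kappa>"

text \<open>The functions that admit such a \<open>Q\<close> form a subfield. It is enough that
  \<open>a\<close> avoids the zeros of \<open>Q\<close>: inversion needs a nonzero value at
  \<open>a\<close>, and agreement passes it on to \<open>b\<close>.\<close>

lemma field_generated_agree: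
  fixes h :: "'l::linorder ratfun"
  assumes "h \<in> field_generated (range rf_const \<union> A)"
  shows "\<exists>Q. Q \<noteq> 0 \<and> (\<forall>a b. mp_eval id a Q \<noteq> 0 \<longrightarrow> (\<forall>\<kappa>\<in>A. agree a b \<kappa>) \<longrightarrow> agree a b h)"
proof -
  define good where "good Q h \<longleftrightarrow> Q \<noteq> 0 \<and> (\<forall>a b. mp_eval id a Q \<noteq> 0 \<longrightarrow> (\<forall>\<kappa>\<in>A. agree a b \<kappa>) \<longrightarrow> agree a b h)"
    for Q and h :: "'l ratfun"
  define S where "S = {h. \<exists>Q. good Q h}"
  have one: "good 1 h" if "\<And>a b. (\<forall>\<kappa>\<in>A. agree a b \<kappa>) \<Longrightarrow> agree a b h" for h
    using that by (simp add: good_def)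
  have mult: "mp_eval id a Q \<noteq> 0 \<and> mp_eval id a Q' \<noteq> 0" if "mp_eval id a (Q * Q') \<noteq> 0" for a :: "'l \<Rightarrow> complex" and Q Q'
    using that by (metis mp_eval_mult ring_hom_fun_id mult_eq_0_iff)
  have "is_subfield S"
    unfolding is_subfield_def
  proof (intro conjI ballI)
    show "0 \<in> S" "1 \<in> S" unfolding S_def using one[of 0] one[of 1] by (auto simp: agree_def)
    fix h assume "h \<in> S"
    then obtain Q where Q: "good Q h" by (auto simp: S_def)
    show "- h \<in> S" unfolding S_def using Q by (auto simp: good_def agree_def rf_uminus intro!: exI[of _ Q])
    show "inverse h \<in> S"
    proof (cases "h = 0")
      case True
      then show ?thesis using \<open>0 \<in> S\<close> by simp
    next
      case False
      from rf_numerator[OF False] obtain q where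
        q: "q \<noteq> 0" "\<And>a. mp_eval id a q \<noteq> 0 \<Longrightarrow> rf_defined h a \<and> rf_eval a h \<noteq> 0" by blast
      have "good (Q * q) (inverse h)" unfolding good_def
      proof (intro conjI allI impI)
        show "Q * q \<noteq> 0" using Q q by (simp add: good_def)
        fix a b assume ab: "mp_eval id a (Q * q) \<noteq> 0" "\<forall>\<kappa>\<in>A. agree a b \<kappa>"
        have "agree a b h" using Q mult[OF ab(1)] ab(2) unfolding good_def by blast
        moreover have "rf_eval a h \<noteq> 0" using q(2) mult[OF ab(1)] by blast
        ultimately show "agree a b (inverse h)" by (simp add: agree_def rf_inverse)
      qed
      then show ?thesis by (auto simp: S_def)
    qed
    fix h' assume "h' \<in> S"
    then obtain Q' where Q': "good Q' h'" by (auto simp: S_def)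
    have *: "Q * Q' \<noteq> 0" "\<And>a b. mp_eval id a (Q * Q') \<noteq> 0 \<Longrightarrow> \<forall>\<kappa>\<in>A. agree a b \<kappa> \<Longrightarrow> agree a b h \<and> agree a b h'"
    proof -
      show "Q * Q' \<noteq> 0" using Q Q' by (simp add: good_def)
      fix a b assume "mp_eval id a (Q * Q') \<noteq> 0" "\<forall>\<kappa>\<in>A. agree a b \<kappa>"
      then show "agree a b h \<and> agree a b h'" using Q Q' mult[of a Q Q'] unfolding good_def by blast
    qed
    have "good (Q * Q') (h + h')" "good (Q * Q') (h * h')"
    proof -
      have "agree a b (h + h') \<and> agree a b (h * h')" if "agree a b h" "agree a b h'" for a b
        using that by (simp add: agree_def rf_add rf_mult)
      then show "good (Q * Q') (h + h')" "good (Q * Q') (h * h')" unfolding good_def using * by blast+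
    qed
    then show "h + h' \<in> S" "h * h' \<in> S" by (auto simp: S_def)
  qed
  moreover have "rf_const c \<in> S" for c unfolding S_def using one[of "rf_const c"] by (auto simp: agree_def)
  moreover have "A \<subseteq> S" unfolding S_def using one by blast
  ultimately have "field_generated (range rf_const \<union> A) \<subseteq> S"
    unfolding field_generated_def by blast
  then show ?thesis using assms unfolding S_def good_def by blast
qed

section \<open>Identifiability and the input-output equation\<close>

lemma finite_range_coeff: "finite (range (coeff p))"
proof (rule finite_subset)
  show "range (coeff p) \<subseteq> insert 0 (coeff p ` {..degree p})"
  proof safe
    fix i assume "coeff p i \<notin> coeff p ` {..degree p}"
    then have "\<not> i \<le> degree p" by blast
    then show "coeff p i = 0" by (simp add: coeff_eq_0)
  qed
qed simp

text \<open>Recovers independence from the dual family after both have been evaluated at a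
  point.\<close>

lemma dual_family_independent:
  fixes c :: "nat \<Rightarrow> complex"
  assumes "\<And>i j. i < r \<Longrightarrow> j < r \<Longrightarrow> (\<Sum>s\<in>UNIV. L i s * v j s) = (if i = j then 1 else 0)"
    and c: "\<And>s. (\<Sum>j<r. c j * v j s) = 0"
  shows "\<forall>i<r. c i = 0"
proof (intro allI impI)
  fix i assume i: "i < r"
  have "0 = (\<Sum>s\<in>UNIV. \<Sum>j<r. L i s * (c j * v j s))" by (simp add: c flip: sum_distrib_left)
  also have "\<dots> = (\<Sum>j<r. c j * (\<Sum>s\<in>UNIV. L i s * v j s))"
    unfolding sum_distrib_left by (subst sum.swap) (simp add: mult.left_commute)
  also have "\<dots> = (\<Sum>j<r. if j = i then c i else 0)"
    by (intro sum.cong) (auto simp: assms(1)[OF i])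
  finally show "c i = 0" using i by simp
qed

context
  fixes f :: "'n::finite \<Rightarrow> ('n, 'k::finite, 'l::{finite,linorder}) syspoly" and g :: "'m::finite \<Rightarrow> ('n, 'k, 'l) syspoly"
    and j0 :: 'm and F :: "'n \<Rightarrow> ('n, 'k, 'l ratfun) row" and G :: "('n, 'k, 'l ratfun) row"
  assumes deg: "\<And>i. total_degree (f i) \<le> 1" "\<And>j. total_degree (g j) \<le> 1"
    and m: "UNIV = {j0 :: 'm}"
    and F_eq: "F = (\<lambda>i. coeff_row (f i))" and G_eq: "G = coeff_row (g j0)"
begin

lemma Omega_h_iff:
  "(x, a, u) \<in> Omega_h f g h \<longleftrightarrow> rows_defined F G a \<and> rf_defined h a \<and> (\<forall>k. u k analytic_on {0})"
  unfolding Omega_h_def F_eq G_eq by (simp add: Omega_iff[OF deg m])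

lemma output_sequence:
  assumes "\<forall>k. u k analytic_on {0}"
  shows "\<exists>X. seq_sol (eval_rows a F) (eval_row a G) X (\<lambda>k. jet (u k)) (jet (Y_out f g x a u j0)) \<and> (\<forall>n. X n 0 = x n)"
  unfolding F_eq G_eq by (rule Y_out_jet(2)) (use deg assms in auto)

lemma same_output_iff:
  assumes "\<forall>k. u k analytic_on {0}"
  shows "same_germs (Y_out f g x a u) (Y_out f g x' b u) \<longleftrightarrow> jet (Y_out f g x a u j0) = jet (Y_out f g x' b u j0)"
  by (rule same_germs_iff_jet[OF m]; rule Y_out_jet(1)) (use deg assms in auto)

lemma identifiable_imp_generated:
  assumes ident: "identifiable f g h" and P: "min_relation F G P"
  shows "h \<in> field_generated (range rf_const \<union> relation_coeffs F G P)"
proof (rule ccontr)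
  assume h: "\<not> ?thesis"
  define A where "A = relation_coeffs F G P"
  have finA: "finite A" unfolding A_def relation_coeffs_def by (simp add: finite_range_coeff)
  define r where "r = degree P"
  have lcP: "lead_coeff P = 1" and stP: "\<And>n. comb (nu F G) P (Some (Inl n)) = 0"
    using P by (auto simp: min_relation_def)
  obtain \<Theta> :: "('n + 'l \<Rightarrow> complex) set" and V :: "('k \<Rightarrow> complex \<Rightarrow> complex) set" where
    \<Theta>: "zariski_open \<Theta>" "\<Theta> \<noteq> {}" and V: "zariski_open_germs V" "V \<noteq> {}" and
    card: "\<And>x0 a u. case_sum x0 a \<in> \<Theta> \<Longrightarrow> u \<in> V \<Longrightarrow> (x0, a, u) \<in> Omega_h f g h \<Longrightarrow> card (S_h f g h x0 a u) = 1"
    using ident unfolding identifiable_def by blast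
  obtain Q :: "('n + 'l, complex) mpoly" where Q: "\<Theta> = {z. mp_eval id z Q \<noteq> 0}" using \<Theta>(1) unfolding zariski_open_def by blast
  obtain z0 where z0: "mp_eval id z0 Q \<noteq> 0" using \<Theta>(2) Q by blast
  obtain u where u: "u \<in> V" using V(2) by blast
  have an: "\<forall>k. u k analytic_on {0}" using V(1) u unfolding zariski_open_germs_def by blast
  define x where "x n = z0 (Inl n)" for n
  \<comment> \<open>With the initial value and the input fixed, \<open>\<Theta>\<close> leaves a
    nonempty open condition \<open>Q'\<close> on the parameters alone.\<close>
  have "poly_fun (\<lambda>a. mp_eval id (\<lambda>v. case_sum x a v) Q)"
  proof (rule poly_fun_mp_eval)
    show "poly_fun (\<lambda>a. case_sum x a v)" for v by (cases v) (simp_all add: poly_fun_const poly_fun_var)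
  qed
  then obtain Q' :: "('l, complex) mpoly" where Q': "\<And>a. mp_eval id (case_sum x a) Q = mp_eval id a Q'"
    unfolding poly_fun_def by (auto simp: fun_eq_iff)
  have "case_sum x (\<lambda>l. z0 (Inr l)) = z0" by (rule ext) (simp add: x_def split: sum.split)
  then have Q'0: "Q' \<noteq> 0" using z0 Q'[of "\<lambda>l. z0 (Inr l)"] by auto
  \<comment> \<open>These functionals will turn prescribed values of the first \<open>r\<close>
    output derivatives into initial values at \<open>b\<close>.\<close>
  obtain L where L: "\<forall>i\<in>{..<r}. \<forall>j\<in>{..<r}. (\<Sum>n\<in>UNIV. L i n * nu F G j (Some (Inl n))) = (if i = j then 1 else 0)"
    using dual_family[of "{..<r}" "\<lambda>i n. nu F G i (Some (Inl n))"] min_relation_independent[OF P] unfolding r_def by auto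
  define D where "D = (\<Union>n. range (F n)) \<union> range G \<union> (\<Union>i\<in>{..<r}. range (L i))"
  have "finite D" unfolding D_def by simp
  from rf_common_denominator[OF this] obtain q where q: "q \<noteq> 0" "\<And>a \<kappa>. mp_eval id a q \<noteq> 0 \<Longrightarrow> \<kappa> \<in> D \<Longrightarrow> rf_defined \<kappa> a"
    by blast
  have "q * Q' \<noteq> 0" using q(1) Q'0 by simp
  from separating_points[OF finA h[folded A_def] this] obtain a b where
    ab: "mp_eval id a (q * Q') \<noteq> 0" "mp_eval id b (q * Q') \<noteq> 0"
    and def: "\<And>\<kappa>. \<kappa> \<in> insert h A \<Longrightarrow> rf_defined \<kappa> a \<and> rf_defined \<kappa> b"
    and eqA: "\<And>\<kappa>. \<kappa> \<in> A \<Longrightarrow> rf_eval a \<kappa> = rf_eval b \<kappa>" and neq: "rf_eval a h \<noteq> rf_eval b h" by blast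
  have qq: "mp_eval id a q \<noteq> 0" "mp_eval id b q \<noteq> 0" "mp_eval id a Q' \<noteq> 0"
    using ab by (simp_all add: mp_eval_mult[OF ring_hom_fun_id])
  have mem: "F n o1 \<in> D" "G o1 \<in> D" for n o1 unfolding D_def by blast+
  have rows: "rows_defined F G a" "rows_defined F G b"
    unfolding rows_defined_def by (intro conjI allI q(2)[OF qq(1)] q(2)[OF qq(2)] mem)+
  have Ldef: "rf_defined (L i n) b" if "i < r" for i n
  proof (rule q(2)[OF qq(2)])
    show "L i n \<in> D" using that unfolding D_def by blast
  qed
  have pd: "defined_coeffs P a" "defined_coeffs P b"
    using def unfolding defined_coeffs_def A_def relation_coeffs_def by blast+
  have \<Omega>a: "(x, a, u) \<in> Omega_h f g h" using rows(1) def an by (simp add: Omega_h_iff)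
  have "case_sum x a \<in> \<Theta>" using qq(3) Q'[of a] by (simp add: Q)
  from card[OF this u \<Omega>a] have card1: "card (S_h f g h x a u) = 1" .
  let ?Y = "jet (Y_out f g x a u j0)" and ?U = "\<lambda>k. jet (u k)"
  obtain X where X: "seq_sol (eval_rows a F) (eval_row a G) X ?U ?Y"
    using output_sequence[OF an, where x = x and a = a] by blast
  let ?Fb = "eval_rows b F" and ?Gb = "eval_row b G"
  \<comment> \<open>What the states have to contribute at \<open>b\<close> to the output derivative
    of order \<open>i\<close> in order to reproduce the output at \<open>a\<close>.\<close>
  define w where "w i = ?Y i - nu ?Fb ?Gb i None - (\<Sum>k\<in>UNIV. act (input_poly ?Fb ?Gb i k) (?U k) 0)" for i
  define x' where "x' n = (\<Sum>i<r. rf_eval b (L i n) * w i)" for n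
  let ?Y' = "jet (Y_out f g x' b u j0)"
  obtain X' where X': "seq_sol ?Fb ?Gb X' ?U ?Y'" "\<And>n. X' n 0 = x' n"
    using output_sequence[OF an, where x = x' and a = b] by blast
  have init: "?Y' j = ?Y j" if j: "j < r" for j
  proof -
    have "(\<Sum>n\<in>UNIV. nu ?Fb ?Gb j (Some (Inl n)) * x' n) = (\<Sum>i<r. (\<Sum>n\<in>UNIV. rf_eval b (L i n) * nu ?Fb ?Gb j (Some (Inl n))) * w i)"
      unfolding x'_def sum_distrib_left sum_distrib_right by (subst sum.swap) (simp add: mult_ac)
    also have "\<dots> = (\<Sum>i<r. if i = j then w j else 0)"
    proof (rule sum.cong[OF refl])
      fix i assume "i \<in> {..<r}"
      then have "rf_eval b (\<Sum>n\<in>UNIV. L i n * nu F G j (Some (Inl n))) = (if i = j then 1 else 0)"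
        using L j by simp
      moreover have "rf_eval b (\<Sum>n\<in>UNIV. L i n * nu F G j (Some (Inl n))) =
          (\<Sum>n\<in>UNIV. rf_eval b (L i n) * nu ?Fb ?Gb j (Some (Inl n)))"
        using Ldef \<open>i \<in> {..<r}\<close> by (simp add: rf_sum rf_mult nu_eval[OF rows(2)])
      ultimately show "(\<Sum>n\<in>UNIV. rf_eval b (L i n) * nu ?Fb ?Gb j (Some (Inl n))) * w i = (if i = j then w j else 0)"
        by simp
    qed
    also have "\<dots> = w j" using j by simp
    finally have "(\<Sum>n\<in>UNIV. nu ?Fb ?Gb j (Some (Inl n)) * x' n) = w j" .
    then show ?thesis using seq_sol_output[OF X'(1), of j 0] X'(2) by (simp add: w_def)
  qed
  have Pab: "eval_poly b P = eval_poly a P"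
    by (rule poly_eqI) (simp add: coeff_eval_poly eqA A_def relation_coeffs_def)
  have "?Y' = ?Y"
  proof (rule outputs_eq[OF X'(1) X, where P = "eval_poly a P"])
    show "lead_coeff (eval_poly a P) = 1" by (rule monic_eval_poly(2)[OF lcP])
    show "comb (nu ?Fb ?Gb) (eval_poly a P) (Some (Inl n)) = 0" for n
      using comb_eval(2)[OF rows(2) pd(2), of "Some (Inl n)"] by (simp add: stP Pab)
    show "comb (nu (eval_rows a F) (eval_row a G)) (eval_poly a P) (Some (Inl n)) = 0" for n
      using comb_eval(2)[OF rows(1) pd(1), of "Some (Inl n)"] by (simp add: stP)
    show "input_comb ?Fb ?Gb (eval_poly a P) k = input_comb (eval_rows a F) (eval_row a G) (eval_poly a P) k" for k
    proof (rule poly_eqI)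
      fix i
      have "coeff (input_comb F G P k) i \<in> A" unfolding A_def relation_coeffs_def by blast
      then show "coeff (input_comb ?Fb ?Gb (eval_poly a P) k) i = coeff (input_comb (eval_rows a F) (eval_row a G) (eval_poly a P) k) i"
        using input_comb_eval(2)[OF rows(1) pd(1), of k i] input_comb_eval(2)[OF rows(2) pd(2), of k i] eqA
        by (simp add: Pab)
    qed
    have "comb (nu F G) P None \<in> A" unfolding A_def relation_coeffs_def by blast
    then show "comb (nu ?Fb ?Gb) (eval_poly a P) None = comb (nu (eval_rows a F) (eval_row a G)) (eval_poly a P) None"
      using comb_eval(2)[OF rows(1) pd(1), of None] comb_eval(2)[OF rows(2) pd(2), of None] eqA by (simp add: Pab)
    show "?Y' i = ?Y i" if "i < degree (eval_poly a P)" for i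
      using that init by (simp add: monic_eval_poly(1)[OF lcP] r_def)
  qed
  then have "same_germs (Y_out f g x a u) (Y_out f g x' b u)" using same_output_iff[OF an] by simp
  moreover have "(x', b, u) \<in> Omega_h f g h" using rows(2) def an by (simp add: Omega_h_iff)
  ultimately have "rf_eval b h \<in> S_h f g h x a u" unfolding S_h_def by blast
  moreover have "rf_eval a h \<in> S_h f g h x a u"
    using \<Omega>a unfolding S_h_def same_germs_def by (auto intro!: exI[of _ a] exI[of _ x])
  ultimately show False using card1 neq by (metis card_1_singletonE singletonD)
qed

text \<open>The conclusion of \<open>output_independent\<close> at \<open>a\<close> mentions only
  \<open>Y\<close> and \<open>U\<close>. As \<open>b\<close> produces the same \<open>Y\<close>, it
  restricts the rows at \<open>b\<close> as well.\<close>

lemma equal_outputs_agree: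
  assumes p: "lead_coeff p = 1" "comb (\<lambda>i. nu F G (Suc i)) p = (\<lambda>_. 0)"
    and rows: "rows_defined F G a" "rows_defined F G b"
    and gen: "generic_initial (eval_rows a F) (eval_row a G) (degree p) (\<lambda>n. X n 0)"
    and U: "input_independent (Suc (degree p) + CARD(('n + 'k) option)) U"
    and sol: "seq_sol (eval_rows a F) (eval_row a G) X U Y" "seq_sol (eval_rows b F) (eval_row b G) X' U Y"
  shows "agree a b (coeff p i)" "agree a b (coeff (input_comb F G (pCons 0 p) k) i)"
    "(\<And>n. comb (nu F G) p (Some (Inl n)) = 0) \<Longrightarrow> agree a b (comb (nu F G) p None)"
proof -
  let ?Fa = "eval_rows a F" and ?Ga = "eval_row a G" and ?Fb = "eval_rows b F" and ?Gb = "eval_row b G"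
  define r where "r = degree p"
  note indep = output_independent[OF sol(1) U gen order_refl]
  \<comment> \<open>A relation among the rows of any system with this output would be a relation for
    \<open>Y\<close>, which \<open>indep\<close> excludes.\<close>
  have ind: "\<forall>i<r. c i = 0" if fin: "\<And>o1. (\<Sum>i<r. c i * nu F' G' (Suc i) o1) = 0"
    and s: "seq_sol F' G' X'' U Y" for c and F' :: "'n \<Rightarrow> ('n, 'k, complex) row" and G' X''
  proof -
    obtain q where q: "\<And>i. coeff q i = (if i < r then c i else 0)" "q = 0 \<or> degree q < r"
      using poly_of_coeffs by blast
    have comb0: "comb (\<lambda>i. nu F' G' (Suc i)) q o1 = 0" for o1 using fin by (simp add: comb_lessThan[OF q(1)])
    have "q = 0"
    proof (rule indep(1))
      show "q = 0 \<or> degree q < degree p" using q(2) by (simp add: r_def)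
      show "coeff (- input_comb F' G' (pCons 0 q) k) 0 = 0" for k by (simp add: input_comb_pCons comb0)
      show "degree (- input_comb F' G' (pCons 0 q) k) \<le> Suc (degree p)" for k
        using degree_input_comb[of F' G' "pCons 0 q" k] q(2) by (auto simp: r_def split: if_splits)
      show "act (pCons 0 q) Y s + (\<Sum>k\<in>UNIV. act (- input_comb F' G' (pCons 0 q) k) (U k) s) = 0" for s
        unfolding act_output[OF s] by (simp add: comb_pCons comb0 act_uminus sum_negf)
    qed
    then show ?thesis using q(1) by (metis coeff_0)
  qed
  have coeffs_def: "defined_coeffs p c" if rc: "rows_defined F G c" and s: "seq_sol (eval_rows c F) (eval_row c G) X'' U Y" for c X''
  proof -
    \<comment> \<open>The relation expresses row \<open>Suc r\<close> by the rows 1 to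
      \<open>r\<close>, whose values at \<open>c\<close> are independent by
      \<open>ind\<close>.\<close>
    have "\<forall>i\<in>{..<r}. rf_defined (- coeff p i) c"
    proof (rule local_solution[where v = "\<lambda>i. nu F G (Suc i)" and w = "nu F G (Suc r)"])
      show "rf_defined (nu F G (Suc i) o1) c" for i o1 by (rule nu_eval(1)[OF rc])
      show "rf_defined (nu F G (Suc r) o1) c" for o1 by (rule nu_eval(1)[OF rc])
      show "nu F G (Suc r) o1 = (\<Sum>i<r. - coeff p i * nu F G (Suc i) o1)" for o1
      proof -
        have "0 = comb (\<lambda>i. nu F G (Suc i)) p o1" by (simp add: p(2))
        also have "\<dots> = (\<Sum>i<r. coeff p i * nu F G (Suc i) o1) + nu F G (Suc r) o1"
          using p(1) by (simp add: comb_def r_def lessThan_Suc_atMost[symmetric])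
        finally show ?thesis by (simp add: sum_negf eq_neg_iff_add_eq_0 add.commute)
      qed
      fix d assume "\<And>o1. (\<Sum>i<r. d i * rf_eval c (nu F G (Suc i) o1)) = 0"
      then show "\<forall>i\<in>{..<r}. d i = 0" using ind[OF _ s, of d] by (simp add: nu_eval[OF rc])
    qed simp
    then have "rf_defined (coeff p i) c" if "i < r" for i using rf_uminus(1)[of "- coeff p i" c] that by simp
    moreover have "rf_defined (coeff p i) c" if "\<not> i < r" for i
    proof (cases "i = r")
      case True
      then show ?thesis using p(1) by (simp add: r_def)
    next
      case False
      then have "coeff p i = 0" using that by (intro coeff_eq_0) (simp add: r_def)
      then show ?thesis by simp
    qed
    ultimately show ?thesis unfolding defined_coeffs_def by blast
  qed
  have pd: "defined_coeffs p a" "defined_coeffs p b"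
    using coeffs_def[OF rows(1) sol(1)] coeffs_def[OF rows(2) sol(2)] by auto
  have pd0: "defined_coeffs (pCons 0 p) a" "defined_coeffs (pCons 0 p) b"
    using pd by (auto simp: defined_coeffs_def coeff_pCons split: nat.split)
  let ?pa = "eval_poly a p" and ?pb = "eval_poly b p"
  have comb_a: "comb (nu ?Fa ?Ga) (pCons 0 ?pa) o1 = 0" for o1
    using comb_eval(2)[OF rows(1) pd0(1), of o1] p(2) by (simp add: eval_poly_pCons comb_pCons)
  have comb_b: "comb (nu ?Fb ?Gb) (pCons 0 ?pb) o1 = 0" for o1
    using comb_eval(2)[OF rows(2) pd0(2), of o1] p(2) by (simp add: eval_poly_pCons comb_pCons)
  \<comment> \<open>Input part of the difference of the two equations for \<open>Y\<close>. In the
    difference the monic terms cancel, and undifferentiated inputs do not occur, because both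
    operators annihilate all entries of the rows.\<close>
  define d where "d k = input_comb ?Fb ?Gb (pCons 0 ?pb) k - input_comb ?Fa ?Ga (pCons 0 ?pa) k" for k
  have small: "?pa - ?pb = 0 \<or> degree (?pa - ?pb) < degree p"
  proof -
    have "coeff (?pa - ?pb) (degree p) = 0" using p(1) by (simp add: coeff_eval_poly)
    moreover have "degree (?pa - ?pb) \<le> degree p" by (intro degree_diff_le degree_eval_poly_le)
    ultimately show ?thesis by (metis le_neq_implies_less leading_coeff_0_iff)
  qed
  have d0: "coeff (d k) 0 = 0" for k
    using comb_a comb_b by (simp add: d_def input_comb_pCons comb_pCons)
  have ddeg: "degree (d k) \<le> Suc (degree p)" for k
    unfolding d_def
    by (intro degree_diff_le order_trans[OF degree_input_comb] order_trans[OF degree_pCons_le] Suc_le_mono[THEN iffD2] degree_eval_poly_le)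
  have rel: "act (pCons 0 (?pa - ?pb)) Y s + (\<Sum>k\<in>UNIV. act (d k) (U k) s) = 0" for s
  proof -
    have "act (pCons 0 ?pa) Y s = (\<Sum>k\<in>UNIV. act (input_comb ?Fa ?Ga (pCons 0 ?pa) k) (U k) s)"
      unfolding act_output[OF sol(1)] by (simp add: comb_a)
    moreover have "act (pCons 0 ?pb) Y s = (\<Sum>k\<in>UNIV. act (input_comb ?Fb ?Gb (pCons 0 ?pb) k) (U k) s)"
      unfolding act_output[OF sol(2)] by (simp add: comb_b)
    moreover have "pCons 0 (?pa - ?pb) = pCons 0 ?pa - pCons 0 ?pb" by simp
    ultimately show ?thesis by (simp only: act_diff d_def sum_subtractf) simp
  qed
  have "?pa - ?pb = 0" "\<And>k. d k = 0" using indep[OF small d0 ddeg rel] by auto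
  then have eq: "?pa = ?pb" "input_comb ?Fb ?Gb (pCons 0 ?pb) k = input_comb ?Fa ?Ga (pCons 0 ?pa) k" for k
    by (simp_all add: d_def)
  show "agree a b (coeff p i)"
    using pd eq(1) unfolding agree_def defined_coeffs_def by (metis coeff_eval_poly)
  have inp: "agree a b (coeff (input_comb F G (pCons 0 p) k) i)" for k i
    unfolding agree_def using input_comb_eval[OF rows(1) pd0(1), of k i] input_comb_eval[OF rows(2) pd0(2), of k i] eq(2)
    by (simp add: eval_poly_pCons)
  then show "agree a b (coeff (input_comb F G (pCons 0 p) k) i)" .
  \<comment> \<open>If \<open>p\<close> already eliminates the states before differentiation,
    comparing the undifferentiated equations at 0 gives the constant term.\<close>
  assume st: "\<And>n. comb (nu F G) p (Some (Inl n)) = 0"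
  have st_a: "comb (nu ?Fa ?Ga) ?pa (Some (Inl n)) = 0" and st_b: "comb (nu ?Fb ?Gb) ?pb (Some (Inl n)) = 0" for n
    using comb_eval(2)[OF rows(1) pd(1), of "Some (Inl n)"] comb_eval(2)[OF rows(2) pd(2), of "Some (Inl n)"] by (simp_all add: st)
  have "input_comb ?Fb ?Gb ?pb k = input_comb ?Fa ?Ga ?pa k" for k
    using eq(2)[of k] by (simp add: input_comb_pCons)
  then have "comb (nu ?Fa ?Ga) ?pa None = comb (nu ?Fb ?Gb) ?pb None"
    using act_output[OF sol(1), of ?pa 0] act_output[OF sol(2), of ?pb 0] by (simp add: st_a[unfolded eq(1)] st_b eq(1))
  then show "agree a b (comb (nu F G) p None)"
    unfolding agree_def using comb_eval[OF rows(1) pd(1), of None] comb_eval[OF rows(2) pd(2), of None] by simp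
qed

lemma generated_imp_identifiable:
  assumes P: "min_relation F G P" and h: "h \<in> field_generated (range rf_const \<union> relation_coeffs F G P)"
  shows "identifiable f g h"
proof -
  obtain p where p: "lead_coeff p = 1" "comb (\<lambda>i. nu F G (Suc i)) p = (\<lambda>_. 0)"
    and p_indep: "\<And>c. (\<And>o1. (\<Sum>i<degree p. c i * nu F G (Suc i) o1) = 0) \<Longrightarrow> \<forall>i<degree p. c i = 0"
    and Pp: "P = p \<or> P = pCons 0 p"
    using reduced_relation[OF P] by blast
  define r where "r = degree p"
  obtain Q where Q: "Q \<noteq> 0" "\<And>a b. mp_eval id a Q \<noteq> 0 \<Longrightarrow> \<forall>\<kappa>\<in>relation_coeffs F G P. agree a b \<kappa> \<Longrightarrow> agree a b h"
    using field_generated_agree[OF h] by blast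
  \<comment> \<open>Independence here concerns all entries of the rows, not only the state entries:
    this is the sense in which the reduced relation is minimal.\<close>
  obtain L where L: "\<forall>i\<in>{..<r}. \<forall>j\<in>{..<r}. (\<Sum>o1\<in>UNIV. L i o1 * nu F G (Suc j) o1) = (if i = j then 1 else 0)"
    using dual_family[of "{..<r}" "\<lambda>i o1. nu F G (Suc i) o1"] p_indep unfolding r_def by auto
  define D where "D = (\<Union>n. range (F n)) \<union> range G \<union> (\<Union>i\<in>{..<r}. range (L i)) \<union> range (coeff p)"
  have "finite D" unfolding D_def by (simp add: finite_range_coeff)
  from rf_common_denominator[OF this] obtain q where q: "q \<noteq> 0" "\<And>a \<kappa>. mp_eval id a q \<noteq> 0 \<Longrightarrow> \<kappa> \<in> D \<Longrightarrow> rf_defined \<kappa> a"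
    by blast
  \<comment> \<open>A single good parameter value, at which everything needed is defined and the
    rows stay independent; it shows that the open conditions are nonempty.\<close>
  obtain a0 where "mp_eval id a0 (q * Q) \<noteq> 0" using nonvanishing_point[of "q * Q"] q(1) Q(1) by auto
  then have a0: "mp_eval id a0 q \<noteq> 0" "mp_eval id a0 Q \<noteq> 0" by (simp_all add: mp_eval_mult[OF ring_hom_fun_id])
  let ?F0 = "eval_rows a0 F" and ?G0 = "eval_row a0 G"
  have "F n o1 \<in> (\<Union>n. range (F n))" for n o1 by blast
  then have mem: "F n o1 \<in> D" "G o1 \<in> D" "coeff p i \<in> D" for n o1 i
    by (simp_all only: D_def Un_iff rangeI simp_thms)
  have rows0: "rows_defined F G a0" unfolding rows_defined_def by (intro conjI allI q(2)[OF a0(1)] mem)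
  have pd0: "defined_coeffs p a0" unfolding defined_coeffs_def by (intro allI q(2)[OF a0(1)] mem)
  have L0: "rf_defined (L i o1) a0" if "i < r" for i o1
  proof (rule q(2)[OF a0(1)])
    show "L i o1 \<in> D" unfolding D_def by (rule UnI1, rule UnI2, rule UN_I[of i]) (use that in auto)
  qed
  have "\<exists>x. generic_initial ?F0 ?G0 (degree (eval_poly a0 p)) x"
  proof (rule generic_initial_exists)
    show "lead_coeff (eval_poly a0 p) = 1" by (rule monic_eval_poly(2)[OF p(1)])
    show "comb (\<lambda>i. nu ?F0 ?G0 (Suc i)) (eval_poly a0 p) = (\<lambda>_. 0)"
    proof
      have "defined_coeffs (pCons 0 p) a0"
        using pd0 by (auto simp: defined_coeffs_def coeff_pCons split: nat.split)
      from comb_eval(2)[OF rows0 this] show "comb (\<lambda>i. nu ?F0 ?G0 (Suc i)) (eval_poly a0 p) o1 = 0" for o1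
        by (simp add: eval_poly_pCons comb_pCons p(2))
    qed
    fix c assume c: "\<And>o1. (\<Sum>i<degree (eval_poly a0 p). c i * nu ?F0 ?G0 (Suc i) o1) = 0"
    have "\<forall>i<r. c i = 0"
    proof (rule dual_family_independent[where L = "\<lambda>i o1. rf_eval a0 (L i o1)" and v = "\<lambda>j o1. nu ?F0 ?G0 (Suc j) o1"])
      show "(\<Sum>j<r. c j * nu ?F0 ?G0 (Suc j) o1) = 0" for o1
        using c[of o1] by (simp add: monic_eval_poly(1)[OF p(1)] r_def)
      fix i j assume ij: "i < r" "j < r"
      then have "rf_eval a0 (\<Sum>o1\<in>UNIV. L i o1 * nu F G (Suc j) o1) = (if i = j then 1 else 0)" using L by simp
      then show "(\<Sum>o1\<in>UNIV. rf_eval a0 (L i o1) * nu ?F0 ?G0 (Suc j) o1) = (if i = j then 1 else 0)"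
        using L0[OF ij(1)] by (simp add: rf_sum rf_mult nu_eval[OF rows0])
    qed
    then show "\<forall>i<degree (eval_poly a0 p). c i = 0" by (simp add: monic_eval_poly(1)[OF p(1)] r_def)
  qed
  then obtain x0 where "generic_initial ?F0 ?G0 r x0" by (auto simp: monic_eval_poly(1)[OF p(1)] r_def)
  from generic_initial_open[OF rows0 this] obtain P1 :: "('n + 'l \<Rightarrow> complex) \<Rightarrow> complex" where
    P1: "poly_fun P1" "P1 (case_sum x0 a0) \<noteq> 0"
    "\<And>x a. P1 (case_sum x a) \<noteq> 0 \<Longrightarrow> rows_defined F G a \<Longrightarrow> generic_initial (eval_rows a F) (eval_row a G) r x" by blast
  \<comment> \<open>Both factors are conditions on the point \<open>(x, a)\<close>: generic initial
    values, and avoidance of the zeros of \<open>Q\<close>. Nothing is imposed on the second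
    point.\<close>
  have "poly_fun (\<lambda>z. P1 z * mp_eval id (\<lambda>l. z (Inr l)) Q)"
    by (intro poly_fun_mult P1(1) poly_fun_mp_eval poly_fun_var)
  then obtain T :: "('n + 'l, complex) mpoly" where T: "\<And>z. mp_eval id z T = P1 z * mp_eval id (\<lambda>l. z (Inr l)) Q"
    unfolding poly_fun_def by (auto simp: fun_eq_iff)
  define \<Theta> where "\<Theta> = {z. mp_eval id z T \<noteq> 0}"
  have \<Theta>: "zariski_open \<Theta>" unfolding zariski_open_def \<Theta>_def by blast
  have "case_sum x0 a0 \<in> \<Theta>" using P1(2) a0(2) by (simp add: \<Theta>_def T)
  then have \<Theta>_ne: "\<Theta> \<noteq> {}" by blast
  define N where "N = Suc r + CARD(('n + 'k) option)"
  obtain P2 :: "('k \<times> nat \<Rightarrow> complex) \<Rightarrow> complex" and z2 where P2: "poly_fun P2" "\<And>z. P2 z \<noteq> 0 \<Longrightarrow> input_independent N (\<lambda>k i. z (k, i))"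
    and z2: "P2 z2 \<noteq> 0" "\<And>k. finite {i. z2 (k, i) \<noteq> 0}"
    using input_independent_open[of N] by blast
  obtain T2 :: "('k, complex) dpoly" where T2: "P2 = (\<lambda>z. mp_eval id z T2)" using P2(1) unfolding poly_fun_def by blast
  define V where "V = {z. (\<forall>j. z j analytic_on {0}) \<and> mp_eval id (\<lambda>(j, i). (deriv ^^ i) (z j) 0) T2 \<noteq> 0}"
  have V: "zariski_open_germs V" unfolding zariski_open_germs_def V_def by blast
  have V_eq: "u \<in> V \<longleftrightarrow> (\<forall>k. u k analytic_on {0}) \<and> P2 (\<lambda>(k, i). jet (u k) i) \<noteq> 0" for u
    unfolding V_def T2 jet_def by simp
  obtain u0 where u0: "\<And>k. u0 k analytic_on {0}" "\<And>k. jet (u0 k) = (\<lambda>i. z2 (k, i))"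
    using inputs_with_jets[of "\<lambda>k i. z2 (k, i)"] z2(2) by blast
  have "(\<lambda>(k, i). jet (u0 k) i) = z2" by (auto simp: u0(2))
  then have "u0 \<in> V" using u0(1) z2(1) by (simp add: V_eq)
  then have V_ne: "V \<noteq> {}" by blast
  have "card (S_h f g h x a u) = 1" if "case_sum x a \<in> \<Theta>" "u \<in> V" "(x, a, u) \<in> Omega_h f g h" for x a u
  proof -
    have nz: "P1 (case_sum x a) \<noteq> 0" "mp_eval id a Q \<noteq> 0" using that(1) by (auto simp: \<Theta>_def T)
    have rows_a: "rows_defined F G a" and an: "\<forall>k. u k analytic_on {0}" using that(3) by (auto simp: Omega_h_iff)
    have U: "input_independent N (\<lambda>k. jet (u k))" using P2(2)[of "\<lambda>(k, i). jet (u k) i"] that(2) by (simp add: V_eq)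
    obtain X where X: "seq_sol (eval_rows a F) (eval_row a G) X (\<lambda>k. jet (u k)) (jet (Y_out f g x a u j0))" "\<forall>n. X n 0 = x n"
      using output_sequence[OF an, where x = x and a = a] by blast
    have gen: "generic_initial (eval_rows a F) (eval_row a G) (degree p) (\<lambda>n. X n 0)"
      using P1(3)[OF nz(1) rows_a] X(2) by (simp add: r_def)
    have "rf_eval b h = rf_eval a h" if b: "(x', b, u) \<in> Omega_h f g h" "same_germs (Y_out f g x a u) (Y_out f g x' b u)" for x' b
    proof -
      have rows_b: "rows_defined F G b" using b(1) by (simp add: Omega_h_iff)
      obtain X' where "seq_sol (eval_rows b F) (eval_row b G) X' (\<lambda>k. jet (u k)) (jet (Y_out f g x' b u j0))"
        using output_sequence[OF an, where x = x' and a = b] by blast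
      then have X': "seq_sol (eval_rows b F) (eval_row b G) X' (\<lambda>k. jet (u k)) (jet (Y_out f g x a u j0))"
        using b(2) same_output_iff[OF an] by simp
      note agr = equal_outputs_agree[OF p rows_a rows_b gen U[unfolded N_def r_def] X(1) X']
      have zero: "agree a b 0" by (simp add: agree_def)
      have coeffs: "agree a b (coeff P i)" for i
        using Pp agr(1) zero by (auto simp: coeff_pCons split: nat.split)
      have inputs: "agree a b (coeff (input_comb F G P k) i)" for k i
      proof -
        from Pp show ?thesis
        proof
          assume "P = p"
          \<comment> \<open>The agreement is known for the differentiated equation; the index shift
            undoes the differentiation.\<close>
          then show ?thesis using agr(2)[of k "Suc i"] by (simp add: input_comb_pCons)
        qed (use agr(2) in simp)
      qed
      \<comment> \<open>For \<open>P = pCons 0 p\<close> the constant term is zero; otherwise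
        \<open>P = p\<close> has no state entries and the last conclusion of
        \<open>equal_outputs_agree\<close> applies.\<close>
      have const: "agree a b (comb (nu F G) P None)"
      proof -
        from Pp show ?thesis
        proof
          assume "P = p"
          then show ?thesis using P agr(3) by (simp add: min_relation_def)
        qed (simp add: comb_pCons p(2) zero)
      qed
      have "agree a b h"
        using coeffs inputs const by (intro Q(2)[OF nz(2)]) (auto simp: relation_coeffs_def)
      then show ?thesis by (simp add: agree_def)
    qed
    moreover have "same_germs (Y_out f g x a u) (Y_out f g x a u)" by (simp add: same_germs_def)
    ultimately have "S_h f g h x a u = {rf_eval a h}"
      using that(3) unfolding S_h_def by blast
    then show ?thesis by simp
  qed
  then show ?thesis
    unfolding identifiable_def using \<Theta> \<Theta>_ne V V_ne by blast
qed

end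

theorem mainTheorem1:
  fixes f :: "'n::finite \<Rightarrow> ('n, 'k::finite, 'l::{finite,linorder}) syspoly"
    and g :: "'m::finite \<Rightarrow> ('n, 'k, 'l) syspoly"
    and h :: "'l ratfun"
  assumes "\<And>i. total_degree (f i) \<le> 1"
    and "\<And>j. total_degree (g j) \<le> 1"
    and "CARD('m) = 1"
  shows "identifiable f g h \<longleftrightarrow> IO_identifiable f g h"
proof -
  obtain j0 :: 'm where m: "UNIV = {j0}" using assms(3) card_1_singletonE by blast
  let ?F = "\<lambda>i. coeff_row (f i)" and ?G = "coeff_row (g j0)"
  note sys = assms(1,2) m refl refl
  obtain P where "min_relation ?F ?G P" using min_relation_exists by blast
  then have "identifiable f g h \<longleftrightarrow> (\<exists>P. min_relation ?F ?G P \<and> h \<in> field_generated (range rf_const \<union> relation_coeffs ?F ?G P))"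
    using identifiable_imp_generated[of f g, OF sys] generated_imp_identifiable[of f g, OF sys] by blast
  then show ?thesis by (simp only: IO_identifiable_iff[of f g, OF assms(1,2) m])
qed



end
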